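(* The group $G=\pi_1(X(\Theta))$ embeds as an index $6$ subgroup in the Artin group $$A_{2,3,\infty}=\langle a,b,c\mid ab=ba,\ bcb=cbc\rangle .$$
   Context: The graph of graphs $X(\Theta)$ is defined as follows. Let $\Theta$ be the theta-graph: two vertices $v,w$ and three edges $e_0,e_1,e_2$, each with initial vertex $v$ and terminal vertex $w$. Indices are taken modulo $3$. - The vertex graph $X_v$ is a triangle with vertices $v_0,v_1,v_2$ and oriented edges $x_j$ from $v_j$ to $v_{j+1}$, together with an oriented loop $a_j$ attached at each $v_j$. - The vertex graph $X_w$ is a triangle with vertices $w_0,w_1,w_2$ and oriented edges $\bar x_j$ from $w_j$ to $w_{j+1}$, together with an oriented loop $\bar a_j$ attached at each $w_j$. - For each $i$, the edge graph $X_{e_i}$ is a bigon with vertices $p_i,q_i$ and oriented edges $\alpha_i$ from $p_i$ to $q_i$ and $\beta_i$ from $q_i$ to $p_i$, together with an oriented loop $\lambda_i$ at $p_i$ and an oriented loop $\mu_i$ at $q_i$. - The edge map $f^{\iota}_{e_i}:X_{e_i}\to X_v$ sends $p_i\mapsto v_i$, $q_i\mapsto v_{i-1}$, maps $\alpha_i$ homeomorphically onto the length-two path $x_i x_{i+1}$, maps $\beta_i$ onto the edge $x_{i-1}$, $\lambda_i$ onto $a_i$ and $\mu_i$ onto $a_{i-1}$, preserving orientations. - The edge map $f^{\tau}_{e_i}:X_{e_i}\to X_w$ sends $p_i\mapsto w_i$, $q_i\mapsto w_{i+1}$, maps $\alpha_i$ onto the edge $\bar x_i$, maps $\beta_i$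 homeomorphically onto the length-two path $\bar x_{i+1}\bar x_{i+2}$, $\lambda_i$ onto $\bar a_i$ and $\mu_i$ onto $\bar a_{i+1}$, preserving orientations. The total space is $\left(X_v\sqcup X_w\sqcup\bigsqcup_i X_{e_i}\times[0,1]\right)/\sim$ with $(y,0)\sim f^{\iota}_{e_i}(y)$ and $(y,1)\sim f^{\tau}_{e_i}(y)$ for $y\in X_{e_i}$, and $G$ is its fundamental group. Equivalently, $G$ is the fundamental group of the associated graph of groups $G(\Theta)$, with vertex groups $\pi_1(X_v)\cong\pi_1(X_w)\cong F_4$, three edge groups $\pi_1(X_{e_i})\cong F_3$, and edge homomorphisms induced by the maps above. *)

theory Defs
  imports
    "HOL-Analysis.Analysis"
    "HOL-Algebra.Coset"
    "Graph_Theory.Digraph"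
    "HOL-Library.Numeral_Type"
begin

section \<open>Groups given by presentations\<close>

text \<open>
  A word is a list of letters; \<open>(g, True)\<close> stands for the generator \<open>g\<close> and
  \<open>(g, False)\<close> for its inverse. All elements of the type \<open>'g\<close> are generators, and a set of
  pairs of words lists the defining relations as equations.
\<close>

type_synonym 'g word = "('g \<times> bool) list"

inductive word_eq :: "('g word \<times> 'g word) set \<Rightarrow> 'g word \<Rightarrow> 'g word \<Rightarrow> bool"
  for R where
  refl: "word_eq R u u"
| sym: "word_eq R u v \<Longrightarrow> word_eq R v u"
| trans: "word_eq R u v \<Longrightarrow> word_eq R v w \<Longrightarrow> word_eq R u w"
| append: "word_eq R u u' \<Longrightarrow> word_eq R v v' \<Longrightarrow> word_eq R (u @ v) (u' @ v')"
| cancel: "word_eq R [(g, b), (g, \<not> b)] []"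
| relation: "(l, r) \<in> R \<Longrightarrow> word_eq R l r"

definition word_class :: "('g word \<times> 'g word) set \<Rightarrow> 'g word \<Rightarrow> 'g word set" where
  "word_class R u = {v. word_eq R u v}"

definition presented_group :: "('g word \<times> 'g word) set \<Rightarrow> 'g word set monoid" where
  "presented_group R =
     \<lparr>carrier = range (word_class R),
      mult = (\<lambda>A B. {w. \<exists>u\<in>A. \<exists>v\<in>B. word_eq R (u @ v) w}),
      one = word_class R []\<rparr>"

lemma word_class_eq_iff: "word_class R u = word_class R v \<longleftrightarrow> word_eq R u v"
  unfolding word_class_def by (auto intro: word_eq.intros)

lemma mult_presented_group:
  "word_class R u \<otimes>\<^bsub>presented_group R\<^esub> word_class R v = word_class R (u @ v)"
  unfolding presented_group_def word_class_def
  by (auto intro: word_eq.refl word_eq.trans word_eq.append)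

lemma word_eq_inverse:
  "word_eq R (map (\<lambda>(g, b). (g, \<not> b)) (rev u) @ u) []"
proof (induction u)
  case Nil
  show ?case by (simp add: word_eq.refl)
next
  case (Cons l u)
  obtain g b where l: "l = (g, b)" by fastforce
  let ?i = "map (\<lambda>(g, b). (g, \<not> b)) (rev u)"
  have "word_eq R ([(g, \<not> b), (g, b)] @ u) ([] @ u)"
    using word_eq.append[OF word_eq.cancel[of R g "\<not> b"] word_eq.refl[of R u]] by simp
  then have "word_eq R (?i @ ([(g, \<not> b), (g, b)] @ u)) (?i @ ([] @ u))"
    by (rule word_eq.append[OF word_eq.refl])
  from word_eq.trans[OF this] Cons.IH show ?case
    by (simp add: l)
qed

lemma group_presented_group: "group (presented_group R)"
proof (rule groupI)
  fix x assume "x \<in> carrier (presented_group R)"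
  then obtain u where x: "x = word_class R u"
    by (auto simp: presented_group_def)
  have "word_class R (map (\<lambda>(g, b). (g, \<not> b)) (rev u)) \<otimes>\<^bsub>presented_group R\<^esub> x
      = \<one>\<^bsub>presented_group R\<^esub>"
    using word_eq_inverse
    by (simp add: x mult_presented_group word_class_eq_iff) (simp add: presented_group_def word_class_eq_iff)
  then show "\<exists>y\<in>carrier (presented_group R). y \<otimes>\<^bsub>presented_group R\<^esub> x = \<one>\<^bsub>presented_group R\<^esub>"
    by (rule bexI) (simp add: presented_group_def)
  show "\<one>\<^bsub>presented_group R\<^esub> \<otimes>\<^bsub>presented_group R\<^esub> x = x"
    using mult_presented_group[of R "[]" u] by (simp add: x presented_group_def)
next
  fix x y
  assume "x \<in> carrier (presented_group R)" "y \<in> carrier (presented_group R)"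
  then obtain u v where "x = word_class R u" "y = word_class R v"
    by (auto simp: presented_group_def)
  then show "x \<otimes>\<^bsub>presented_group R\<^esub> y \<in> carrier (presented_group R)"
    by (simp add: mult_presented_group) (simp add: presented_group_def)
next
  fix x y z
  assume "x \<in> carrier (presented_group R)" "y \<in> carrier (presented_group R)"
    "z \<in> carrier (presented_group R)"
  then obtain u v w where "x = word_class R u" "y = word_class R v" "z = word_class R w"
    by (auto simp: presented_group_def)
  then show "x \<otimes>\<^bsub>presented_group R\<^esub> y \<otimes>\<^bsub>presented_group R\<^esub> z
      = x \<otimes>\<^bsub>presented_group R\<^esub> (y \<otimes>\<^bsub>presented_group R\<^esub> z)"
    by (simp add: mult_presented_group)
qed (simp add: presented_group_def)

datatype artin_gen = gen_a | gen_b | gen_c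

definition pos_word :: "'g list \<Rightarrow> 'g word" where
  "pos_word gs = map (\<lambda>g. (g, True)) gs"

definition artin_23inf :: "artin_gen word set monoid" where
  "artin_23inf = presented_group
     {(pos_word [gen_a, gen_b], pos_word [gen_b, gen_a]),
      (pos_word [gen_b, gen_c, gen_b], pos_word [gen_c, gen_b, gen_c])}"

section \<open>The fundamental group of an abstract topological space\<close>

definition loops_at :: "'a topology \<Rightarrow> 'a \<Rightarrow> (real \<Rightarrow> 'a) set" where
  "loops_at X x = {p. pathin X p \<and> p 0 = x \<and> p 1 = x}"

definition loop_homotopic :: "'a topology \<Rightarrow> 'a \<Rightarrow> (real \<Rightarrow> 'a) \<Rightarrow> (real \<Rightarrow> 'a) \<Rightarrow> bool" where
  "loop_homotopic X x = homotopic_with (\<lambda>r. r 0 = x \<and> r 1 = x) (top_of_set {0..1}) X"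

text \<open>The library's \<^const>\<open>joinpaths\<close> is restricted to types of class \<^class>\<open>topological_space\<close>.\<close>

definition path_concat :: "(real \<Rightarrow> 'a) \<Rightarrow> (real \<Rightarrow> 'a) \<Rightarrow> real \<Rightarrow> 'a" where
  "path_concat p q = (\<lambda>t. if t \<le> 1 / 2 then p (2 * t) else q (2 * t - 1))"

definition loop_class :: "'a topology \<Rightarrow> 'a \<Rightarrow> (real \<Rightarrow> 'a) \<Rightarrow> (real \<Rightarrow> 'a) set" where
  "loop_class X x p = {q. loop_homotopic X x p q}"

definition fundamental_group :: "'a topology \<Rightarrow> 'a \<Rightarrow> (real \<Rightarrow> 'a) set monoid" where
  "fundamental_group X x =
     \<lparr>carrier = loop_class X x ` loops_at X x,
      mult = (\<lambda>P Q. {r. \<exists>p\<in>P. \<exists>q\<in>Q. loop_homotopic X x (path_concat p q) r}),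
      one = loop_class X x (\<lambda>_. x)\<rparr>"

section \<open>Quotient spaces and disjoint unions\<close>

text \<open>
  The equivalence relation on the points of \<open>X\<close> generated by \<open>r\<close>; the quotient space consists
  of its classes.
\<close>

definition gen_equiv :: "'a topology \<Rightarrow> ('a \<Rightarrow> 'a \<Rightarrow> bool) \<Rightarrow> ('a \<times> 'a) set" where
  "gen_equiv X r = {(x, y). x \<in> topspace X \<and> y \<in> topspace X \<and>
     equivclp (\<lambda>x y. x \<in> topspace X \<and> y \<in> topspace X \<and> r x y) x y}"

definition quotient_point :: "'a topology \<Rightarrow> ('a \<Rightarrow> 'a \<Rightarrow> bool) \<Rightarrow> 'a \<Rightarrow> 'a set" where
  "quotient_point X r x = gen_equiv X r `` {x}"

definition quotient_space :: "'a topology \<Rightarrow> ('a \<Rightarrow> 'a \<Rightarrow> bool) \<Rightarrow> 'a set topology" where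
  "quotient_space X r =
     topology (\<lambda>U. U \<subseteq> topspace X // gen_equiv X r \<and> openin X {x \<in> topspace X. quotient_point X r x \<in> U})"

lemma istopology_quotient_space:
  "istopology (\<lambda>U. U \<subseteq> topspace X // gen_equiv X r \<and> openin X {x \<in> topspace X. quotient_point X r x \<in> U})"
proof -
  have 1: "{x \<in> topspace X. quotient_point X r x \<in> S \<inter> T}
      = {x \<in> topspace X. quotient_point X r x \<in> S} \<inter> {x \<in> topspace X. quotient_point X r x \<in> T}" for S T
    by auto
  have 2: "{x \<in> topspace X. quotient_point X r x \<in> \<Union>K} = (\<Union>S\<in>K. {x \<in> topspace X. quotient_point X r x \<in> S})" for K
    by auto
  show ?thesis
    unfolding istopology_def 1 2 by blast
qed

lemma openin_quotient_space:
  "openin (quotient_space X r) U \<longleftrightarrow>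
     U \<subseteq> topspace X // gen_equiv X r \<and> openin X {x \<in> topspace X. quotient_point X r x \<in> U}"
  by (simp add: quotient_space_def istopology_quotient_space)

lemma equiv_gen_equiv: "equiv (topspace X) (gen_equiv X r)"
  unfolding gen_equiv_def equiv_def
  by (auto intro!: refl_onI symI transI intro: equivclp_sym equivclp_trans)

lemma quotient_point_eq_iff:
  assumes "x \<in> topspace X" "y \<in> topspace X"
  shows "quotient_point X r x = quotient_point X r y \<longleftrightarrow> (x, y) \<in> gen_equiv X r"
  using eq_equiv_class_iff[OF equiv_gen_equiv assms] by (simp add: quotient_point_def)

lemma topspace_quotient_space [simp]:
  "topspace (quotient_space X r) = quotient_point X r ` topspace X"
proof -
  have "{x \<in> topspace X. quotient_point X r x \<in> topspace X // gen_equiv X r} = topspace X"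
    by (auto simp: quotient_point_def intro: quotientI)
  then have "openin (quotient_space X r) (topspace X // gen_equiv X r)"
    by (simp add: openin_quotient_space)
  then have "topspace (quotient_space X r) = topspace X // gen_equiv X r"
    by (meson openin_quotient_space openin_subset openin_topspace subset_antisym)
  then show ?thesis
    by (auto simp: quotient_def quotient_point_def)
qed

lemma quotient_map_quotient_point: "quotient_map X (quotient_space X r) (quotient_point X r)"
  unfolding quotient_map_def
  by (auto simp: openin_quotient_space quotient_def quotient_point_def)

definition plus_topology :: "'a topology \<Rightarrow> 'b topology \<Rightarrow> ('a + 'b) topology" where
  "plus_topology X Y =
     topology (\<lambda>U. openin X (Inl -` U) \<and> openin Y (Inr -` U))"

lemma openin_plus_topology:
  "openin (plus_topology X Y) U \<longleftrightarrow> openin X (Inl -` U) \<and> openin Y (Inr -` U)"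
proof -
  have "istopology (\<lambda>U. openin X (Inl -` U) \<and> openin Y (Inr -` U))"
    unfolding istopology_def vimage_Int vimage_Union by blast
  then show ?thesis
    by (simp add: plus_topology_def)
qed

lemma topspace_plus_topology [simp]:
  "topspace (plus_topology X Y) = topspace X <+> topspace Y"
proof
  have "openin (plus_topology X Y) (topspace (plus_topology X Y))"
    by simp
  then have "Inl -` topspace (plus_topology X Y) \<subseteq> topspace X"
    "Inr -` topspace (plus_topology X Y) \<subseteq> topspace Y"
    unfolding openin_plus_topology by (auto dest: openin_subset)
  then show "topspace (plus_topology X Y) \<subseteq> topspace X <+> topspace Y"
    by (intro subsetI, rename_tac z, case_tac z) auto
next
  have "Inl -` (topspace X <+> topspace Y) = topspace X" "Inr -` (topspace X <+> topspace Y) = topspace Y"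
    by auto
  then have "openin (plus_topology X Y) (topspace X <+> topspace Y)"
    by (simp add: openin_plus_topology)
  then show "topspace X <+> topspace Y \<subseteq> topspace (plus_topology X Y)"
    by (rule openin_subset)
qed

section \<open>Graphs as topological spaces, and maps between them\<close>

text \<open>The realization glues the ends of a unit interval for each arc to its tail and head.\<close>

definition graph_pieces :: "('v, 'e) pre_digraph \<Rightarrow> ('v + 'e \<times> real) topology" where
  "graph_pieces G = plus_topology (discrete_topology (verts G))
     (sum_topology (\<lambda>_. top_of_set {0..1}) (arcs G))"

inductive graph_glue :: "('v, 'e) pre_digraph \<Rightarrow> 'v + 'e \<times> real \<Rightarrow> 'v + 'e \<times> real \<Rightarrow> bool"
  for G where
  "graph_glue G (Inr (e, 0)) (Inl (tail G e))"
| "graph_glue G (Inr (e, 1)) (Inl (head G e))"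

definition realization :: "('v, 'e) pre_digraph \<Rightarrow> ('v + 'e \<times> real) set topology" where
  "realization G = quotient_space (graph_pieces G) (graph_glue G)"

definition graph_point :: "('v, 'e) pre_digraph \<Rightarrow> 'v + 'e \<times> real \<Rightarrow> ('v + 'e \<times> real) set" where
  "graph_point G = quotient_point (graph_pieces G) (graph_glue G)"

text \<open>
  The point at time \<open>t\<close> on the path traversing the arcs \<open>es\<close> one after the other, each in
  its own direction, at constant speed.
\<close>

definition walk_point :: "('v, 'e) pre_digraph \<Rightarrow> 'e list \<Rightarrow> real \<Rightarrow> ('v + 'e \<times> real) set" where
  "walk_point G es t =
     (let n = length es; k = min (n - 1) (nat \<lfloor>real n * t\<rfloor>)
      in graph_point G (Inr (es ! k, real n * t - real k)))"

text \<open>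
  The map of realizations that sends each vertex \<open>u\<close> to \<open>f u\<close> and each arc \<open>e\<close> to the path along
  \<open>g e\<close>. It is computed on representatives; see \<open>graph_map_point\<close> below.
\<close>

fun piece_map :: "('w, 'd) pre_digraph \<Rightarrow> ('v \<Rightarrow> 'w) \<Rightarrow> ('e \<Rightarrow> 'd list)
    \<Rightarrow> 'v + 'e \<times> real \<Rightarrow> ('w + 'd \<times> real) set" where
  "piece_map H f g (Inl u) = graph_point H (Inl (f u))"
| "piece_map H f g (Inr (e, t)) = walk_point H (g e) t"

definition graph_map :: "('w, 'd) pre_digraph \<Rightarrow> ('v \<Rightarrow> 'w) \<Rightarrow> ('e \<Rightarrow> 'd list)
    \<Rightarrow> ('v + 'e \<times> real) set \<Rightarrow> ('w + 'd \<times> real) set" where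
  "graph_map H f g y = the_elem (piece_map H f g ` y)"

lemma topspace_graph_pieces [simp]:
  "topspace (graph_pieces G) = verts G <+> arcs G \<times> {0..1}"
  by (auto simp: graph_pieces_def)

lemma graph_point_glue:
  assumes "wf_digraph H" "e \<in> arcs H"
  shows "graph_point H (Inr (e, 0)) = graph_point H (Inl (tail H e))"
    and "graph_point H (Inr (e, 1)) = graph_point H (Inl (head H e))"
  using assms unfolding graph_point_def
  by (subst quotient_point_eq_iff;
      auto simp: gen_equiv_def wf_digraph.tail_in_verts wf_digraph.head_in_verts
        intro!: r_into_equivclp graph_glue.intros)+

lemma graph_map_point:
  assumes H: "wf_digraph H"
    and g: "\<And>e. e \<in> arcs G \<Longrightarrow> g e \<noteq> [] \<and> set (g e) \<subseteq> arcs H \<and>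
      tail H (hd (g e)) = f (tail G e) \<and> head H (last (g e)) = f (head G e)"
    and x: "x \<in> topspace (graph_pieces G)"
  shows "graph_map H f g (graph_point G x) = piece_map H f g x"
proof -
  let ?r = "\<lambda>x y. x \<in> topspace (graph_pieces G) \<and> y \<in> topspace (graph_pieces G) \<and> graph_glue G x y"
  have glue: "piece_map H f g y = piece_map H f g z" if "?r y z" for y z
  proof -
    have "graph_glue G y z" using that by blast
    then show ?thesis
    proof cases
      case (1 e)
      then have e: "e \<in> arcs G" using that by auto
      then have "hd (g e) \<in> arcs H" using g[OF e] hd_in_set by blast
      then show ?thesis
        using 1 g[OF e] graph_point_glue(1)[OF H, of "hd (g e)"]
        by (simp add: walk_point_def flip: hd_conv_nth)
    next
      case (2 e)
      then have e: "e \<in> arcs G" using that by auto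
      then have l: "last (g e) \<in> arcs H" using g[OF e] last_in_set by blast
      have n: "min (length (g e) - 1) (nat \<lfloor>real (length (g e))\<rfloor>) = length (g e) - 1"
        by simp
      have "real (length (g e)) - real (length (g e) - 1) = 1"
        using g[OF e] by (cases "g e") auto
      then show ?thesis
        using 2 g[OF e] graph_point_glue(2)[OF H l] n last_conv_nth[of "g e"]
        by (simp add: walk_point_def)
    qed
  qed
  have "piece_map H f g y = piece_map H f g x" if "y \<in> graph_point G x" for y
  proof -
    have "equivclp ?r x y"
      using that by (simp add: graph_point_def quotient_point_def gen_equiv_def)
    then show ?thesis
    proof (induction rule: equivclp_induct)
      case (step y z)
      then show ?case using glue[of y z] glue[of z y] by presburger
    qed simp
  qed
  moreover have "x \<in> graph_point G x"
    using x by (simp add: graph_point_def quotient_point_def gen_equiv_def)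
  ultimately have "piece_map H f g ` graph_point G x = {piece_map H f g x}"
    by (intro equalityI subsetI) (blast, blast)
  then show ?thesis
    by (simp add: graph_map_def)
qed

section \<open>Total spaces of graphs of spaces\<close>

definition total_pieces :: "('v, 'e) pre_digraph \<Rightarrow> ('v \<Rightarrow> 'a topology) \<Rightarrow> ('e \<Rightarrow> 'b topology)
    \<Rightarrow> ('v \<times> 'a + 'e \<times> 'b \<times> real) topology" where
  "total_pieces T V E = plus_topology (sum_topology V (verts T))
     (sum_topology (\<lambda>e. prod_topology (E e) (top_of_set {0..1})) (arcs T))"

inductive total_glue :: "('v, 'e) pre_digraph \<Rightarrow> ('e \<Rightarrow> 'b \<Rightarrow> 'a) \<Rightarrow> ('e \<Rightarrow> 'b \<Rightarrow> 'a)
    \<Rightarrow> 'v \<times> 'a + 'e \<times> 'b \<times> real \<Rightarrow> 'v \<times> 'a + 'e \<times> 'b \<times> real \<Rightarrow> bool"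
  for T fi ft where
  "total_glue T fi ft (Inr (e, y, 0)) (Inl (tail T e, fi e y))"
| "total_glue T fi ft (Inr (e, y, 1)) (Inl (head T e, ft e y))"

definition total_space :: "('v, 'e) pre_digraph \<Rightarrow> ('v \<Rightarrow> 'a topology) \<Rightarrow> ('e \<Rightarrow> 'b topology)
    \<Rightarrow> ('e \<Rightarrow> 'b \<Rightarrow> 'a) \<Rightarrow> ('e \<Rightarrow> 'b \<Rightarrow> 'a) \<Rightarrow> ('v \<times> 'a + 'e \<times> 'b \<times> real) set topology" where
  "total_space T V E fi ft = quotient_space (total_pieces T V E) (total_glue T fi ft)"

section \<open>The graph of graphs over the theta graph\<close>

text \<open>Indices are elements of the type \<^typ>\<open>3\<close>, whose arithmetic is modulo 3.\<close>

datatype theta_vertex = Theta_v | Theta_w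

definition theta_graph :: "(theta_vertex, 3) pre_digraph" where
  "theta_graph = \<lparr>verts = {Theta_v, Theta_w}, arcs = UNIV, tail = (\<lambda>_. Theta_v), head = (\<lambda>_. Theta_w)\<rparr>"

text \<open>
  The graphs at the two vertices of the theta graph are disjoint copies of the same graph, so
  the barred edges of the second one carry the names \<open>Edge_x j\<close> and \<open>Loop_a j\<close> as well. The
  vertex \<open>j\<close> stands for \<open>v\<^sub>j\<close> in one copy and for \<open>w\<^sub>j\<close> in the other.
\<close>

datatype vertex_graph_arc = Edge_x 3 | Loop_a 3

fun vertex_graph_tail :: "vertex_graph_arc \<Rightarrow> 3" where
  "vertex_graph_tail (Edge_x j) = j"
| "vertex_graph_tail (Loop_a j) = j"

fun vertex_graph_head :: "vertex_graph_arc \<Rightarrow> 3" where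
  "vertex_graph_head (Edge_x j) = j + 1"
| "vertex_graph_head (Loop_a j) = j"

definition vertex_graph :: "(3, vertex_graph_arc) pre_digraph" where
  "vertex_graph = \<lparr>verts = UNIV, arcs = UNIV, tail = vertex_graph_tail, head = vertex_graph_head\<rparr>"

datatype edge_graph_vertex = Vert_p | Vert_q

datatype edge_graph_arc = Alpha | Beta | Lambda | Mu

fun edge_graph_tail :: "edge_graph_arc \<Rightarrow> edge_graph_vertex" where
  "edge_graph_tail Alpha = Vert_p"
| "edge_graph_tail Beta = Vert_q"
| "edge_graph_tail Lambda = Vert_p"
| "edge_graph_tail Mu = Vert_q"

fun edge_graph_head :: "edge_graph_arc \<Rightarrow> edge_graph_vertex" where
  "edge_graph_head Alpha = Vert_q"
| "edge_graph_head Beta = Vert_p"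
| "edge_graph_head Lambda = Vert_p"
| "edge_graph_head Mu = Vert_q"

definition edge_graph :: "(edge_graph_vertex, edge_graph_arc) pre_digraph" where
  "edge_graph = \<lparr>verts = UNIV, arcs = UNIV, tail = edge_graph_tail, head = edge_graph_head\<rparr>"

fun iota_vertex :: "3 \<Rightarrow> edge_graph_vertex \<Rightarrow> 3" where
  "iota_vertex i Vert_p = i"
| "iota_vertex i Vert_q = i - 1"

fun iota_arc :: "3 \<Rightarrow> edge_graph_arc \<Rightarrow> vertex_graph_arc list" where
  "iota_arc i Alpha = [Edge_x i, Edge_x (i + 1)]"
| "iota_arc i Beta = [Edge_x (i - 1)]"
| "iota_arc i Lambda = [Loop_a i]"
| "iota_arc i Mu = [Loop_a (i - 1)]"

fun tau_vertex :: "3 \<Rightarrow> edge_graph_vertex \<Rightarrow> 3" where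
  "tau_vertex i Vert_p = i"
| "tau_vertex i Vert_q = i + 1"

fun tau_arc :: "3 \<Rightarrow> edge_graph_arc \<Rightarrow> vertex_graph_arc list" where
  "tau_arc i Alpha = [Edge_x i]"
| "tau_arc i Beta = [Edge_x (i + 1), Edge_x (i + 2)]"
| "tau_arc i Lambda = [Loop_a i]"
| "tau_arc i Mu = [Loop_a (i + 1)]"

text \<open>The hypotheses of \<open>graph_map_point\<close>, and that consecutive arcs fit together.\<close>

lemma wf_vertex_graph: "wf_digraph vertex_graph"
  by (simp add: wf_digraph_def vertex_graph_def)

lemma iota_arc_walk:
  "iota_arc i e \<noteq> []"
  "tail vertex_graph (hd (iota_arc i e)) = iota_vertex i (tail edge_graph e)"
  "head vertex_graph (last (iota_arc i e)) = iota_vertex i (head edge_graph e)"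
  "Suc k < length (iota_arc i e) \<Longrightarrow>
     head vertex_graph (iota_arc i e ! k) = tail vertex_graph (iota_arc i e ! Suc k)"
  using exhaust_3[of i] by (cases e; auto simp: vertex_graph_def edge_graph_def)+

lemma tau_arc_walk:
  "tau_arc i e \<noteq> []"
  "tail vertex_graph (hd (tau_arc i e)) = tau_vertex i (tail edge_graph e)"
  "head vertex_graph (last (tau_arc i e)) = tau_vertex i (head edge_graph e)"
  "Suc k < length (tau_arc i e) \<Longrightarrow>
     head vertex_graph (tau_arc i e ! k) = tail vertex_graph (tau_arc i e ! Suc k)"
  using exhaust_3[of i] by (cases e; auto simp: vertex_graph_def edge_graph_def)+

definition X_Theta ::
  "(theta_vertex \<times> (3 + vertex_graph_arc \<times> real) set
     + 3 \<times> (edge_graph_vertex + edge_graph_arc \<times> real) set \<times> real) set topology" where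
  "X_Theta = total_space theta_graph (\<lambda>_. realization vertex_graph) (\<lambda>_. realization edge_graph)
     (\<lambda>i. graph_map vertex_graph (iota_vertex i) (iota_arc i))
     (\<lambda>i. graph_map vertex_graph (tau_vertex i) (tau_arc i))"

end

(*
  With d = cb the Artin group becomes <a, b, d | ab = ba, bdb = dd>, and the total space is the
  cover of the presentation complex of this presentation that belongs to the homomorphism to Z/6
  with a |-> 0, b |-> 1, d |-> 2. So the group G is the kernel of that homomorphism.
  Concretely, a word of the Artin group lifts to an edge path of the total space from any given
  vertex; equivalent words lift to homotopic paths, since every relation bounds a square.
  Conversely the holonomy of a flat bundle with fibre the Artin group sends the lift of a word
  back to its class and is invariant under homotopy. As every path is homotopic to the lift of a
  word up to short segments at its ends, the holonomy is injective on loops.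
*)
theory Submission
  imports Defs
begin

section \<open>Paths and homotopies\<close>

text \<open>The complex is built from tiles defined on the whole plane, because two paths in one
  tile with equal ends are homotopic at once. Whatever leaves a single tile goes through charts, and
  a chart serves twice: its contraction replaces a small path by lines in tiles, and its words make
  the transport of the bundle locally constant. Both facts amount to one check per chart and tile,
  collected in \<open>chart_region\<close>; openness, continuity and holonomy are then tested tile
  by tile.

  The obstacle is joint continuity. The contraction depends on a point of a quotient and on a time,
  and the map from an edge space times the interval has the same shape. Both rest on the fact that a
  quotient map times the identity of a locally compact Hausdorff space is again a quotient map.

  The letter \<open>c\<close> has degree 1 because d = cb has degree 2. A lift from the vertex k
  ends at k plus the degree of the word, so loops correspond to words of degree 0 whatever the base
  point. The six vertices are the six degrees, and this is the index.\<close>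

lemma homotopic_paths_through_convex:
  fixes F :: "'a::real_normed_vector \<Rightarrow> 'b::topological_space"
  assumes S: "convex S" and F: "continuous_on S F" "F \<in> S \<rightarrow> T"
    and fg: "path f" "path g" "path_image f \<subseteq> S" "path_image g \<subseteq> S"
      "pathstart f = pathstart g" "pathfinish f = pathfinish g"
  shows "homotopic_paths T (F \<circ> f) (F \<circ> g)"
proof (rule homotopic_paths_continuous_image[OF _ F])
  show "homotopic_paths S f g"
  proof (rule homotopic_paths_linear)
    fix t :: real assume "t \<in> {0..1}"
    then show "closed_segment (f t) (g t) \<subseteq> S"
      using fg S by (intro closed_segment_subset) (auto simp: path_image_def)
  qed (use fg in auto)
qed

text \<open>Bisection of the unit interval in place of a Lebesgue number. Restricting
  \<open>p\<close> to two adjacent intervals and joining gives the restriction to their union only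
  up to reparametrisation, which is why \<open>P\<close> has to respect homotopy.\<close>

lemma path_property_subdivide:
  fixes p :: "real \<Rightarrow> 'a::topological_space"
  assumes p: "path p" "path_image p \<subseteq> T"
    and join: "\<And>q r. P q \<Longrightarrow> P r \<Longrightarrow> pathfinish q = pathstart r \<Longrightarrow> P (q +++ r)"
    and homotopic: "\<And>q r. P q \<Longrightarrow> homotopic_paths T q r \<Longrightarrow> P r"
    and local: "\<And>y. y \<in> T \<Longrightarrow> \<exists>U. open U \<and> y \<in> U \<and> (\<forall>q. path q \<longrightarrow> path_image q \<subseteq> U \<inter> T \<longrightarrow> P q)"
  shows "P p"
proof -
  have cont: "continuous_on {0..1} p" and im: "p \<in> {0..1} \<rightarrow> T"
    using p by (auto simp: path_def path_image_def)
  have seg: "path_image (linepath a b) \<subseteq> {0..1}" if "a \<in> {0..1}" "b \<in> {0..1}" for a b :: real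
    using that closed_segment_subset[of a "{0..1}" b] by (simp add: path_image_linepath)
  have "0 \<le> (0::real) \<longrightarrow> (1::real) \<le> 1 \<longrightarrow> P (p \<circ> linepath 0 1)"
  proof (rule Bolzano[where P = "\<lambda>a b. 0 \<le> a \<longrightarrow> b \<le> 1 \<longrightarrow> P (p \<circ> linepath a b)"])
    fix a m b :: real
    assume 1: "0 \<le> a \<longrightarrow> m \<le> 1 \<longrightarrow> P (p \<circ> linepath a m)"
      and 2: "0 \<le> m \<longrightarrow> b \<le> 1 \<longrightarrow> P (p \<circ> linepath m b)" and le: "a \<le> m" "m \<le> b"
    show "0 \<le> a \<longrightarrow> b \<le> 1 \<longrightarrow> P (p \<circ> linepath a b)"
    proof (intro impI)
      assume ab: "0 \<le> a" "b \<le> 1"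
      have "P ((p \<circ> linepath a m) +++ (p \<circ> linepath m b))"
        using 1 2 ab le by (intro join) (auto simp: pathfinish_compose pathstart_compose)
      then have "P (p \<circ> (linepath a m +++ linepath m b))"
        by (simp add: path_compose_join)
      moreover have "homotopic_paths T (p \<circ> (linepath a m +++ linepath m b)) (p \<circ> linepath a b)"
        using seg[of a m] seg[of m b] seg[of a b] ab le
        by (intro homotopic_paths_through_convex[OF _ cont im]) (auto simp: path_image_join)
      ultimately show "P (p \<circ> linepath a b)" by (rule homotopic)
    qed
  next
    fix x :: real assume x: "0 \<le> x" "x \<le> 1"
    then have px: "p x \<in> T" using im by auto
    obtain U where U: "open U" "p x \<in> U" "\<forall>q. path q \<longrightarrow> path_image q \<subseteq> U \<inter> T \<longrightarrow> P q"
      using local[OF px] by metis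
    have "\<exists>A. open A \<and> x \<in> A \<and> (\<forall>y\<in>{0..1}. y \<in> A \<longrightarrow> p y \<in> U)"
      using cont[unfolded continuous_on_topological, rule_format, OF _ U(1,2)] x by auto
    then obtain A where A: "open A" "x \<in> A" "\<forall>y\<in>{0..1}. y \<in> A \<longrightarrow> p y \<in> U" by auto
    obtain e where e: "e > 0" "ball x e \<subseteq> A" using A open_contains_ball by metis
    have "P (p \<circ> linepath a b)" if ab: "a \<le> x" "x \<le> b" "b - a < e" "0 \<le> a" "b \<le> 1" for a b
    proof -
      have "closed_segment a b \<subseteq> {0..1} \<inter> A"
        using ab e(2) by (auto simp: closed_segment_eq_real_ivl ball_eq_greaterThanLessThan subset_iff)
      then have "path_image (p \<circ> linepath a b) \<subseteq> U \<inter> T"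
        using A(3) im by (auto simp: path_image_compose path_image_linepath)
      moreover have "path (p \<circ> linepath a b)"
        using seg[of a b] ab cont by (intro path_continuous_image) (auto intro: continuous_on_subset)
      ultimately show ?thesis using U(3) by blast
    qed
    then show "\<exists>d>0. \<forall>a b. a \<le> x \<and> x \<le> b \<and> b - a < d \<longrightarrow> 0 \<le> a \<longrightarrow> b \<le> 1 \<longrightarrow> P (p \<circ> linepath a b)"
      using e(1) by blast
  qed auto
  then have "P (p \<circ> linepath 0 1)" by simp
  moreover have "p \<circ> linepath 0 1 = p" by (simp add: linepath_def fun_eq_iff)
  ultimately show ?thesis by simp
qed

section \<open>Local systems and holonomy\<close>

lemma continuous_on_nbhd:
  assumes "continuous_on S f" "x \<in> S" "open B" "f x \<in> B"
  obtains A where "open A" "x \<in> A" "\<forall>y\<in>S \<inter> A. f y \<in> B"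
proof -
  have "\<exists>A. open A \<and> x \<in> A \<and> (\<forall>y\<in>S. y \<in> A \<longrightarrow> f y \<in> B)"
    using assms(1)[unfolded continuous_on_topological, rule_format, OF assms(2-4)] .
  then obtain A where "open A" "x \<in> A" "\<forall>y\<in>S. y \<in> A \<longrightarrow> f y \<in> B" by auto
  then show thesis by (intro that) auto
qed

text \<open>
  A discontinuous presentation of a flat bundle: \<open>\<kappa> x y\<close> is the transport from the frame at \<open>x\<close> to
  the frame at a nearby point \<open>y\<close>, and it is meaningful only for \<open>y\<close> close to \<open>x\<close>. Since the frames
  are chosen independently at all points, \<open>\<kappa>\<close> need not be locally constant; only the cocycle
  condition is local.
\<close>

locale local_system = group G for G (structure) +
  fixes X :: "'x::topological_space set" and \<kappa> :: "'x \<Rightarrow> 'x \<Rightarrow> 'g"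
  assumes kappa_closed: "x \<in> X \<Longrightarrow> y \<in> X \<Longrightarrow> \<kappa> x y \<in> carrier G"
    and kappa_refl: "x \<in> X \<Longrightarrow> \<kappa> x x = \<one>"
    and kappa_cocycle: "x \<in> X \<Longrightarrow> \<exists>W. open W \<and> x \<in> W \<and>
      (\<forall>y\<in>W \<inter> X. \<exists>V. open V \<and> y \<in> V \<and> (\<forall>z\<in>V \<inter> X. \<kappa> x z = \<kappa> x y \<otimes> \<kappa> y z))"
begin

text \<open>A parallel section of the pullback along \<open>F\<close>. Continuity of
  \<open>F\<close> enters only where sections are constructed, not in the notion itself.\<close>

definition flat :: "'t::topological_space set \<Rightarrow> ('t \<Rightarrow> 'x) \<Rightarrow> ('t \<Rightarrow> 'g) \<Rightarrow> bool" where
  "flat S F D \<longleftrightarrow> (\<forall>x\<in>S. F x \<in> X \<and> D x \<in> carrier G \<and>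
     (\<exists>U. open U \<and> x \<in> U \<and> (\<forall>y\<in>S \<inter> U. D y = D x \<otimes> \<kappa> (F x) (F y))))"

lemma flat_closed: "flat S F D \<Longrightarrow> x \<in> S \<Longrightarrow> D x \<in> carrier G"
  by (simp add: flat_def)

lemma flatD:
  assumes "flat S F D" "x \<in> S"
  obtains U where "open U" "x \<in> U" "\<forall>y\<in>S \<inter> U. D y = D x \<otimes> \<kappa> (F x) (F y)"
  using assms unfolding flat_def by auto

lemma flatI:
  assumes "\<And>x. x \<in> S \<Longrightarrow> F x \<in> X" "\<And>x. x \<in> S \<Longrightarrow> D x \<in> carrier G"
    and "\<And>x. x \<in> S \<Longrightarrow> \<exists>U. open U \<and> x \<in> U \<and> (\<forall>y\<in>S \<inter> U. D y = D x \<otimes> \<kappa> (F x) (F y))"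
  shows "flat S F D"
  using assms by (simp add: flat_def)

lemma flat_in: "flat S F D \<Longrightarrow> x \<in> S \<Longrightarrow> F x \<in> X"
  by (simp add: flat_def)

lemma flat_mult:
  assumes D: "flat S F D" and g: "g \<in> carrier G"
  shows "flat S F (\<lambda>x. g \<otimes> D x)"
proof (rule flatI)
  fix x assume x: "x \<in> S"
  show "F x \<in> X" "g \<otimes> D x \<in> carrier G"
    using x g flat_in[OF D] flat_closed[OF D] by auto
  obtain U where U: "open U" "x \<in> U" "\<forall>y\<in>S \<inter> U. D y = D x \<otimes> \<kappa> (F x) (F y)"
    by (rule flatD[OF D x])
  have "g \<otimes> D y = g \<otimes> D x \<otimes> \<kappa> (F x) (F y)" if "y \<in> S \<inter> U" for y
    using that U(3) x g flat_in[OF D] flat_closed[OF D] by (simp add: m_assoc kappa_closed)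
  then show "\<exists>U. open U \<and> x \<in> U \<and> (\<forall>y\<in>S \<inter> U. g \<otimes> D y = g \<otimes> D x \<otimes> \<kappa> (F x) (F y))"
    using U by blast
qed

lemma flat_compose:
  assumes D: "flat S F D" and h: "continuous_on T h" "h \<in> T \<rightarrow> S"
  shows "flat T (\<lambda>x. F (h x)) (\<lambda>x. D (h x))"
proof (rule flatI)
  fix x assume x: "x \<in> T"
  have hx: "h x \<in> S" using funcset_mem[OF h(2) x] .
  show "F (h x) \<in> X" "D (h x) \<in> carrier G"
    using flat_in[OF D hx] flat_closed[OF D hx] .
  obtain U where U: "open U" "h x \<in> U" "\<forall>y\<in>S \<inter> U. D y = D (h x) \<otimes> \<kappa> (F (h x)) (F y)"
    by (rule flatD[OF D hx])
  obtain V where V: "open V" "x \<in> V" "\<forall>y\<in>T \<inter> V. h y \<in> U"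
    by (rule continuous_on_nbhd[OF h(1) x U(1,2)])
  have "D (h y) = D (h x) \<otimes> \<kappa> (F (h x)) (F (h y))" if "y \<in> T \<inter> V" for y
    using U(3) V(3) that funcset_mem[OF h(2), of y] by simp
  with V(1,2) show "\<exists>V. open V \<and> x \<in> V \<and> (\<forall>y\<in>T \<inter> V. D (h y) = D (h x) \<otimes> \<kappa> (F (h x)) (F (h y)))"
    by (intro exI[of _ V] conjI ballI)
qed

lemma flat_subset:
  assumes D: "flat S F D" and T: "T \<subseteq> S"
  shows "flat T F D"
  using flat_compose[OF D continuous_on_id, of T] T by auto

lemma flat_cong: "flat S F D \<Longrightarrow> (\<And>x. x \<in> S \<Longrightarrow> F x = F' x) \<Longrightarrow> (\<And>x. x \<in> S \<Longrightarrow> D x = D' x) \<Longrightarrow> flat S F' D'"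
  unfolding flat_def by auto

text \<open>Near a point both sections acquire the same right factor, which cancels in the quotient;
  the quotient is therefore locally constant.\<close>

lemma flat_unique:
  assumes D: "flat S F D" "flat S F D'" and S: "connected S" and xy: "x \<in> S" "y \<in> S"
  shows "D x \<otimes> inv D' x = D y \<otimes> inv D' y"
proof (rule connected_local_const[OF S xy], intro ballI)
  fix x assume x: "x \<in> S"
  obtain U where U: "open U" "x \<in> U" "\<forall>y\<in>S \<inter> U. D y = D x \<otimes> \<kappa> (F x) (F y)"
    by (rule flatD[OF D(1) x])
  obtain V where V: "open V" "x \<in> V" "\<forall>y\<in>S \<inter> V. D' y = D' x \<otimes> \<kappa> (F x) (F y)"
    by (rule flatD[OF D(2) x])
  have "D x \<otimes> inv D' x = D y \<otimes> inv D' y" if y: "y \<in> S" "y \<in> U \<inter> V" for y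
  proof -
    have c: "D x \<in> carrier G" "D' x \<in> carrier G" "\<kappa> (F x) (F y) \<in> carrier G"
      using flat_closed[OF D(1) x] flat_closed[OF D(2) x] flat_in[OF D(1)] x y by (auto simp: kappa_closed)
    have "D y \<otimes> inv D' y = (D x \<otimes> \<kappa> (F x) (F y)) \<otimes> (inv \<kappa> (F x) (F y) \<otimes> inv D' x)"
      using U(3) V(3) y c by (simp add: inv_mult_group)
    also have "\<dots> = D x \<otimes> (\<kappa> (F x) (F y) \<otimes> (inv \<kappa> (F x) (F y) \<otimes> inv D' x))"
      using c by (simp add: m_assoc)
    also have "\<kappa> (F x) (F y) \<otimes> (inv \<kappa> (F x) (F y) \<otimes> inv D' x) = inv D' x"
      using c by (simp add: m_assoc[symmetric])
    finally show ?thesis by (rule HOL.sym)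
  qed
  then show "\<forall>\<^sub>F y in at x within S. D x \<otimes> inv D' x = D y \<otimes> inv D' y"
    unfolding eventually_at_topological using U V by (intro exI[of _ "U \<inter> V"]) auto
qed

lemma flat_Un:
  assumes D: "flat S F D" "flat T F D'" and ST: "closed S" "closed T" "connected (S \<inter> T)" "S \<inter> T \<noteq> {}"
  shows "\<exists>E. flat (S \<union> T) F E"
proof -
  obtain p where p: "p \<in> S \<inter> T" using ST by blast
  \<comment> \<open>Left multiplication by this constant makes the second section agree with the
    first at \<open>p\<close>, hence by uniqueness on the whole connected overlap.\<close>
  define g where "g = D p \<otimes> inv D' p"
  define E where "E x = (if x \<in> S then D x else g \<otimes> D' x)" for x
  note c = flat_closed[OF D(1)] and c' = flat_closed[OF D(2)]
  have g: "g \<in> carrier G" using p c c' by (simp add: g_def)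
  have E': "E x = g \<otimes> D' x" if "x \<in> T" for x
  proof (cases "x \<in> S")
    case True
    have "D x \<otimes> inv D' x = g"
      unfolding g_def using that True p
      by (intro flat_unique[OF flat_subset[OF D(1)] flat_subset[OF D(2)] ST(3)]) auto
    then have "g \<otimes> D' x = D x \<otimes> (inv D' x \<otimes> D' x)"
      using c[OF True] c'[OF that] by (metis inv_closed m_assoc)
    then show ?thesis using True c c' that by (simp add: E_def)
  qed (simp add: E_def)
  have 1: "flat S F E" by (rule flat_cong[OF D(1)]) (auto simp: E_def)
  have 2: "flat T F E" by (rule flat_cong[OF flat_mult[OF D(2) g]]) (auto simp: E')
  \<comment> \<open>Also claimed for points outside \<open>A\<close>: as \<open>A\<close> is closed,
    a neighbourhood of such a point misses it and the condition is vacuous.\<close>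
  have nb: "\<exists>U. open U \<and> x \<in> U \<and> (\<forall>y\<in>A \<inter> U. E y = E x \<otimes> \<kappa> (F x) (F y))"
    if A: "flat A F E" "closed A" for A x
  proof (cases "x \<in> A")
    case False
    then show ?thesis using A(2) by (intro exI[of _ "- A"]) auto
  next
    case True
    then show ?thesis using A(1) by (simp add: flat_def)
  qed
  have "flat (S \<union> T) F E"
  proof (rule flatI)
    fix x assume x: "x \<in> S \<union> T"
    show "F x \<in> X" "E x \<in> carrier G"
      using x flat_in[OF 1] flat_in[OF 2] flat_closed[OF 1] flat_closed[OF 2] by auto
    obtain U where U: "open U" "x \<in> U" "\<forall>y\<in>S \<inter> U. E y = E x \<otimes> \<kappa> (F x) (F y)"
      using nb[OF 1 ST(1)] by metis
    obtain V where V: "open V" "x \<in> V" "\<forall>y\<in>T \<inter> V. E y = E x \<otimes> \<kappa> (F x) (F y)"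
      using nb[OF 2 ST(2)] by metis
    show "\<exists>U. open U \<and> x \<in> U \<and> (\<forall>y\<in>(S \<union> T) \<inter> U. E y = E x \<otimes> \<kappa> (F x) (F y))"
      using U V by (intro exI[of _ "U \<inter> V"]) auto
  qed
  then show ?thesis by blast
qed

text \<open>The transport out of the single frame at \<open>F x\<close> is a section near
  \<open>x\<close>, and the cocycle condition says exactly that it is flat.\<close>

lemma flat_local:
  assumes F: "continuous_on S F" "F \<in> S \<rightarrow> X" and x: "x \<in> S"
  shows "\<exists>U D. open U \<and> x \<in> U \<and> flat (S \<inter> U) F D"
proof -
  have Fx: "F x \<in> X" using F x by blast
  obtain W where W: "open W" "F x \<in> W"
    "\<forall>y\<in>W \<inter> X. \<exists>V. open V \<and> y \<in> V \<and> (\<forall>z\<in>V \<inter> X. \<kappa> (F x) z = \<kappa> (F x) y \<otimes> \<kappa> y z)"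
    using kappa_cocycle[OF Fx] by blast
  obtain U where U: "open U" "x \<in> U" "\<forall>y\<in>S \<inter> U. F y \<in> W"
    by (rule continuous_on_nbhd[OF F(1) x W(1,2)])
  have "flat (S \<inter> U) F (\<lambda>y. \<kappa> (F x) (F y))"
  proof (rule flatI)
    fix y assume y: "y \<in> S \<inter> U"
    then show Fy: "F y \<in> X" using funcset_mem[OF F(2)] by simp
    then show "\<kappa> (F x) (F y) \<in> carrier G" using Fx by (simp add: kappa_closed)
    have yS: "y \<in> S" "F y \<in> W \<inter> X" using y U(3) Fy by simp_all
    obtain V where V: "open V" "F y \<in> V" "\<forall>z\<in>V \<inter> X. \<kappa> (F x) z = \<kappa> (F x) (F y) \<otimes> \<kappa> (F y) z"
      using W(3)[rule_format, OF yS(2)] by auto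
    obtain U' where U': "open U'" "y \<in> U'" "\<forall>z\<in>S \<inter> U'. F z \<in> V"
      by (rule continuous_on_nbhd[OF F(1) yS(1) V(1,2)])
    have "\<kappa> (F x) (F z) = \<kappa> (F x) (F y) \<otimes> \<kappa> (F y) (F z)" if "z \<in> S \<inter> U \<inter> U'" for z
      using V(3) U'(3) that funcset_mem[OF F(2)] by simp
    with U'(1,2) show "\<exists>U'. open U' \<and> y \<in> U' \<and> (\<forall>z\<in>S \<inter> U \<inter> U'. \<kappa> (F x) (F z) = \<kappa> (F x) (F y) \<otimes> \<kappa> (F y) (F z))"
      by auto
  qed
  then show ?thesis using U(1,2) by auto
qed

text \<open>
  Flat sections are unique up to a constant on connected sets, so they can be glued along an
  interval; two applications of Bolzano's principle produce one on the whole square.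
\<close>

lemma flat_box:
  fixes F :: "real \<times> real \<Rightarrow> 'x"
  assumes F: "continuous_on ({0..1} \<times> {0..1}) F" "F \<in> {0..1} \<times> {0..1} \<rightarrow> X"
  shows "\<exists>D. flat ({0..1} \<times> {0..1}) F D"
proof -
  let ?I = "{0..1::real}"
  define P where "P a b c d \<longleftrightarrow> (\<exists>D. flat (({a..b} \<inter> ?I) \<times> ({c..d} \<inter> ?I)) F D)" for a b c d :: real
  \<comment> \<open>A vertical strip over the full second coordinate. Gluing two pieces forces the
    smaller of their widths, so the width is quantified inside the predicate that is
    bisected.\<close>
  have strip: "\<exists>e>0. P (x - e) (x + e) 0 1" if x: "x \<in> ?I" for x
  proof -
    have "0 \<le> (0::real) \<longrightarrow> (1::real) \<le> 1 \<longrightarrow> (\<exists>e>0. P (x - e) (x + e) 0 1)"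
    proof (rule Bolzano[where P = "\<lambda>c d. 0 \<le> c \<longrightarrow> d \<le> 1 \<longrightarrow> (\<exists>e>0. P (x - e) (x + e) c d)"])
      fix c m d :: real
      assume 1: "0 \<le> c \<longrightarrow> m \<le> 1 \<longrightarrow> (\<exists>e>0. P (x - e) (x + e) c m)"
        and 2: "0 \<le> m \<longrightarrow> d \<le> 1 \<longrightarrow> (\<exists>e>0. P (x - e) (x + e) m d)" and le: "c \<le> m" "m \<le> d"
      show "0 \<le> c \<longrightarrow> d \<le> 1 \<longrightarrow> (\<exists>e>0. P (x - e) (x + e) c d)"
      proof (intro impI)
        assume cd: "0 \<le> c" "d \<le> 1"
        obtain e1 D1 where e1: "e1 > 0" "flat (({x - e1..x + e1} \<inter> ?I) \<times> ({c..m} \<inter> ?I)) F D1"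
          using 1 cd le by (auto simp: P_def)
        obtain e2 D2 where e2: "e2 > 0" "flat (({x - e2..x + e2} \<inter> ?I) \<times> ({m..d} \<inter> ?I)) F D2"
          using 2 cd le by (auto simp: P_def)
        define e where "e = min e1 e2"
        let ?J = "{x - e..x + e} \<inter> ?I"
        have sub: "?J \<subseteq> {x - e1..x + e1} \<inter> ?I" "?J \<subseteq> {x - e2..x + e2} \<inter> ?I"
          by (auto simp: e_def)
        have 3: "flat (?J \<times> ({c..m} \<inter> ?I)) F D1" "flat (?J \<times> ({m..d} \<inter> ?I)) F D2"
          by (rule flat_subset[OF e1(2)], use sub in blast) (rule flat_subset[OF e2(2)], use sub in blast)
        have I: "?J = {max (x - e) 0..min (x + e) 1}" by auto
        have "?J \<times> ({c..m} \<inter> ?I) \<inter> ?J \<times> ({m..d} \<inter> ?I) = ?J \<times> {m}"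
          using le cd by auto
        moreover have "connected (?J \<times> {m})" unfolding I by (intro connected_Times) auto
        moreover have "e > 0" using e1 e2 by (simp add: e_def)
        moreover have "?J \<times> {m} \<noteq> {}" using x \<open>e > 0\<close> by auto
        moreover have "?J \<times> ({c..m} \<inter> ?I) \<union> ?J \<times> ({m..d} \<inter> ?I) = ?J \<times> ({c..d} \<inter> ?I)"
          using le by auto
        ultimately have "\<exists>D. flat (?J \<times> ({c..d} \<inter> ?I)) F D"
          using flat_Un[OF 3] by (simp add: closed_Times closed_Int)
        then show "\<exists>e>0. P (x - e) (x + e) c d"
          using \<open>e > 0\<close> by (auto simp: P_def)
      qed
    next
      fix s :: real assume s: "0 \<le> s" "s \<le> 1"
      obtain U D where U: "open U" "(x, s) \<in> U" "flat ((?I \<times> ?I) \<inter> U) F D"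
        using flat_local[OF F, of "(x, s)"] x s by auto
      obtain A B where AB: "open A" "open B" "x \<in> A" "s \<in> B" "A \<times> B \<subseteq> U"
        using open_prod_elim[OF U(1,2)] by (metis mem_Sigma_iff)
      obtain e where e: "e > 0" "cball x e \<subseteq> A" using AB open_contains_cball by blast
      obtain d where d: "d > 0" "ball s d \<subseteq> B" using AB open_contains_ball by blast
      have "P (x - e) (x + e) c c'" if "c \<le> s" "s \<le> c'" "c' - c < d" for c c'
      proof -
        have "{x - e..x + e} \<subseteq> A" using e(2) by (simp add: cball_eq_atLeastAtMost)
        moreover have "{c..c'} \<subseteq> B" using d(2) that by (auto simp: ball_eq_greaterThanLessThan)
        ultimately have "({x - e..x + e} \<inter> ?I) \<times> ({c..c'} \<inter> ?I) \<subseteq> (?I \<times> ?I) \<inter> U"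
          using AB(5) by blast
        then show ?thesis using flat_subset[OF U(3)] by (auto simp: P_def)
      qed
      then show "\<exists>d>0. \<forall>c c'. c \<le> s \<and> s \<le> c' \<and> c' - c < d \<longrightarrow> 0 \<le> c \<longrightarrow> c' \<le> 1 \<longrightarrow> (\<exists>e>0. P (x - e) (x + e) c c')"
        using d(1) e(1) by blast
    qed auto
    then show ?thesis by simp
  qed
  have "0 \<le> (0::real) \<longrightarrow> (1::real) \<le> 1 \<longrightarrow> P 0 1 0 1"
  proof (rule Bolzano[where P = "\<lambda>a b. 0 \<le> a \<longrightarrow> b \<le> 1 \<longrightarrow> P a b 0 1"])
    fix a m b :: real
    assume 1: "0 \<le> a \<longrightarrow> m \<le> 1 \<longrightarrow> P a m 0 1" and 2: "0 \<le> m \<longrightarrow> b \<le> 1 \<longrightarrow> P m b 0 1" and le: "a \<le> m" "m \<le> b"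
    show "0 \<le> a \<longrightarrow> b \<le> 1 \<longrightarrow> P a b 0 1"
    proof (intro impI)
      assume ab: "0 \<le> a" "b \<le> 1"
      obtain D1 D2 where 3: "flat (({a..m} \<inter> ?I) \<times> ({0..1} \<inter> ?I)) F D1" "flat (({m..b} \<inter> ?I) \<times> ({0..1} \<inter> ?I)) F D2"
        using 1 2 ab le by (auto simp: P_def)
      have "({a..m} \<inter> ?I) \<times> ({0..1} \<inter> ?I) \<inter> ({m..b} \<inter> ?I) \<times> ({0..1} \<inter> ?I) = {m} \<times> {0..1}"
        using le ab by auto
      moreover have "connected ({m} \<times> {0..1::real})" by (intro connected_Times) auto
      moreover have "({a..m} \<inter> ?I) \<times> ({0..1} \<inter> ?I) \<union> ({m..b} \<inter> ?I) \<times> ({0..1} \<inter> ?I) = ({a..b} \<inter> ?I) \<times> ({0..1} \<inter> ?I)"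
        using le by auto
      ultimately have "\<exists>D. flat (({a..b} \<inter> ?I) \<times> ({0..1} \<inter> ?I)) F D"
        using flat_Un[OF 3] by (simp add: closed_Times closed_Int)
      then show "P a b 0 1" by (simp add: P_def)
    qed
  next
    fix x :: real assume x: "0 \<le> x" "x \<le> 1"
    obtain e where e0: "e > 0" "P (x - e) (x + e) 0 1"
      using strip[of x] x by auto
    then obtain D where e: "e > 0" "flat (({x - e..x + e} \<inter> ?I) \<times> ({0..1} \<inter> ?I)) F D"
      unfolding P_def by blast
    have "P a b 0 1" if "a \<le> x" "x \<le> b" "b - a < e" for a b
    proof -
      have "({a..b} \<inter> ?I) \<times> ({0..1} \<inter> ?I) \<subseteq> ({x - e..x + e} \<inter> ?I) \<times> ({0..1} \<inter> ?I)"
        using that by auto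
      then show ?thesis using flat_subset[OF e(2)] by (auto simp: P_def)
    qed
    then show "\<exists>d>0. \<forall>a b. a \<le> x \<and> x \<le> b \<and> b - a < d \<longrightarrow> 0 \<le> a \<longrightarrow> b \<le> 1 \<longrightarrow> P a b 0 1"
      using e(1) by blast
  qed auto
  then show ?thesis by (simp add: P_def)
qed

section \<open>Holonomy along paths and its invariance under homotopy\<close>

lemma flat_quotient_unique:
  assumes D: "flat S F D" "flat S F D'" and S: "connected S" and xy: "x \<in> S" "y \<in> S"
  shows "inv D x \<otimes> D y = inv D' x \<otimes> D' y"
proof -
  have c: "D x \<in> carrier G" "D y \<in> carrier G" "D' x \<in> carrier G" "D' y \<in> carrier G"
    using flat_closed[OF D(1)] flat_closed[OF D(2)] xy by auto
  have "D y = D x \<otimes> inv D' x \<otimes> D' y"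
    using flat_unique[OF assms] c by (simp add: m_assoc)
  then show ?thesis using c by (simp add: m_assoc[symmetric])
qed

text \<open>A flat section on an interval is unique up to a left factor. The quotient is formed on
  the side where this factor cancels.\<close>

definition hol :: "(real \<Rightarrow> 'x) \<Rightarrow> 'g" where
  "hol p = (THE g. \<exists>D. flat {0..1} p D \<and> g = inv D 0 \<otimes> D 1)"

lemma hol_eqI:
  assumes "flat {0..1} p D"
  shows "hol p = inv D 0 \<otimes> D 1"
  unfolding hol_def
proof (rule the_equality)
  show "\<exists>D'. flat {0..1} p D' \<and> inv D 0 \<otimes> D 1 = inv D' 0 \<otimes> D' 1"
    by (intro exI[of _ D] conjI assms HOL.refl)
  fix g assume "\<exists>D. flat {0..1} p D \<and> g = inv D 0 \<otimes> D 1"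
  then obtain D' where D': "flat {0..1} p D'" "g = inv D' 0 \<otimes> D' 1" by (elim exE conjE)
  have "inv D' 0 \<otimes> D' 1 = inv D 0 \<otimes> D 1"
    by (rule flat_quotient_unique[OF D'(1) assms]) auto
  with D'(2) show "g = inv D 0 \<otimes> D 1" by simp
qed

lemma flat_path:
  assumes "path p" "path_image p \<subseteq> X"
  shows "\<exists>D. flat {0..1} p D"
proof -
  \<comment> \<open>A path is treated as a map of the square that is constant in the second
    coordinate.\<close>
  have "continuous_on ({0..1} \<times> {0..1}) (\<lambda>z::real \<times> real. p (fst z))"
    using assms(1) unfolding path_def
    by (rule continuous_on_compose2[of "{0..1}" p]) (auto intro: continuous_intros)
  moreover have "(\<lambda>z::real \<times> real. p (fst z)) \<in> {0..1} \<times> {0..1} \<rightarrow> X"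
    using assms(2) by (auto simp: path_image_def)
  ultimately have "\<exists>D. flat ({0..1} \<times> {0..1}) (\<lambda>z::real \<times> real. p (fst z)) D"
    by (rule flat_box)
  then obtain D where D: "flat ({0..1} \<times> {0..1}) (\<lambda>z::real \<times> real. p (fst z)) D" ..
  have "continuous_on {0..1} (\<lambda>t::real. (t, 0::real))" "(\<lambda>t::real. (t, 0::real)) \<in> {0..1} \<rightarrow> {0..1} \<times> {0..1}"
    by (auto intro: continuous_intros)
  from flat_compose[OF D this] have "flat {0..1} p (\<lambda>t. D (t, 0))" by simp
  then show ?thesis by (rule exI[of _ "\<lambda>t. D (t, 0)"])
qed

lemma hol_closed:
  assumes "path p" "path_image p \<subseteq> X"
  shows "hol p \<in> carrier G"
proof -
  obtain D where D: "flat {0..1} p D" using flat_path[OF assms] ..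
  show ?thesis using hol_eqI[OF D] flat_closed[OF D] by simp
qed

lemma hol_const:
  assumes "x \<in> X"
  shows "hol (\<lambda>_. x) = \<one>"
proof -
  have "flat {0..1} (\<lambda>_. x) (\<lambda>_. \<one>)"
    by (rule flatI) (use assms in \<open>auto simp: kappa_refl\<close>)
  from hol_eqI[OF this] show ?thesis by simp
qed

text \<open>Take one flat section over the square of the homotopy. The two sides on which the end
  points stay fixed are constant paths, so the section does not change along them, and the other two
  sides have the same quotient.\<close>

lemma hol_homotopic:
  assumes "homotopic_paths X p q"
  shows "hol p = hol q"
proof -
  obtain h where h: "continuous_on ({0..1} \<times> {0..1}) h" "h \<in> {0..1} \<times> {0..1} \<rightarrow> X"
    "\<forall>x\<in>{0..1}. h (0, x) = p x" "\<forall>x\<in>{0..1}. h (1, x) = q x"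
    and e: "\<forall>t\<in>{0..1::real}. h (t, 0) = p 0 \<and> h (t, 1) = p 1"
    using assms unfolding homotopic_paths by (auto simp: pathstart_def pathfinish_def)
  obtain D where D: "flat ({0..1} \<times> {0..1}) h D"
    using flat_box[OF h(1,2)] ..
  have p: "flat {0..1} p (\<lambda>t. D (0, t))"
    by (rule flat_cong[OF flat_compose[OF D, of "{0..1}" "\<lambda>t. (0, t)"]]) (auto intro!: continuous_intros simp: h)
  have q: "flat {0..1} q (\<lambda>t. D (1, t))"
    by (rule flat_cong[OF flat_compose[OF D, of "{0..1}" "\<lambda>t. (1, t)"]]) (auto intro!: continuous_intros simp: h)
  have const: "D (0, x) = D (1, x)" if x: "x = 0 \<or> x = 1" for x
  proof -
    have 1: "flat {0..1} (\<lambda>t. p x) (\<lambda>t. D (t, x))"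
      by (rule flat_cong[OF flat_compose[OF D, of "{0..1}" "\<lambda>t. (t, x)"]]) (use x e in \<open>auto intro!: continuous_intros\<close>)
    then have "inv D (0, x) \<otimes> D (1, x) = \<one>"
      using hol_eqI[OF 1] hol_const[of "p x"] flat_in[OF 1, of 0] by simp
    then show ?thesis
      using flat_closed[OF 1, of 0] flat_closed[OF 1, of 1] by (simp add: inv_solve_left')
  qed
  show ?thesis using hol_eqI[OF p] hol_eqI[OF q] const[of 0] const[of 1] by simp
qed

lemma hol_join:
  assumes p: "path p" "path_image p \<subseteq> X" and q: "path q" "path_image q \<subseteq> X" and pq: "pathfinish p = pathstart q"
  shows "hol (p +++ q) = hol p \<otimes> hol q"
proof -
  have pi: "path (p +++ q)" "path_image (p +++ q) \<subseteq> X"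
    using assms by (auto simp: path_image_join)
  obtain D where D: "flat {0..1} (p +++ q) D" using flat_path[OF pi] ..
  have 1: "flat {0..1} p (\<lambda>t. D (t / 2))"
    by (rule flat_cong[OF flat_compose[OF D, of "{0..1}" "\<lambda>t. t / 2"]])
      (auto intro!: continuous_intros simp: joinpaths_def)
  have 2: "flat {0..1} q (\<lambda>t. D ((1 + t) / 2))"
    by (rule flat_cong[OF flat_compose[OF D, of "{0..1}" "\<lambda>t. (1 + t) / 2"]])
      (use pq in \<open>auto intro!: continuous_intros simp: joinpaths_def pathstart_def pathfinish_def field_simps\<close>)
  have c: "D 0 \<in> carrier G" "D (1 / 2) \<in> carrier G" "D 1 \<in> carrier G"
    using flat_closed[OF D] by auto
  then have "inv D 0 \<otimes> D 1 = inv D 0 \<otimes> (D (1 / 2) \<otimes> (inv D (1 / 2) \<otimes> D 1))"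
    by (simp add: m_assoc[symmetric])
  then show ?thesis
    using hol_eqI[OF D] hol_eqI[OF 1] hol_eqI[OF 2] c by (simp add: m_assoc)
qed

end

section \<open>Quotient spaces and graphs\<close>

text \<open>This turns a function on representatives into one on the quotient: invariance under the
  generating pairs propagates along the generated equivalence, and the image of a class is a
  singleton.\<close>

lemma the_elem_quotient_point:
  assumes "x \<in> topspace X"
    and "\<And>y z. y \<in> topspace X \<Longrightarrow> z \<in> topspace X \<Longrightarrow> r y z \<Longrightarrow> h y = h z"
  shows "the_elem (h ` quotient_point X r x) = h x"
proof -
  let ?r = "\<lambda>x y. x \<in> topspace X \<and> y \<in> topspace X \<and> r x y"
  have "h y = h x" if "y \<in> quotient_point X r x" for y
  proof -
    have "equivclp ?r x y"
      using that by (simp add: quotient_point_def gen_equiv_def)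
    then show ?thesis
    proof (induction rule: equivclp_induct)
      case (step y z)
      have "h y = h z"
        using step(2)
      proof
        assume "?r y z"
        then show ?thesis by (intro assms(2)) simp_all
      next
        assume "?r z y"
        then show ?thesis by (intro assms(2)[symmetric]) simp_all
      qed
      then show ?case using step(3) by (simp only:)
    qed simp
  qed
  moreover have "x \<in> quotient_point X r x"
    using assms(1) by (simp add: quotient_point_def gen_equiv_def)
  ultimately show ?thesis
    by (intro the_elem_image_unique) blast+
qed

lemma quotient_point_eqI:
  assumes "x \<in> topspace X" "y \<in> topspace X" "r x y"
  shows "quotient_point X r x = quotient_point X r y"
  using assms by (subst quotient_point_eq_iff) (auto simp: gen_equiv_def intro: r_into_equivclp)

lemma continuous_map_from_plus:
  "continuous_map (plus_topology X Y) Z f \<longleftrightarrow>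
    continuous_map X Z (\<lambda>x. f (Inl x)) \<and> continuous_map Y Z (\<lambda>y. f (Inr y))"
proof -
  have "Inl -` {x \<in> topspace X <+> topspace Y. f x \<in> U} = {x \<in> topspace X. f (Inl x) \<in> U}"
    "Inr -` {x \<in> topspace X <+> topspace Y. f x \<in> U} = {y \<in> topspace Y. f (Inr y) \<in> U}" for U
    by auto
  then show ?thesis
    unfolding continuous_map_def openin_plus_topology by (auto simp: Pi_iff Plus_def)
qed

lemma continuous_map_from_sum:
  assumes "\<And>i. i \<in> I \<Longrightarrow> continuous_map (X i) Z (\<lambda>x. f (i, x))"
  shows "continuous_map (sum_topology X I) Z f"
  unfolding continuous_map_def
proof (intro conjI allI impI)
  show "f \<in> topspace (sum_topology X I) \<rightarrow> topspace Z"
    using assms by (auto simp: continuous_map_def Pi_iff)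
  fix U assume U: "openin Z U"
  have "{x. (i, x) \<in> {x \<in> topspace (sum_topology X I). f x \<in> U}} = {x \<in> topspace (X i). f (i, x) \<in> U}"
    if "i \<in> I" for i using that by auto
  then show "openin (sum_topology X I) {x \<in> topspace (sum_topology X I). f x \<in> U}"
    using assms U unfolding openin_sum_topology by (auto simp: continuous_map_def)
qed

lemma openin_graph_pieces:
  "openin (graph_pieces G) U \<longleftrightarrow> Inl -` U \<subseteq> verts G \<and> Inr -` U \<subseteq> arcs G \<times> {0..1} \<and>
    (\<forall>e\<in>arcs G. openin (top_of_set {0..1}) {t. Inr (e, t) \<in> U})"
  by (auto simp: graph_pieces_def openin_plus_topology openin_sum_topology)

text \<open>The product is a disjoint union of open parts, one for each vertex and each arc, so
  continuity is a matter of the separate parts. It is needed for the edge graph times the unit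
  interval.\<close>

lemma continuous_map_from_graph_pieces_times:
  fixes G :: "('v, 'e) pre_digraph"
  assumes v: "\<And>v. v \<in> verts G \<Longrightarrow> continuous_map Z W (\<lambda>s. f (Inl v, s))"
    and e: "\<And>e. e \<in> arcs G \<Longrightarrow> continuous_map (prod_topology (top_of_set {0..1}) Z) W (\<lambda>x. f (Inr (e, fst x), snd x))"
  shows "continuous_map (prod_topology (graph_pieces G) Z) W f"
  unfolding continuous_map_def
proof (intro conjI allI impI)
  show "f \<in> topspace (prod_topology (graph_pieces G) Z) \<rightarrow> topspace W"
  proof
    fix x assume x: "x \<in> topspace (prod_topology (graph_pieces G) Z)"
    obtain p s where ps: "x = (p, s)" by (cases x)
    show "f x \<in> topspace W"
    proof (cases p)
      case (Inl u)
      then have "u \<in> verts G" "s \<in> topspace Z" using x ps by auto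
      then show ?thesis
        using funcset_mem[OF continuous_map_funspace[OF v]] ps Inl by simp
    next
      case (Inr y)
      obtain a t where y: "y = (a, t)" by (cases y)
      then have "a \<in> arcs G" "(t, s) \<in> topspace (prod_topology (top_of_set {0..1}) Z)" using x ps Inr by auto
      then show ?thesis
        using funcset_mem[OF continuous_map_funspace[OF e], of a "(t, s)"] ps Inr y by simp
    qed
  qed
  fix U assume U: "openin W U"
  let ?P = "{x \<in> topspace (prod_topology (graph_pieces G) Z). f x \<in> U}"
  show "openin (prod_topology (graph_pieces G) Z) ?P"
  proof (subst openin_subopen, intro ballI)
    fix x assume x: "x \<in> ?P"
    obtain p s where ps: "x = (p, s)" by (cases x)
    show "\<exists>T. openin (prod_topology (graph_pieces G) Z) T \<and> x \<in> T \<and> T \<subseteq> ?P"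
    proof (cases p)
      case (Inl u)
      then have u: "u \<in> verts G" "s \<in> topspace Z" "f (Inl u, s) \<in> U" using x ps by auto
      let ?A = "{s \<in> topspace Z. f (Inl u, s) \<in> U}"
      have A: "openin Z ?A" using v[OF u(1)] U by (simp add: continuous_map_def)
      have "openin (graph_pieces G) {Inl u}"
        using u(1) by (simp add: graph_pieces_def openin_plus_topology vimage_def)
      then have "openin (prod_topology (graph_pieces G) Z) ({Inl u} \<times> ?A)"
        using A by (simp add: openin_prod_Times_iff)
      moreover have "{Inl u} \<times> ?A \<subseteq> ?P" using u(1) by auto
      ultimately show ?thesis using u ps Inl by (intro exI[of _ "{Inl u} \<times> ?A"]) simp
    next
      case (Inr y)
      obtain a t where y: "y = (a, t)" by (cases y)
      have a: "a \<in> arcs G" "t \<in> {0..1}" "s \<in> topspace Z" "f (Inr (a, t), s) \<in> U" using x ps Inr y by auto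
      let ?R = "prod_topology (top_of_set {0..1::real}) Z"
      let ?S = "{x \<in> topspace ?R. f (Inr (a, fst x), snd x) \<in> U}"
      have "openin ?R ?S" using e[OF a(1)] U by (simp add: continuous_map_def)
      moreover have "(t, s) \<in> ?S" using a by simp
      ultimately have "\<exists>A B. openin (top_of_set {0..1}) A \<and> openin Z B \<and> t \<in> A \<and> s \<in> B \<and> A \<times> B \<subseteq> ?S"
        by (rule openin_prod_topology_alt[THEN iffD1, rule_format])
      then obtain A B where AB: "openin (top_of_set {0..1}) A" "openin Z B" "t \<in> A" "s \<in> B" "A \<times> B \<subseteq> ?S"
        by (elim exE conjE)
      have "openin (top_of_set {0..1}) {t. (Inr (b, t) :: 'v + 'e \<times> real) \<in> Inr ` ({a} \<times> A)}" for b
      proof -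
        have "{t. (Inr (b, t) :: 'v + 'e \<times> real) \<in> Inr ` ({a} \<times> A)} = (if b = a then A else {})"
          by (auto simp: image_iff)
        then show ?thesis using AB(1) by simp
      qed
      then have "openin (graph_pieces G) (Inr ` ({a} \<times> A))"
        using a(1) openin_subset[OF AB(1)] unfolding openin_graph_pieces by auto
      then have "openin (prod_topology (graph_pieces G) Z) ((Inr ` ({a} \<times> A)) \<times> B)"
        using AB(2) by (simp add: openin_prod_Times_iff)
      moreover have "(Inr ` ({a} \<times> A)) \<times> B \<subseteq> ?P"
        using AB(5) a(1) by auto
      ultimately show ?thesis
        using AB ps Inr y by (intro exI[of _ "(Inr ` ({a} \<times> A)) \<times> B"]) simp
    qed
  qed
qed

lemma walk_point_single: "walk_point G [e] t = graph_point G (Inr (e, t))"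
  by (simp add: walk_point_def)

lemma walk_point_pair:
  assumes "t \<in> {0..1}"
  shows "walk_point G [e, e'] t = graph_point G (if t < 1 / 2 then Inr (e, 2 * t) else Inr (e', 2 * t - 1))"
proof (cases "t < 1 / 2")
  case True
  then have "\<lfloor>2 * t\<rfloor> = 0" using assms by (simp add: floor_eq_iff)
  then show ?thesis using True by (simp add: walk_point_def)
next
  case False
  then have "1 \<le> \<lfloor>2 * t\<rfloor>" by (simp add: le_floor_iff)
  then have "1 \<le> nat \<lfloor>2 * t\<rfloor>" by linarith
  \<comment> \<open>At \<open>t = 1\<close> the floor is 2; the minimum keeps the index on the
    second arc.\<close>
  then have "min (2 - 1) (nat \<lfloor>2 * t\<rfloor>) = 1" by linarith
  then show ?thesis using False by (simp add: walk_point_def)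
qed

lemma topspace_realization: "topspace (realization G) = graph_point G ` topspace (graph_pieces G)"
  by (simp add: realization_def graph_point_def)

lemma quotient_map_graph_point: "quotient_map (graph_pieces G) (realization G) (graph_point G)"
  unfolding realization_def graph_point_def by (rule quotient_map_quotient_point)

lemma continuous_map_graph_piece:
  assumes "e \<in> arcs G"
  shows "continuous_map (top_of_set {0..1}) (realization G) (\<lambda>t. graph_point G (Inr (e, t)))"
proof -
  \<comment> \<open>Continuity of the identity, read through the criterion for maps out of a sum, is
    continuity of the injections.\<close>
  have "continuous_map (graph_pieces G) (graph_pieces G) (\<lambda>x. x)" by simp
  then have "continuous_map (sum_topology (\<lambda>_. top_of_set {0..1}) (arcs G)) (graph_pieces G) Inr"
    by (subst (asm) graph_pieces_def) (simp add: continuous_map_from_plus)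
  moreover have "continuous_map (top_of_set {0..1}) (sum_topology (\<lambda>_. top_of_set {0..1}) (arcs G)) (\<lambda>t. (e, t))"
    by (rule continuous_map_component_injection[OF assms])
  ultimately have "continuous_map (top_of_set {0..1}) (graph_pieces G) (Inr \<circ> (\<lambda>t. (e, t)))"
    by (rule continuous_map_compose[rotated])
  from continuous_map_compose[OF this quotient_imp_continuous_map[OF quotient_map_graph_point]]
  show ?thesis by (simp add: o_def)
qed

section \<open>The model complex\<close>

text \<open>
  The sixfold cyclic cover of the presentation complex of \<open>\<langle>a, b, d | ab = ba, bdb = dd\<rangle>\<close>, with points
  in normal form: every point lies in a unique open cell. From the vertex \<open>k\<close> the edges labelled
  \<open>a\<close>, \<open>b\<close>, \<open>d\<close> lead to \<open>k\<close>, \<open>k + 1\<close>, \<open>k + 2\<close>. Coordinates outside the open unit interval give junk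
  points, which are excluded by \<open>tiled\<close> below.
\<close>

datatype cell_point = Vert 6 | On_a 6 real | On_b 6 real | On_d 6 real | In_C 6 real real | In_D 6 real real

definition edge_a :: "6 \<Rightarrow> real \<Rightarrow> cell_point" where
  "edge_a k t = (if t \<le> 0 \<or> 1 \<le> t then Vert k else On_a k t)"

definition edge_b :: "6 \<Rightarrow> real \<Rightarrow> cell_point" where
  "edge_b k s = (if s \<le> 0 then Vert k else if 1 \<le> s then Vert (k + 1) else On_b k s)"

definition edge_d :: "6 \<Rightarrow> real \<Rightarrow> cell_point" where
  "edge_d k t = (if t \<le> 0 then Vert k else if 1 \<le> t then Vert (k + 2) else On_d k t)"

text \<open>
  The tiles are clamped to the unit square. The boundary of \<open>tile_C\<close> reads \<open>ab = ba\<close>; the bottom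
  side of \<open>tile_D\<close> is \<open>dd\<close> with its middle vertex at \<open>1 / 2\<close>, the other three sides read \<open>bdb\<close>, the
  right one downwards.
\<close>

definition tile_C :: "6 \<Rightarrow> real \<Rightarrow> real \<Rightarrow> cell_point" where
  "tile_C k t s = (if s \<le> 0 then edge_a k t else if 1 \<le> s then edge_a (k + 1) t
     else if t \<le> 0 \<or> 1 \<le> t then edge_b k s else In_C k t s)"

definition tile_D :: "6 \<Rightarrow> real \<Rightarrow> real \<Rightarrow> cell_point" where
  "tile_D k t s = (if s \<le> 0 then (if t \<le> 1 / 2 then edge_d k (2 * t) else edge_d (k + 2) (2 * t - 1))
     else if 1 \<le> s then edge_d (k + 1) t
     else if t \<le> 0 then edge_b k s else if 1 \<le> t then edge_b (k + 3) (1 - s) else In_D k t s)"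

datatype tile = Tile_C 6 | Tile_D 6

fun tile_map :: "tile \<Rightarrow> real \<times> real \<Rightarrow> cell_point" where
  "tile_map (Tile_C k) (t, s) = tile_C k t s"
| "tile_map (Tile_D k) (t, s) = tile_D k t s"

section \<open>The topology of the model complex\<close>

instantiation cell_point :: topological_space
begin

text \<open>The final topology of the tiles. Clamping extends them to the plane, so that openness of
  preimages involves no relative topology. Junk points have empty preimages, which makes
  \<open>tiled\<close> both open and closed.\<close>

definition open_cell_point :: "cell_point set \<Rightarrow> bool" where
  "open_cell_point S \<longleftrightarrow> (\<forall>c. open (tile_map c -` S))"

instance
proof
  show "open (UNIV :: cell_point set)"
    by (simp add: open_cell_point_def)
  fix S T :: "cell_point set" assume "open S" "open T"
  then show "open (S \<inter> T)"
    by (simp add: open_cell_point_def vimage_Int open_Int)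
next
  fix K :: "cell_point set set" assume "\<forall>S\<in>K. open S"
  then show "open (\<Union>K)"
    by (auto simp: open_cell_point_def vimage_Union intro: open_UN)
qed

end

definition tiled :: "cell_point set" where
  "tiled = (\<Union>c. range (tile_map c))"

lemma tile_map_in_tiled [simp]: "tile_map c z \<in> tiled"
  by (auto simp: tiled_def)

lemma tiledE:
  assumes "y \<in> tiled"
  obtains c z where "y = tile_map c z"
  using assms by (auto simp: tiled_def)

lemma continuous_on_tile_map [continuous_intros]:
  "continuous_on S f \<Longrightarrow> continuous_on S (\<lambda>x. tile_map c (f x))"
proof -
  assume f: "continuous_on S f"
  have "continuous_on UNIV (tile_map c)"
    by (simp add: continuous_on_open_vimage open_cell_point_def)
  then show ?thesis
    using continuous_on_compose2[OF _ f] by blast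
qed

lemma open_tiled: "open tiled"
  by (simp add: open_cell_point_def vimage_def)

lemma quotient_map_tile_map:
  "quotient_map (prod_topology (discrete_topology UNIV) euclidean) (top_of_set tiled)
     (\<lambda>(c, z). tile_map c z)"
  unfolding quotient_map_def
proof (intro conjI allI impI)
  show "(\<lambda>(c, z). tile_map c z) ` topspace (prod_topology (discrete_topology UNIV) euclidean)
      = topspace (top_of_set tiled)"
    by (auto simp: tiled_def)
  fix U assume "U \<subseteq> topspace (top_of_set tiled)"
  then have U: "U \<subseteq> tiled" by simp
  let ?V = "{x \<in> topspace (prod_topology (discrete_topology UNIV) euclidean). (case x of (c, z) \<Rightarrow> tile_map c z) \<in> U}"
  have 1: "openin (top_of_set tiled) U \<longleftrightarrow> open U"
    using U open_tiled by (simp add: openin_open_eq)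
  have 2: "openin (prod_topology (discrete_topology UNIV) euclidean) ?V \<longleftrightarrow> (\<forall>c. open (tile_map c -` U))"
  proof
    assume L: "openin (prod_topology (discrete_topology UNIV) euclidean) ?V"
    show "\<forall>c. open (tile_map c -` U)"
    proof
      fix c :: tile
      have "continuous_map euclidean (prod_topology (discrete_topology UNIV) euclidean) (\<lambda>z::real\<times>real. (c, z))"
        by (simp add: continuous_map_pairwise o_def)
      from openin_continuous_map_preimage[OF this L] show "open (tile_map c -` U)"
        by (simp add: vimage_def)
    qed
  next
    assume R: "\<forall>c. open (tile_map c -` U)"
    have "?V = (\<Union>c. {c} \<times> (tile_map c -` U))" by auto
    then show "openin (prod_topology (discrete_topology UNIV) euclidean) ?V"
      using R by (auto intro!: openin_Union simp: openin_prod_Times_iff)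
  qed
  show "openin (prod_topology (discrete_topology UNIV) euclidean) ?V = openin (top_of_set tiled) U"
    unfolding 1 2 open_cell_point_def ..
qed

text \<open>The real line is locally compact and Hausdorff, so the map from the tiles stays a
  quotient map after multiplication with it. This is what allows the continuity of a contraction in
  point and time together to be tested tile by tile.\<close>

lemma open_tiled_times:
  fixes A :: "(cell_point \<times> real) set"
  assumes sub: "A \<subseteq> tiled \<times> UNIV"
    and op: "\<And>c. open {(z, r). (tile_map c z, r) \<in> A}"
  shows "open A"
proof -
  let ?P = "prod_topology (discrete_topology UNIV) euclidean :: (tile \<times> real \<times> real) topology"
  let ?f = "\<lambda>(x, r::real). ((case x of (c, z) \<Rightarrow> tile_map c z), r)"
  have q: "quotient_map (prod_topology ?P euclidean) (prod_topology (top_of_set tiled) euclidean) ?f"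
    by (rule quotient_map_prod_left)
      (auto intro: quotient_map_tile_map simp: locally_compact_space_euclidean Hausdorff_space_euclidean)
  have ts: "topspace (prod_topology (top_of_set tiled) (euclidean :: real topology)) = tiled \<times> UNIV"
    by simp
  have "openin (prod_topology ?P euclidean) {x \<in> topspace (prod_topology ?P euclidean). ?f x \<in> A}"
  proof (subst openin_subopen, intro ballI)
    fix x assume "x \<in> {x \<in> topspace (prod_topology ?P euclidean). ?f x \<in> A}"
    moreover obtain c z r where x1: "x = ((c, z), r)"
      by (metis surj_pair)
    ultimately have x: "x = ((c, z), r)" "(tile_map c z, r) \<in> A" by simp_all
    have "(z, r) \<in> {(z, r). (tile_map c z, r) \<in> A}"
      using x by simp
    from open_prod_elim[OF op this] obtain U V where UV: "open U" "open V" "z \<in> U" "r \<in> V"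
      and sub: "U \<times> V \<subseteq> {(z, r). (tile_map c z, r) \<in> A}"
      by (metis mem_Sigma_iff)
    have "openin (prod_topology ?P euclidean) (({c} \<times> U) \<times> V)"
      using UV by (simp add: openin_prod_Times_iff)
    moreover have "({c} \<times> U) \<times> V \<subseteq> {x \<in> topspace (prod_topology ?P euclidean). ?f x \<in> A}"
      using sub by auto
    ultimately show "\<exists>T. openin (prod_topology ?P euclidean) T \<and> x \<in> T \<and>
        T \<subseteq> {x \<in> topspace (prod_topology ?P euclidean). ?f x \<in> A}"
      using UV x(1) by (intro exI[of _ "({c} \<times> U) \<times> V"]) simp
  qed
  then have "openin (prod_topology (top_of_set tiled) euclidean) A"
    using q sub unfolding quotient_map_def ts by blast
  then have "openin (top_of_set (tiled \<times> (UNIV::real set))) A"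
    by (simp add: prod_topology_subtopology(1) flip: euclidean_product_topology)
  then show ?thesis
    using open_tiled by (simp add: openin_open_eq open_Times)
qed

section \<open>Charts of the model complex\<close>

text \<open>
  Open stars of the vertices, punctured at the midpoints of the edges so that the two ends of a
  loop do not meet, and tubular neighbourhoods of the open edges \<open>a\<close> and \<open>d\<close>. Each of them contracts
  to its centre along straight lines of the tiles.
\<close>

datatype chart = Star 6 | Arc_a 6 | Arc_d 6

fun near :: "chart \<Rightarrow> cell_point \<Rightarrow> bool" where
  "near (Star k) (Vert j) = (j = k)"
| "near (Star k) (On_a j t) = (j = k \<and> t \<noteq> 1 / 2)"
| "near (Star k) (On_b j s) = (j = k \<or> j + 1 = k)"
| "near (Star k) (On_d j t) = (j = k \<and> t < 1 / 2 \<or> j + 2 = k \<and> 1 / 2 < t)"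
| "near (Star k) (In_C j t s) = ((j = k \<or> j + 1 = k) \<and> t \<noteq> 1 / 2)"
| "near (Star k) (In_D j t s) = (j = k \<and> t < 1 / 4 \<or> j + 2 = k \<and> 1 / 4 < t \<and> t < 3 / 4 \<or>
     j + 4 = k \<and> 3 / 4 < t \<or> j + 1 = k \<and> t < 1 / 2 \<or> j + 3 = k \<and> 1 / 2 < t)"
| "near (Arc_a k) (On_a j t) = (j = k)"
| "near (Arc_a k) (In_C j t s) = (j = k \<or> j + 1 = k)"
| "near (Arc_d k) (On_d j t) = (j = k)"
| "near (Arc_d k) (In_D j t s) = (j = k \<and> t < 1 / 2 \<or> j + 2 = k \<and> 1 / 2 < t \<or> j + 1 = k)"
| "near _ _ = False"

definition chart_domain :: "chart \<Rightarrow> cell_point set" where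
  "chart_domain O' = {y \<in> tiled. near O' y}"

text \<open>The targets are the corners and edge midpoints as seen in a tile. The bottom of
  \<open>tile_D\<close> carries two edges \<open>d\<close>, with vertices at 0,
  \<open>1 / 2\<close>, 1 and midpoints at \<open>1 / 4\<close> and \<open>3 / 4\<close>; its top
  carries one, with midpoint \<open>1 / 2\<close>. The five corners of \<open>tile_D j\<close> are
  the distinct vertices \<open>j\<close> to \<open>j + 4\<close>, so \<open>k\<close> decides the
  target. In \<open>tile_C\<close> each vertex occurs at two corners, and the half containing
  \<open>t\<close> decides.\<close>

fun contract :: "chart \<Rightarrow> cell_point \<Rightarrow> real \<Rightarrow> cell_point" where
  "contract (Star k) (On_a j t) r = edge_a j ((1 - r) * t + (if t < 1 / 2 then 0 else r))"
| "contract (Star k) (On_b j s) r = edge_b j ((1 - r) * s + (if j = k then 0 else r))"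
| "contract (Star k) (On_d j t) r = edge_d j ((1 - r) * t + (if j = k then 0 else r))"
| "contract (Star k) (In_C j t s) r =
     tile_C j ((1 - r) * t + (if t < 1 / 2 then 0 else r)) ((1 - r) * s + (if j = k then 0 else r))"
| "contract (Star k) (In_D j t s) r =
     tile_D j ((1 - r) * t + r * (if j = k \<or> j + 1 = k then 0 else if j + 2 = k then 1 / 2 else 1))
       ((1 - r) * s + (if j = k \<or> j + 2 = k \<or> j + 4 = k then 0 else r))"
| "contract (Arc_a k) (On_a j t) r = edge_a j ((1 - r) * t + r / 2)"
| "contract (Arc_a k) (In_C j t s) r = tile_C j ((1 - r) * t + r / 2) ((1 - r) * s + (if j = k then 0 else r))"
| "contract (Arc_d k) (On_d j t) r = edge_d j ((1 - r) * t + r / 2)"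
| "contract (Arc_d k) (In_D j t s) r =
     tile_D j ((1 - r) * t + r * (if j = k then 1 / 4 else if j + 2 = k then 3 / 4 else 1 / 2))
       ((1 - r) * s + (if j = k \<or> j + 2 = k then 0 else r))"
| "contract _ y r = y"

text \<open>
  \<open>d = cb\<close> turns the braid relation \<open>bcb = cbc\<close> into \<open>bdb = dd\<close>. Below, \<open>centre_word\<close> is the
  holonomy inside a chart from the frame of a point, which sits at the base vertex of its open cell,
  to the centre of the chart, and \<open>corner_word\<close> is the holonomy inside a tile from the corner
  \<open>(0, 0)\<close> to the frame of a point. That their product is locally constant is what makes the
  holonomy well defined, and it is where the defining relations are used.
\<close>

definition word_a :: "artin_gen word" where "word_a = [(gen_a, True)]"
definition word_b :: "artin_gen word" where "word_b = [(gen_b, True)]"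
definition word_d :: "artin_gen word" where "word_d = [(gen_c, True), (gen_b, True)]"

fun centre_word :: "chart \<Rightarrow> cell_point \<Rightarrow> artin_gen word" where
  "centre_word (Star k) (On_a j t) = (if t < 1 / 2 then [] else word_a)"
| "centre_word (Star k) (On_b j s) = (if j = k then [] else word_b)"
| "centre_word (Star k) (On_d j t) = (if j = k then [] else word_d)"
| "centre_word (Star k) (In_C j t s) = (if j = k then [] else word_b) @ (if t < 1 / 2 then [] else word_a)"
| "centre_word (Star k) (In_D j t s) = (if j = k then [] else if j + 1 = k then word_b
     else if j + 2 = k then word_d else if j + 3 = k then word_b @ word_d else word_d @ word_d)"
| "centre_word (Arc_a k) (In_C j t s) = (if j = k then [] else word_b)"
| "centre_word (Arc_d k) (In_D j t s) = (if j = k then [] else if j + 2 = k then word_d else word_b)"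
| "centre_word _ _ = []"

fun corner_word :: "tile \<Rightarrow> real \<times> real \<Rightarrow> artin_gen word" where
  "corner_word (Tile_C k) (t, s) = (if 1 \<le> s then word_b else []) @ (if 1 \<le> t then word_a else [])"
| "corner_word (Tile_D k) (t, s) = (if s \<le> 0 then (if t < 1 / 2 then [] else if t < 1 then word_d else word_d @ word_d)
     else if 1 \<le> s then (if t < 1 then word_b else word_b @ word_d)
     else if t < 1 then [] else word_b @ word_d)"

definition artin_rels :: "(artin_gen word \<times> artin_gen word) set" where
  "artin_rels = {(pos_word [gen_a, gen_b], pos_word [gen_b, gen_a]),
      (pos_word [gen_b, gen_c, gen_b], pos_word [gen_c, gen_b, gen_c])}"

abbreviation artin_eq :: "artin_gen word \<Rightarrow> artin_gen word \<Rightarrow> bool" (infix "\<simeq>" 50) where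
  "u \<simeq> v \<equiv> word_eq artin_rels u v"

lemma artin_eq_rules:
  "word_a @ word_b \<simeq> word_b @ word_a" "word_b @ word_a \<simeq> word_a @ word_b"
  "word_b @ word_d @ word_b \<simeq> word_d @ word_d" "word_d @ word_d \<simeq> word_b @ word_d @ word_b"
proof -
  show 1: "word_a @ word_b \<simeq> word_b @ word_a"
    by (rule word_eq.relation) (simp add: artin_rels_def pos_word_def word_a_def word_b_def)
  then show "word_b @ word_a \<simeq> word_a @ word_b" by (rule word_eq.sym)
  have "pos_word [gen_b, gen_c, gen_b] @ word_b \<simeq> pos_word [gen_c, gen_b, gen_c] @ word_b"
    by (intro word_eq.append word_eq.relation word_eq.refl) (simp add: artin_rels_def)
  then show 2: "word_b @ word_d @ word_b \<simeq> word_d @ word_d"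
    by (simp add: pos_word_def word_b_def word_d_def)
  then show "word_d @ word_d \<simeq> word_b @ word_d @ word_b" by (rule word_eq.sym)
qed

text \<open>One sheet of a chart inside a tile: the geometric and the algebraic property of charts
  in one predicate. The word \<open>w\<close> spells a boundary path from \<open>(0, 0)\<close> to
  the target \<open>p\<close>, or to the tail of the edge whose midpoint is
  \<open>p\<close>.\<close>

definition chart_region :: "chart \<Rightarrow> tile \<Rightarrow> (real \<times> real) set \<Rightarrow> real \<times> real \<Rightarrow> artin_gen word \<Rightarrow> bool" where
  "chart_region O' c N p w \<longleftrightarrow> open N \<and> (\<forall>z\<in>N. near O' (tile_map c z) \<and>
     corner_word c z @ centre_word O' (tile_map c z) \<simeq> w \<and>
     (\<forall>r\<in>{0..1}. contract O' (tile_map c z) r = tile_map c ((1 - r) *\<^sub>R z + r *\<^sub>R p)))"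

text \<open>Regions spill over the sides of the unit square, where the tile is clamped. A region
  only crosses sides that contain its target, and a coordinate beyond such a side stays beyond it
  during the contraction, so clamping and contraction are compatible.\<close>

lemma interpolate_le_0: "t \<le> 0 \<Longrightarrow> 0 \<le> r \<Longrightarrow> r \<le> 1 \<Longrightarrow> (1 - r) * t \<le> (0::real)"
  by (simp add: mult_nonneg_nonpos)

lemma interpolate_ge_1: "1 \<le> t \<Longrightarrow> 0 \<le> r \<Longrightarrow> r \<le> 1 \<Longrightarrow> 1 \<le> (1 - r) * t + (r::real)"
  using mult_left_mono[of 1 t "1 - r"] by simp

lemmas tile_defs = tile_C_def tile_D_def edge_a_def edge_b_def edge_d_def

lemma interpolate_simps:
  fixes r t :: real
  assumes "0 \<le> r" "r \<le> 1"
  shows "t \<le> 0 \<Longrightarrow> (1 - r) * t \<le> 0" "t \<le> 0 \<Longrightarrow> \<not> 1 \<le> (1 - r) * t"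
    "1 \<le> t \<Longrightarrow> 1 \<le> (1 - r) * t + r" "1 \<le> t \<Longrightarrow> \<not> (1 - r) * t + r \<le> 0"
  using assms interpolate_le_0[of t r] interpolate_ge_1[of t r] by auto

lemma chart_regionI:
  assumes "open N"
    and "\<And>t s. (t, s) \<in> N \<Longrightarrow> near O' (tile_map c (t, s)) \<and>
      corner_word c (t, s) @ centre_word O' (tile_map c (t, s)) \<simeq> w"
    and "\<And>t s r. (t, s) \<in> N \<Longrightarrow> 0 \<le> r \<Longrightarrow> r \<le> 1 \<Longrightarrow>
      contract O' (tile_map c (t, s)) r = tile_map c ((1 - r) * t + r * fst p, (1 - r) * s + r * snd p)"
  shows "chart_region O' c N p w"
  using assms unfolding chart_region_def by (auto simp: scaleR_prod_def plus_prod_def)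

lemma region_Star_C:
  "chart_region (Star k) (Tile_C k) {z. snd z < 1 \<and> fst z < 1 / 2} (0, 0) []"
  "chart_region (Star k) (Tile_C k) {z. snd z < 1 \<and> 1 / 2 < fst z} (1, 0) word_a"
  "j + 1 = k \<Longrightarrow> chart_region (Star k) (Tile_C j) {z. 0 < snd z \<and> fst z < 1 / 2} (0, 1) word_b"
  "j + 1 = k \<Longrightarrow> chart_region (Star k) (Tile_C j) {z. 0 < snd z \<and> 1 / 2 < fst z} (1, 1) (word_b @ word_a)"
  by (rule chart_regionI,
      (intro open_Collect_conj open_Collect_less continuous_intros)[],
      (auto simp: tile_defs word_eq.refl artin_eq_rules)[],
      (auto simp: tile_defs interpolate_simps)[])+

lemma region_Arc_a:
  "chart_region (Arc_a k) (Tile_C k) {z. snd z < 1 \<and> 0 < fst z \<and> fst z < 1} (1 / 2, 0) []"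
  "j + 1 = k \<Longrightarrow> chart_region (Arc_a k) (Tile_C j) {z. 0 < snd z \<and> 0 < fst z \<and> fst z < 1} (1 / 2, 1) word_b"
  by (rule chart_regionI,
      (intro open_Collect_conj open_Collect_less continuous_intros)[],
      (auto simp: tile_defs word_eq.refl artin_eq_rules)[],
      (auto simp: tile_defs interpolate_simps)[])+

text \<open>The nested conditionals of \<open>tile_D\<close> give precedence to the horizontal
  sides. Since adjacent sides agree where their domains overlap, each formula also holds beyond the
  corners.\<close>

lemma tile_D_sides:
  "s \<le> 0 \<Longrightarrow> t \<le> 1 / 2 \<Longrightarrow> tile_D k t s = edge_d k (2 * t)"
  "s \<le> 0 \<Longrightarrow> 1 / 2 \<le> t \<Longrightarrow> tile_D k t s = edge_d (k + 2) (2 * t - 1)"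
  "1 \<le> s \<Longrightarrow> tile_D k t s = edge_d (k + 1) t"
  "t \<le> 0 \<Longrightarrow> tile_D k t s = edge_b k s"
  "1 \<le> t \<Longrightarrow> tile_D k t s = edge_b (k + 3) (1 - s)"
  by (auto simp: tile_defs)

lemma contract_Star_edge:
  assumes "0 \<le> r" "r \<le> 1"
  shows "t < 1 / 2 \<Longrightarrow> contract (Star k) (edge_d k t) r = edge_d k ((1 - r) * t)"
    "1 / 2 < t \<Longrightarrow> j + 2 = k \<Longrightarrow> contract (Star k) (edge_d j t) r = edge_d j ((1 - r) * t + r)"
    "t < 1 \<Longrightarrow> contract (Star k) (edge_b k t) r = edge_b k ((1 - r) * t)"
    "0 < t \<Longrightarrow> j + 1 = k \<Longrightarrow> contract (Star k) (edge_b j t) r = edge_b j ((1 - r) * t + r)"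
  using assms by (auto simp: edge_d_def edge_b_def interpolate_simps)

lemma tile_D_cases:
  fixes t s :: real
  shows "s \<le> 0 \<or> 1 \<le> s \<or> t \<le> 0 \<or> 1 \<le> t \<or> 0 < t \<and> t < 1 \<and> 0 < s \<and> s < 1"
  by linarith

lemma tile_D_interior: "0 < t \<Longrightarrow> t < 1 \<Longrightarrow> 0 < s \<Longrightarrow> s < 1 \<Longrightarrow> tile_D k t s = In_D k t s"
  by (simp add: tile_D_def)

lemmas tile_D_simps = tile_D_sides tile_D_interior
lemmas region_simps = tile_defs word_eq.refl artin_eq_rules
lemmas region_intros = open_Collect_conj open_Collect_less continuous_intros

lemma region_Star_D1:
  "chart_region (Star k) (Tile_D k) {z. snd z < 1 \<and> fst z < 1 / 4} (0, 0) []"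
proof (rule chart_regionI, goal_cases)
  case (3 t s r)
  then have r: "0 \<le> r" "r \<le> 1" and ts: "s < 1" "t < 1 / 4" by auto
  have le: "(1 - r) * t \<le> 1 / 2"
    using ts r mult_left_le_one_le[of "max 0 t" "1 - r"] mult_left_mono[of t "max 0 t" "1 - r"] by linarith
  show ?case
    using ts r le contract_Star_edge(1)[of r "2 * t" k] tile_D_cases[of s t]
    apply -
    apply (elim disjE conjE)
    apply (auto simp: tile_D_simps contract_Star_edge interpolate_simps mult.left_commute)
    done
qed (auto simp: region_simps intro!: region_intros)

lemma region_Star_D2:
  assumes "j + 2 = k"
  shows "chart_region (Star k) (Tile_D j) {z. snd z < 1 \<and> 1 / 4 < fst z \<and> fst z < 3 / 4} (1 / 2, 0) word_d"
proof (rule chart_regionI, goal_cases)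
  case (3 t s r)
  then have r: "0 \<le> r" "r \<le> 1" and ts: "s < 1" "1 / 4 < t" "t < 3 / 4" by auto
  \<comment> \<open>The line to \<open>(1 / 2, 0)\<close> never passes from one of the two bottom
    edges to the other, so the same formula for the bottom side applies throughout.\<close>
  have le: "t \<le> 1 / 2 \<Longrightarrow> (1 - r) * t + r / 2 \<le> 1 / 2" "1 / 2 \<le> t \<Longrightarrow> 1 / 2 \<le> (1 - r) * t + r / 2"
    using r mult_left_mono[of t "1 / 2" "1 - r"] mult_left_mono[of "1 / 2" t "1 - r"] by (auto simp: field_simps)
  show ?case
    using ts r le assms tile_D_cases[of s t]
    apply -
    apply (elim disjE conjE; cases "t \<le> 1 / 2")
    apply (auto simp: tile_D_simps contract_Star_edge interpolate_simps mult.left_commute)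
    apply (simp add: algebra_simps)
    done
qed (use assms in \<open>auto simp: region_simps intro!: region_intros\<close>)

lemma region_Star_D3:
  assumes "j + 4 = k"
  shows "chart_region (Star k) (Tile_D j) {z. snd z < 1 \<and> 3 / 4 < fst z} (1, 0) (word_d @ word_d)"
proof (rule chart_regionI, goal_cases)
  case (3 t s r)
  then have r: "0 \<le> r" "r \<le> 1" and ts: "s < 1" "3 / 4 < t" by auto
  have le: "1 / 2 \<le> (1 - r) * t + r"
    using r ts mult_left_mono[of "1 / 2" t "1 - r"] by (auto simp: field_simps)
  show ?case
    using ts r le assms tile_D_cases[of s t]
    apply -
    apply (elim disjE conjE)
    apply (auto simp: tile_D_simps contract_Star_edge interpolate_simps)
    apply (simp_all add: algebra_simps)
    done
qed (use assms in \<open>auto simp: region_simps intro!: region_intros\<close>)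

lemma region_Star_D4:
  assumes "j + 1 = k"
  shows "chart_region (Star k) (Tile_D j) {z. 0 < snd z \<and> fst z < 1 / 2} (0, 1) word_b"
proof (rule chart_regionI, goal_cases)
  case (3 t s r)
  then have r: "0 \<le> r" "r \<le> 1" and ts: "0 < s" "t < 1 / 2" by auto
  show ?case
    using ts r assms tile_D_cases[of s t]
    apply -
    apply (elim disjE conjE)
    apply (auto simp: tile_D_simps contract_Star_edge interpolate_simps)
    done
qed (use assms in \<open>auto simp: region_simps intro!: region_intros\<close>)

lemma region_Star_D5:
  assumes "j + 3 = k"
  shows "chart_region (Star k) (Tile_D j) {z. 0 < snd z \<and> 1 / 2 < fst z} (1, 1) (word_b @ word_d)"
proof (rule chart_regionI, goal_cases)
  case (3 t s r)
  then have r: "0 \<le> r" "r \<le> 1" and ts: "0 < s" "1 / 2 < t" by auto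
  show ?case
    using ts r assms tile_D_cases[of s t]
    apply -
    apply (elim disjE conjE)
    apply (auto simp: tile_D_simps contract_Star_edge interpolate_simps)
    apply (simp add: algebra_simps)
    done
qed (use assms in \<open>auto simp: region_simps intro!: region_intros\<close>)

lemma contract_Arc_d_edge:
  assumes "0 \<le> r" "r \<le> 1" "0 < t" "t < 1"
  shows "contract (Arc_d k) (edge_d k t) r = edge_d k ((1 - r) * t + r / 2)"
  using assms by (auto simp: edge_d_def)

lemma region_Arc_d1:
  "chart_region (Arc_d k) (Tile_D k) {z. snd z < 1 \<and> 0 < fst z \<and> fst z < 1 / 2} (1 / 4, 0) []"
proof (rule chart_regionI, goal_cases)
  case (3 t s r)
  then have r: "0 \<le> r" "r \<le> 1" and ts: "s < 1" "0 < t" "t < 1 / 2" by auto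
  have le: "(1 - r) * t + r / 4 \<le> 1 / 2"
    using r ts mult_left_mono[of t "1 / 2" "1 - r"] by (auto simp: field_simps)
  show ?case
    using ts r le tile_D_cases[of s t]
    apply -
    apply (elim disjE conjE)
    apply (auto simp: tile_D_simps contract_Arc_d_edge interpolate_simps)
    apply (simp_all add: algebra_simps)
    done
qed (auto simp: region_simps intro!: region_intros)

lemma region_Arc_d2:
  assumes "j + 2 = k"
  shows "chart_region (Arc_d k) (Tile_D j) {z. snd z < 1 \<and> 1 / 2 < fst z \<and> fst z < 1} (3 / 4, 0) word_d"
proof (rule chart_regionI, goal_cases)
  case (3 t s r)
  then have r: "0 \<le> r" "r \<le> 1" and ts: "s < 1" "1 / 2 < t" "t < 1" by auto
  have le: "1 / 2 \<le> (1 - r) * t + r * 3 / 4"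
    using r ts mult_left_mono[of "1 / 2" t "1 - r"] by (auto simp: field_simps)
  show ?case
    using ts r le assms tile_D_cases[of s t]
    apply -
    apply (elim disjE conjE)
    apply (auto simp: tile_D_simps contract_Arc_d_edge interpolate_simps)
    apply (simp_all add: algebra_simps)
    done
qed (use assms in \<open>auto simp: region_simps intro!: region_intros\<close>)

lemma region_Arc_d3:
  assumes "j + 1 = k"
  shows "chart_region (Arc_d k) (Tile_D j) {z. 0 < snd z \<and> 0 < fst z \<and> fst z < 1} (1 / 2, 1) word_b"
proof (rule chart_regionI, goal_cases)
  case (3 t s r)
  then have r: "0 \<le> r" "r \<le> 1" and ts: "0 < s" "0 < t" "t < 1" by auto
  show ?case
    using ts r assms tile_D_cases[of s t]
    apply -
    apply (elim disjE conjE)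
    apply (auto simp: tile_D_simps contract_Arc_d_edge interpolate_simps)
    done
qed (use assms in \<open>auto simp: region_simps intro!: region_intros\<close>)

definition has_region :: "chart \<Rightarrow> tile \<Rightarrow> real \<times> real \<Rightarrow> bool" where
  "has_region O' c z \<longleftrightarrow> (\<exists>N p w. z \<in> N \<and> chart_region O' c N p w)"

lemma has_regionI:
  "chart_region O' c N p w \<Longrightarrow> z \<in> N \<Longrightarrow> has_region O' c z"
  by (auto simp only: has_region_def)

text \<open>\<open>near\<close> speaks of normal forms, a region of coordinates. They are matched by
  evaluating the tile in its interior and on each side, and the regions turn out to fill the
  preimage of the chart.\<close>

lemma chart_region_exists:
  assumes "near O' (tile_map c z)"
  shows "has_region O' c z"
proof -
  obtain t s where z: "z = (t, s)" by (cases z)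
  show ?thesis
  proof (cases c)
    case c: (Tile_C j)
    show ?thesis
    proof (cases O')
      case (Star k)
      note r = region_Star_C[THEN has_regionI, where z = "(t, s)"]
      consider "j = k" "s < 1" "t < 1 / 2" | "j = k" "s < 1" "1 / 2 < t"
        | "j + 1 = k" "0 < s" "t < 1 / 2" | "j + 1 = k" "0 < s" "1 / 2 < t"
        using assms unfolding z c Star by (auto simp: tile_defs split: if_splits) linarith+
      then show ?thesis
        unfolding z c Star by cases (simp_all add: r)
    next
      case (Arc_a k)
      note r = region_Arc_a[THEN has_regionI, where z = "(t, s)"]
      consider "j = k" "s < 1" "0 < t" "t < 1" | "j + 1 = k" "0 < s" "0 < t" "t < 1"
        using assms unfolding z c Arc_a by (auto simp: tile_defs split: if_splits)
      then show ?thesis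
        unfolding z c Arc_a by cases (simp_all add: r)
    next
      case (Arc_d k)
      then show ?thesis
        using assms unfolding z c by (auto simp: tile_defs split: if_splits)
    qed
  next
    case c: (Tile_D j)
    show ?thesis
    proof (cases O')
      case (Star k)
      note r = region_Star_D1[THEN has_regionI, where z = "(t, s)"] region_Star_D2[THEN has_regionI, where z = "(t, s)"]
        region_Star_D3[THEN has_regionI, where z = "(t, s)"] region_Star_D4[THEN has_regionI, where z = "(t, s)"]
        region_Star_D5[THEN has_regionI, where z = "(t, s)"]
      consider "j = k" "s < 1" "t < 1 / 4" | "j + 2 = k" "s < 1" "1 / 4 < t" "t < 3 / 4"
        | "j + 4 = k" "s < 1" "3 / 4 < t"
        | "j + 1 = k" "0 < s" "t < 1 / 2" | "j + 3 = k" "0 < s" "1 / 2 < t"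
        using assms unfolding z c Star by (auto simp: tile_defs split: if_splits)
      then show ?thesis
        unfolding z c Star by cases (simp_all add: r)
    next
      case (Arc_d k)
      note r = region_Arc_d1[THEN has_regionI, where z = "(t, s)"] region_Arc_d2[THEN has_regionI, where z = "(t, s)"]
        region_Arc_d3[THEN has_regionI, where z = "(t, s)"]
      consider "j = k" "s < 1" "0 < t" "t < 1 / 2" | "j + 2 = k" "s < 1" "1 / 2 < t" "t < 1"
        | "j + 1 = k" "0 < s" "0 < t" "t < 1"
        using assms unfolding z c Arc_d by (auto simp: tile_defs split: if_splits)
      then show ?thesis
        unfolding z c Arc_d by cases (simp_all add: r)
    next
      case (Arc_a k)
      then show ?thesis
        using assms unfolding z c by (auto simp: tile_defs split: if_splits)
    qed
  qed
qed

lemma near_regionE: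
  assumes "near O' (tile_map c z)"
  obtains N p w where "z \<in> N" "chart_region O' c N p w"
  using chart_region_exists[OF assms] by (auto simp only: has_region_def)

section \<open>Lifting words to paths\<close>

lemma homotopic_paths_self_reparametrize:
  assumes p: "path p" "path_image p \<subseteq> T"
    and fg: "path f" "path g" "path_image f \<subseteq> {0..1}" "path_image g \<subseteq> {0..1}"
      "pathstart f = pathstart g" "pathfinish f = pathfinish g"
  shows "homotopic_paths T (p \<circ> f) (p \<circ> g)"
  by (rule homotopic_paths_through_convex[of "{0..1}"]) (use assms in \<open>auto simp: path_def path_image_def\<close>)

lemma linepath_image_unit:
  "a \<in> {0..1} \<Longrightarrow> b \<in> {0..1} \<Longrightarrow> path_image (linepath a b) \<subseteq> {0..1::real}"
  using closed_segment_subset[of a "{0..1}" b] by (simp add: path_image_linepath)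

text \<open>All the paths involved are \<open>p\<close> composed with a path in the unit interval,
  and there only the ends matter.\<close>

lemma homotopic_paths_units:
  assumes p: "path p" "path_image p \<subseteq> T"
  shows "homotopic_paths T (p +++ (\<lambda>_. pathfinish p)) p"
    and "homotopic_paths T ((\<lambda>_. pathstart p) +++ p) p"
    and "homotopic_paths T (p +++ reversepath p) (\<lambda>_. pathstart p)"
    and "homotopic_paths T (reversepath p +++ p) (\<lambda>_. pathfinish p)"
proof -
  have l: "linepath a a = (\<lambda>_. a)" for a :: real by (simp add: linepath_def fun_eq_iff algebra_simps)
  have e: "p \<circ> linepath 0 1 = p" "p \<circ> linepath 1 1 = (\<lambda>_. pathfinish p)" "p \<circ> linepath 0 0 = (\<lambda>_. pathstart p)"
    "p \<circ> linepath 1 0 = reversepath p"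
    by (auto simp: linepath_def fun_eq_iff pathstart_def pathfinish_def reversepath_def)
  note r = homotopic_paths_self_reparametrize[OF p, of "linepath a b +++ linepath b d" "linepath a d" for a b d]
  note i = linepath_image_unit
  show "homotopic_paths T (p +++ (\<lambda>_. pathfinish p)) p"
    using r[of 0 1 1] i by (simp add: path_compose_join e path_image_join)
  show "homotopic_paths T ((\<lambda>_. pathstart p) +++ p) p"
    using r[of 0 0 1] i by (simp add: path_compose_join e path_image_join)
  show "homotopic_paths T (p +++ reversepath p) (\<lambda>_. pathstart p)"
    using r[of 0 1 0] i by (simp add: path_compose_join e path_image_join)
  show "homotopic_paths T (reversepath p +++ p) (\<lambda>_. pathfinish p)"
    using r[of 1 0 1] i by (simp add: path_compose_join e path_image_join)
qed

abbreviation homotopic_tiled :: "(real \<Rightarrow> cell_point) \<Rightarrow> (real \<Rightarrow> cell_point) \<Rightarrow> bool" (infix "\<asymp>" 50) where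
  "p \<asymp> q \<equiv> homotopic_paths tiled p q"

abbreviation tiled_path :: "(real \<Rightarrow> cell_point) \<Rightarrow> bool" where
  "tiled_path p \<equiv> path p \<and> path_image p \<subseteq> tiled"

lemma tiled_path_join: "tiled_path p \<Longrightarrow> tiled_path q \<Longrightarrow> pathfinish p = pathstart q \<Longrightarrow> tiled_path (p +++ q)"
  by (auto simp: path_image_join)

lemma tiled_path_tile_map: "path f \<Longrightarrow> tiled_path (tile_map c \<circ> f)"
  by (auto intro!: path_continuous_image continuous_on_tile_map[OF continuous_on_id]
      simp: path_image_def)

lemma homotopic_tile_map:
  assumes "path f" "path g" "pathstart f = pathstart g" "pathfinish f = pathfinish g"
  shows "tile_map c \<circ> f \<asymp> tile_map c \<circ> g"
  by (rule homotopic_paths_through_convex[of UNIV])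
    (use assms in \<open>auto intro: continuous_on_tile_map[OF continuous_on_id]\<close>)

lemma homotopic_join_left: "p \<asymp> p' \<Longrightarrow> tiled_path q \<Longrightarrow> pathfinish p = pathstart q \<Longrightarrow> p +++ q \<asymp> p' +++ q"
  by (intro homotopic_paths_join) auto

lemma homotopic_join_right: "q \<asymp> q' \<Longrightarrow> tiled_path p \<Longrightarrow> pathfinish p = pathstart q \<Longrightarrow> p +++ q \<asymp> p +++ q'"
  by (intro homotopic_paths_join) auto

lemma homotopic_assoc:
  "tiled_path p \<Longrightarrow> tiled_path q \<Longrightarrow> tiled_path r \<Longrightarrow> pathfinish p = pathstart q \<Longrightarrow> pathfinish q = pathstart r \<Longrightarrow>
    (p +++ q) +++ r \<asymp> p +++ (q +++ r)"
  by (rule homotopic_paths_sym, rule homotopic_paths_assoc) auto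

lemma edge_eq_tile_map:
  "edge_a k = tile_map (Tile_C k) \<circ> linepath (0, 0) (1, 0)"
  "edge_a (k + 1) = tile_map (Tile_C k) \<circ> linepath (0, 1) (1, 1)"
  "edge_b k = tile_map (Tile_C k) \<circ> linepath (0, 0) (0, 1)"
  "edge_b k = tile_map (Tile_C k) \<circ> linepath (1, 0) (1, 1)"
  "edge_b k = tile_map (Tile_D k) \<circ> linepath (0, 0) (0, 1)"
  "edge_b (k + 3) = tile_map (Tile_D k) \<circ> linepath (1, 1) (1, 0)"
  "edge_d (k + 1) = tile_map (Tile_D k) \<circ> linepath (0, 1) (1, 1)"
  by (auto simp: fun_eq_iff linepath_def tile_defs scaleR_prod_def plus_prod_def field_simps)

lemma edge_ends [simp]:
  "pathstart (edge_a k) = Vert k" "pathfinish (edge_a k) = Vert k"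
  "pathstart (edge_b k) = Vert k" "pathfinish (edge_b k) = Vert (k + 1)"
  "pathstart (edge_d k) = Vert k" "pathfinish (edge_d k) = Vert (k + 2)"
  by (auto simp: pathstart_def pathfinish_def tile_defs)

lemma edge_tiled [simp]:
  "path (edge_a k)" "path_image (edge_a k) \<subseteq> tiled"
  "path (edge_b k)" "path_image (edge_b k) \<subseteq> tiled"
  "path (edge_d k)" "path_image (edge_d k) \<subseteq> tiled"
  using tiled_path_tile_map[of "linepath (0, 0) (1, 0)" "Tile_C k"]
    tiled_path_tile_map[of "linepath (0, 0) (0, 1)" "Tile_C k"]
    tiled_path_tile_map[of "linepath (0, 1) (1, 1)" "Tile_D (k - 1)"]
  by (simp_all flip: edge_eq_tile_map)

text \<open>Only a homotopy, since the functions differ outside the unit interval: beyond its half,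
  the bottom side of the tile runs on into the neighbouring edge, while \<open>edge_d\<close> stops
  at a vertex.\<close>

lemma edge_d_eq_tile_map:
  "edge_d k \<asymp> tile_map (Tile_D k) \<circ> linepath (0, 0) (1 / 2, 0)"
  "edge_d (k + 2) \<asymp> tile_map (Tile_D k) \<circ> linepath (1 / 2, 0) (1, 0)"
  by (rule homotopic_paths_eq;
      auto simp: linepath_def tile_defs scaleR_prod_def plus_prod_def field_simps)+

lemma Vert_tiled [simp]: "Vert k \<in> tiled"
  using tile_map_in_tiled[of "Tile_C k" "(0, 0)"] by (simp add: tile_defs)

lemma const_path_ends [simp]: "pathstart (\<lambda>_. y) = y" "pathfinish (\<lambda>_. y) = y"
  by (simp_all add: pathstart_def pathfinish_def)

lemma const_path_tiled: "y \<in> tiled \<Longrightarrow> tiled_path (\<lambda>_. y)"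
  by (auto simp: path_def path_image_def)

section \<open>Degrees of words and their lifts to edge paths\<close>

fun gen_degree :: "artin_gen \<Rightarrow> 6" where
  "gen_degree gen_a = 0" | "gen_degree gen_b = 1" | "gen_degree gen_c = 1"

fun letter_degree :: "artin_gen \<times> bool \<Rightarrow> 6" where
  "letter_degree (g, b) = (if b then gen_degree g else - gen_degree g)"

definition word_degree :: "artin_gen word \<Rightarrow> 6" where
  "word_degree w = sum_list (map letter_degree w)"

text \<open>The complex has no edge \<open>c\<close>. As d = cb, the letter \<open>c\<close> is
  \<open>d\<close> followed by \<open>b\<close> backwards, which leads from \<open>k\<close> to
  \<open>k + 2\<close> and back to \<open>k + 1\<close>.\<close>

fun lift_gen :: "artin_gen \<Rightarrow> 6 \<Rightarrow> real \<Rightarrow> cell_point" where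
  "lift_gen gen_a k = edge_a k"
| "lift_gen gen_b k = edge_b k"
| "lift_gen gen_c k = edge_d k +++ reversepath (edge_b (k + 1))"

fun lift_letter :: "artin_gen \<times> bool \<Rightarrow> 6 \<Rightarrow> real \<Rightarrow> cell_point" where
  "lift_letter (g, True) k = lift_gen g k"
| "lift_letter (g, False) k = reversepath (lift_gen g (k - gen_degree g))"

fun lift_word :: "artin_gen word \<Rightarrow> 6 \<Rightarrow> real \<Rightarrow> cell_point" where
  "lift_word [] k = (\<lambda>_. Vert k)"
| "lift_word (l # w) k = lift_letter l k +++ lift_word w (k + letter_degree l)"

lemma word_degree_simps [simp]:
  "word_degree [] = 0" "word_degree (l # w) = letter_degree l + word_degree w"
  "word_degree (u @ v) = word_degree u + word_degree v"
  by (simp_all add: word_degree_def)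

lemma lift_gen_path [simp]:
  "path (lift_gen g k)" "path_image (lift_gen g k) \<subseteq> tiled"
  "pathstart (lift_gen g k) = Vert k" "pathfinish (lift_gen g k) = Vert (k + gen_degree g)"
  by (cases g; simp add: path_image_join)+

lemma lift_letter_path [simp]:
  "path (lift_letter l k)" "path_image (lift_letter l k) \<subseteq> tiled"
  "pathstart (lift_letter l k) = Vert k" "pathfinish (lift_letter l k) = Vert (k + letter_degree l)"
  by (cases "(l, k)" rule: lift_letter.cases; simp)+

lemma lift_word_path [simp]:
  "path (lift_word w k) \<and> path_image (lift_word w k) \<subseteq> tiled \<and>
   pathstart (lift_word w k) = Vert k \<and> pathfinish (lift_word w k) = Vert (k + word_degree w)"
  by (induction w arbitrary: k) (simp_all add: const_path_tiled path_image_join add.assoc)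

lemmas lift_word_pathD [simp] =
  lift_word_path[THEN conjunct1] lift_word_path[THEN conjunct2, THEN conjunct1]
  lift_word_path[THEN conjunct2, THEN conjunct2, THEN conjunct1]
  lift_word_path[THEN conjunct2, THEN conjunct2, THEN conjunct2]

lemma lift_word_append: "lift_word (u @ v) k \<asymp> lift_word u k +++ lift_word v (k + word_degree u)"
proof (induction u arbitrary: k)
  case Nil
  show ?case
    using homotopic_paths_units(2)[of "lift_word v k" tiled] by (simp add: homotopic_paths_sym)
next
  case (Cons l u)
  have "lift_word ((l # u) @ v) k \<asymp> lift_letter l k +++ (lift_word u (k + letter_degree l) +++ lift_word v (k + word_degree (l # u)))"
    using Cons.IH[of "k + letter_degree l"] by (simp add: homotopic_join_right add.assoc)
  also have "\<dots> \<asymp> lift_word (l # u) k +++ lift_word v (k + word_degree (l # u))"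
    using homotopic_paths_sym[OF homotopic_assoc, of "lift_letter l k" "lift_word u (k + letter_degree l)" "lift_word v (k + word_degree (l # u))"]
    by (simp add: add.assoc)
  finally show ?case .
qed

lemma lift_word_single: "lift_word [l] k \<asymp> lift_letter l k"
  using homotopic_paths_units(1)[of "lift_letter l k" tiled] by simp

lemma lift_word_edges:
  "lift_word word_a k \<asymp> edge_a k" "lift_word word_b k \<asymp> edge_b k" "lift_word word_d k \<asymp> edge_d k"
proof -
  show "lift_word word_a k \<asymp> edge_a k" "lift_word word_b k \<asymp> edge_b k"
    using lift_word_single[of "(gen_a, True)" k] lift_word_single[of "(gen_b, True)" k]
    by (simp_all add: word_a_def word_b_def)
  have "lift_word word_d k \<asymp> (edge_d k +++ reversepath (edge_b (k + 1))) +++ edge_b (k + 1)"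
    using homotopic_paths_units(1)[of "edge_b (k + 1)" tiled] lift_gen_path[of gen_c k]
    by (simp add: word_d_def add.commute homotopic_join_right)
  also have "\<dots> \<asymp> edge_d k +++ (reversepath (edge_b (k + 1)) +++ edge_b (k + 1))"
    by (rule homotopic_assoc) (simp_all)
  also have "\<dots> \<asymp> edge_d k +++ (\<lambda>_. Vert (k + 2))"
    using homotopic_paths_units(4)[of "edge_b (k + 1)" tiled]
    by (intro homotopic_join_right) (simp_all add: add.commute)
  also have "\<dots> \<asymp> edge_d k"
    using homotopic_paths_units(1)[of "edge_d k" tiled] by simp
  finally show "lift_word word_d k \<asymp> edge_d k" .
qed

declare subset_path_image_join [simp]

lemma lift_word_relation_ab:
  "lift_word (word_a @ word_b) k \<asymp> lift_word (word_b @ word_a) k"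
proof -
  have "lift_word (word_a @ word_b) k \<asymp> lift_word word_a k +++ lift_word word_b k"
    using lift_word_append[of word_a word_b k] by (simp add: word_a_def)
  also have "\<dots> \<asymp> edge_a k +++ edge_b k"
    by (intro homotopic_paths_join lift_word_edges) (simp add: word_a_def)
  also have "\<dots> \<asymp> tile_map (Tile_C k) \<circ> (linepath (0, 0) (1, 0) +++ linepath (1, 0) (1, 1))"
    unfolding path_compose_join by (simp flip: edge_eq_tile_map)
  also have "\<dots> \<asymp> tile_map (Tile_C k) \<circ> (linepath (0, 0) (0, 1) +++ linepath (0, 1) (1, 1))"
    by (rule homotopic_tile_map) auto
  also have "\<dots> \<asymp> edge_b k +++ edge_a (k + 1)"
    unfolding path_compose_join by (simp flip: edge_eq_tile_map)
  also have "\<dots> \<asymp> lift_word word_b k +++ lift_word word_a (k + 1)"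
    by (intro homotopic_paths_join homotopic_paths_sym[OF lift_word_edges(1)] homotopic_paths_sym[OF lift_word_edges(2)]) simp
  also have "\<dots> \<asymp> lift_word (word_b @ word_a) k"
    using homotopic_paths_sym[OF lift_word_append[of word_b word_a k]] by (simp add: word_b_def)
  finally show ?thesis .
qed

text \<open>With d = cb the relation reads bd = dc, and \<open>c\<close> lifts to \<open>d\<close>
  followed by \<open>b\<close> backwards. The two sides become the two boundary paths of
  \<open>Tile_D k\<close> from \<open>(0, 0)\<close> to \<open>(1, 1)\<close>: left and top, or
  bottom and right.\<close>

lemma lift_word_relation_bcb:
  "lift_word (pos_word [gen_b, gen_c, gen_b]) k \<asymp> lift_word (pos_word [gen_c, gen_b, gen_c]) k"
proof -
  have c: "word_degree word_d = 2" "word_degree word_b = 1" by (simp_all add: word_d_def word_b_def)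
  have w: "pos_word [gen_b, gen_c, gen_b] = word_b @ word_d" "pos_word [gen_c, gen_b, gen_c] = word_d @ [(gen_c, True)]"
    by (simp_all add: pos_word_def word_b_def word_d_def)
  have C: "lift_word [(gen_c, True)] (k + 2) \<asymp> edge_d (k + 2) +++ reversepath (edge_b (k + 3))"
    using lift_word_single[of "(gen_c, True)" "k + 2"] by (simp add: add.commute)
  have r: "reversepath (edge_b (k + 3)) = tile_map (Tile_D k) \<circ> linepath (1, 0) (1, 1)"
    unfolding edge_eq_tile_map(6) by (auto simp: fun_eq_iff reversepath_def linepath_def algebra_simps)
  have "lift_word (word_b @ word_d) k \<asymp> lift_word word_b k +++ lift_word word_d (k + 1)"
    using lift_word_append[of word_b word_d k] by (simp add: c)
  also have "\<dots> \<asymp> edge_b k +++ edge_d (k + 1)"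
    by (intro homotopic_paths_join lift_word_edges) (simp add: c)
  also have "\<dots> \<asymp> tile_map (Tile_D k) \<circ> (linepath (0, 0) (0, 1) +++ linepath (0, 1) (1, 1))"
    unfolding path_compose_join by (simp flip: edge_eq_tile_map)
  also have "\<dots> \<asymp> tile_map (Tile_D k) \<circ> (linepath (0, 0) (1 / 2, 0) +++ (linepath (1 / 2, 0) (1, 0) +++ linepath (1, 0) (1, 1)))"
    by (rule homotopic_tile_map) auto
  also have "\<dots> \<asymp> edge_d k +++ (edge_d (k + 2) +++ reversepath (edge_b (k + 3)))"
    unfolding path_compose_join r[symmetric]
    by (intro homotopic_paths_join homotopic_paths_sym[OF edge_d_eq_tile_map(1)] homotopic_paths_sym[OF edge_d_eq_tile_map(2)])
      (use tiled_path_tile_map[of "linepath (1, 0) (1, 1)" "Tile_D k"] in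
        \<open>simp_all add: r pathstart_compose pathfinish_compose\<close>)
  also have "\<dots> \<asymp> lift_word word_d k +++ lift_word [(gen_c, True)] (k + 2)"
    by (intro homotopic_paths_join homotopic_paths_sym[OF lift_word_edges(3)] homotopic_paths_sym[OF C]) simp
  also have "\<dots> \<asymp> lift_word (word_d @ [(gen_c, True)]) k"
    using homotopic_paths_sym[OF lift_word_append[of word_d "[(gen_c, True)]" k]] by (simp add: c)
  finally show ?thesis unfolding w .
qed

text \<open>The degrees have to be carried through the induction, because in a concatenation they
  determine the vertex at which the second lift starts.\<close>

lemma lift_word_cong:
  assumes "u \<simeq> v"
  shows "word_degree u = word_degree v \<and> (\<forall>k. lift_word u k \<asymp> lift_word v k)"
  using assms
proof (induction rule: word_eq.induct)
  case (append u u' v v')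
  have "lift_word (u @ v) k \<asymp> lift_word (u' @ v') k" for k
  proof -
    have "lift_word (u @ v) k \<asymp> lift_word u k +++ lift_word v (k + word_degree u)"
      by (rule lift_word_append)
    also have "\<dots> \<asymp> lift_word u' k +++ lift_word v' (k + word_degree u')"
      using append.IH by (intro homotopic_paths_join) auto
    also have "\<dots> \<asymp> lift_word (u' @ v') k"
      by (rule homotopic_paths_sym[OF lift_word_append])
    finally show ?thesis .
  qed
  then show ?case using append.IH by simp
next
  case (trans u v w)
  then show ?case using homotopic_paths_trans by fastforce
next
  case (cancel g b)
  have "lift_word [(g, b), (g, \<not> b)] k \<asymp> (\<lambda>_. Vert k)" for k
  proof -
    have "lift_word [(g, b), (g, \<not> b)] k \<asymp> lift_letter (g, b) k +++ lift_letter (g, \<not> b) (k + letter_degree (g, b))"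
      using lift_word_single[of "(g, \<not> b)" "k + letter_degree (g, b)"]
      by (simp add: homotopic_join_right)
    also have "\<dots> \<asymp> (\<lambda>_. Vert k)"
      using homotopic_paths_units(3)[of "lift_gen g k" tiled] homotopic_paths_units(4)[of "lift_gen g (k - gen_degree g)" tiled]
      by (cases b) simp_all
    finally show ?thesis .
  qed
  then show ?case by simp
next
  case (relation l r)
  have ab: "pos_word [gen_a, gen_b] = word_a @ word_b" "pos_word [gen_b, gen_a] = word_b @ word_a"
    by (simp_all add: pos_word_def word_a_def word_b_def)
  have d: "word_degree (pos_word [gen_b, gen_c, gen_b]) = word_degree (pos_word [gen_c, gen_b, gen_c])"
    by (simp add: pos_word_def)
  from relation consider "l = word_a @ word_b" "r = word_b @ word_a"
    | "l = pos_word [gen_b, gen_c, gen_b]" "r = pos_word [gen_c, gen_b, gen_c]"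
    unfolding artin_rels_def ab by auto
  then show ?case
  proof cases
    case 1
    then show ?thesis using lift_word_relation_ab by simp
  next
    case 2
    then show ?thesis using lift_word_relation_bcb d by simp
  qed
qed (simp_all add: homotopic_paths_sym)

section \<open>Every path is homotopic to the lift of a word\<close>

fun base :: "cell_point \<Rightarrow> 6" where
  "base (Vert k) = k" | "base (On_a k t) = k" | "base (On_b k s) = k" | "base (On_d k t) = k"
| "base (In_C k t s) = k" | "base (In_D k t s) = k"

fun tether :: "cell_point \<Rightarrow> real \<Rightarrow> cell_point" where
  "tether (Vert k) x = Vert k"
| "tether (On_a k t) x = edge_a k (x * t)"
| "tether (On_b k s) x = edge_b k (x * s)"
| "tether (On_d k t) x = edge_d k (x * t)"
| "tether (In_C k t s) x = tile_C k (x * t) (x * s)"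
| "tether (In_D k t s) x = tile_D k (x * t) (x * s)"

fun tile_index :: "tile \<Rightarrow> 6" where
  "tile_index (Tile_C k) = k" | "tile_index (Tile_D k) = k"

text \<open>The place in the tile of the base vertex of the open cell containing the point. The open
  right side of \<open>Tile_D\<close> belongs to \<open>(1, 1)\<close>, as its edge runs downwards,
  and the middle of the bottom side is itself a corner.\<close>

fun corner :: "tile \<Rightarrow> real \<times> real \<Rightarrow> real \<times> real" where
  "corner (Tile_C k) (t, s) = (if 1 \<le> t then 1 else 0, if 1 \<le> s then 1 else 0)"
| "corner (Tile_D k) (t, s) =
     (if s \<le> 0 then (if t < 1 / 2 then (0, 0) else if t < 1 then (1 / 2, 0) else (1, 0))
      else if 1 \<le> s then (if t < 1 then (0, 1) else (1, 1)) else if t < 1 then (0, 0) else (1, 1))"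

lemma tether_0: "tether y 0 = Vert (base y)"
  by (cases y) (auto simp: tile_defs)

lemma tile_D_point_cases:
  fixes s t :: real
  assumes "0 \<le> t" "t \<le> 1" "0 \<le> s" "s \<le> 1"
  shows "s = 0 \<and> t < 1 / 2 \<or> s = 0 \<and> 1 / 2 < t \<and> t < 1 \<or> s = 0 \<and> t = 1 \<or> s = 1 \<and> t < 1 \<or> s = 1 \<and> t = 1
      \<or> 0 < s \<and> s < 1 \<and> t < 1 \<or> 0 < s \<and> s < 1 \<and> t = 1 \<or> s = 0 \<and> t = 1 / 2"
proof -
  consider "s = 0" | "s = 1" | "0 < s" "s < 1" using assms by linarith
  then show ?thesis using assms by cases auto
qed

text \<open>Each side of a tile is an affine copy of its edge, and affine maps send lines from the
  base corner to lines from the base vertex. On \<open>Tile_D\<close> the changes of coordinate are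
  \<open>2 * t\<close> and \<open>2 * t - 1\<close> at the bottom and \<open>1 - s\<close> on the
  right.\<close>

lemma tether_eq:
  assumes z: "z \<in> {0..1} \<times> {0..1}" and x: "x \<in> {0..1}"
  shows "tile_map c (linepath (corner c z) z x) = tether (tile_map c z) x"
proof -
  obtain t s where ts: "z = (t, s)" "0 \<le> t" "t \<le> 1" "0 \<le> s" "s \<le> 1" using z by auto
  show ?thesis
  proof (cases c)
    case (Tile_C k)
    consider "t < 1" "s < 1" | "t = 1" "s < 1" | "t < 1" "s = 1" | "t = 1" "s = 1" using ts by linarith
    then show ?thesis
      using x ts(2-) unfolding ts(1) Tile_C
      by cases (auto simp: linepath_def scaleR_prod_def plus_prod_def tile_defs)
  next
    case (Tile_D k)
    have le: "x * t \<le> t" "x * s \<le> s" "0 \<le> x" using x ts by (simp_all add: mult_left_le_one_le)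
    have l: "tile_map c (linepath p z x) = tile_D k ((1 - x) * fst p + x * t) ((1 - x) * snd p + x * s)" for p
      by (cases p) (simp add: ts(1) Tile_D linepath_def scaleR_prod_def plus_prod_def)
    consider "s = 0" "t < 1 / 2" | "s = 0" "1 / 2 < t" "t < 1" | "s = 0" "t = 1" | "s = 1" "t < 1" | "s = 1" "t = 1"
      | "0 < s" "s < 1" "t < 1" | "0 < s" "s < 1" "t = 1" | "s = 0" "t = 1 / 2"
      using tile_D_point_cases[OF ts(2-5)] by auto
    then show ?thesis
    proof cases
      case 2
      have e: "(1 - x) / 2 + x * t \<ge> 1 / 2" using 2 x mult_left_mono[of "1 / 2" t x] by (simp add: field_simps)
      have "tile_map c (linepath (corner c z) z x) = tile_D k ((1 - x) / 2 + x * t) 0"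
        using 2 by (simp add: ts(1) Tile_D linepath_def scaleR_prod_def plus_prod_def)
      also have "\<dots> = edge_d (k + 2) (2 * ((1 - x) / 2 + x * t) - 1)"
        using e by (rule tile_D_sides(2)[rotated]) simp
      also have "2 * ((1 - x) / 2 + x * t) - 1 = x * (2 * t - 1)" by (simp add: field_simps)
      finally show ?thesis
        using 2 by (simp add: ts(1) Tile_D tile_D_sides) (auto simp: edge_d_def)
    next
      case 8
      show ?thesis unfolding ts(1) Tile_D 8 by (simp add: tile_defs)
    next
      case 7
      have "tile_map c (linepath (corner c z) z x) = tile_D k 1 ((1 - x) + x * s)"
        using 7 by (simp add: ts(1) Tile_D linepath_def scaleR_prod_def plus_prod_def)
      also have "\<dots> = edge_b (k + 3) (x * (1 - s))"
        by (simp add: tile_D_sides algebra_simps)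
      finally show ?thesis
        using 7 by (simp add: ts(1) Tile_D tile_D_sides) (auto simp: edge_b_def)
    next
      case 1
      have "x * t < 1 / 2" using 1(2) le(1) by (rule le_less_trans[rotated])
      then have "\<not> 1 \<le> x * t" "x * t * 2 \<le> 1" by simp_all
      with 1 show ?thesis
        using le(3) ts(2) by (cases "t = 0") (simp_all add: l, auto simp: ts(1) Tile_D tile_defs)
    next
      case 3
      then show ?thesis
        by (simp add: l) (simp add: ts(1) Tile_D tile_D_sides edge_d_def)
    next
      case 4
      then show ?thesis
        using ts(2,3) le by (simp add: l) (auto simp: ts(1) Tile_D tile_D_sides edge_d_def)
    next
      case 5
      then show ?thesis
        by (simp add: l) (simp add: ts(1) Tile_D tile_D_sides edge_d_def)
    next
      case 6
      then show ?thesis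
        using ts(2,3) le
        by (cases "t = 0") (simp_all add: l, auto simp: ts(1) Tile_D tile_D_sides tile_D_interior edge_b_def)
    qed
  qed
qed

text \<open>The path \<open>g\<close> runs along the boundary of the tile. Only its ends are
  recorded, since they determine it up to homotopy in the tile.\<close>

lemma lift_corner_word:
  assumes z: "z \<in> {0..1} \<times> {0..1}"
  shows "\<exists>g. path g \<and> pathstart g = (0, 0) \<and> pathfinish g = corner c z \<and>
    lift_word (corner_word c z) (tile_index c) \<asymp> tile_map c \<circ> g"
proof -
  obtain t s where ts: "z = (t, s)" "0 \<le> t" "t \<le> 1" "0 \<le> s" "s \<le> 1" using z by auto
  have two: "lift_word (u @ v) k \<asymp> tile_map c \<circ> (linepath p q +++ linepath q r)"
    if "lift_word u k \<asymp> tile_map c \<circ> linepath p q" "lift_word v (k + word_degree u) \<asymp> tile_map c \<circ> linepath q r" for u v k p q r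
    using homotopic_paths_trans[OF lift_word_append homotopic_paths_join[OF that]]
    by (simp add: path_compose_join)
  have none: "lift_word [] (tile_index c) \<asymp> tile_map c \<circ> linepath (0, 0) (0, 0)"
  proof -
    have "tile_map c \<circ> linepath (0, 0) (0, 0) = (\<lambda>_. Vert (tile_index c))"
      by (cases c) (auto simp: fun_eq_iff linepath_def tile_defs)
    then show ?thesis using const_path_tiled by simp
  qed
  have deg: "word_degree word_a = 0" "word_degree word_b = 1" "word_degree word_d = 2"
    by (simp_all add: word_a_def word_b_def word_d_def)
  show ?thesis
  proof (cases c)
    case c: (Tile_C k)
    have e: "lift_word word_a k \<asymp> tile_map c \<circ> linepath (0, 0) (1, 0)"
      "lift_word word_a (k + 1) \<asymp> tile_map c \<circ> linepath (0, 1) (1, 1)"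
      "lift_word word_b k \<asymp> tile_map c \<circ> linepath (0, 0) (0, 1)"
      using lift_word_edges by (simp_all add: c flip: edge_eq_tile_map)
    have "lift_word (word_b @ word_a) k \<asymp> tile_map c \<circ> (linepath (0, 0) (0, 1) +++ linepath (0, 1) (1, 1))"
      by (rule two) (use e in \<open>simp_all add: deg\<close>)
    note g = this e(1,3) none
    consider "t < 1" "s < 1" | "t = 1" "s < 1" | "t < 1" "s = 1" | "t = 1" "s = 1" using ts by linarith
    then show ?thesis
    proof cases
      case 1
      then show ?thesis using g by (intro exI[of _ "linepath (0, 0) (0, 0)"]) (simp add: ts(1) c)
    next
      case 2
      then show ?thesis using g by (intro exI[of _ "linepath (0, 0) (1, 0)"]) (simp add: ts(1) c)
    next
      case 3
      then show ?thesis using g by (intro exI[of _ "linepath (0, 0) (0, 1)"]) (simp add: ts(1) c)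
    next
      case 4
      then show ?thesis using g by (intro exI[of _ "linepath (0, 0) (0, 1) +++ linepath (0, 1) (1, 1)"]) (simp add: ts(1) c)
    qed
  next
    case c: (Tile_D k)
    have e: "lift_word word_d k \<asymp> tile_map c \<circ> linepath (0, 0) (1 / 2, 0)"
      "lift_word word_d (k + 2) \<asymp> tile_map c \<circ> linepath (1 / 2, 0) (1, 0)"
      "lift_word word_d (k + 1) \<asymp> tile_map c \<circ> linepath (0, 1) (1, 1)"
      "lift_word word_b k \<asymp> tile_map c \<circ> linepath (0, 0) (0, 1)"
      using homotopic_paths_trans[OF lift_word_edges(3) edge_d_eq_tile_map(1)]
        homotopic_paths_trans[OF lift_word_edges(3) edge_d_eq_tile_map(2)] lift_word_edges
      by (simp_all add: c flip: edge_eq_tile_map)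
    have w: "lift_word (word_b @ word_d) k \<asymp> tile_map c \<circ> (linepath (0, 0) (0, 1) +++ linepath (0, 1) (1, 1))"
      "lift_word (word_d @ word_d) k \<asymp> tile_map c \<circ> (linepath (0, 0) (1 / 2, 0) +++ linepath (1 / 2, 0) (1, 0))"
      by (rule two; use e in \<open>simp add: deg\<close>)+
    note g = w e(1,4) none
    consider "s = 0" "t < 1 / 2" | "s = 0" "1 / 2 \<le> t" "t < 1" | "s = 0" "t = 1" | "s = 1" "t < 1" | "s = 1" "t = 1"
      | "0 < s" "s < 1" "t < 1" | "0 < s" "s < 1" "t = 1" using ts by linarith
    then show ?thesis
    proof cases
      case 1
      then show ?thesis using g by (intro exI[of _ "linepath (0, 0) (0, 0)"]) (simp add: ts(1) c)
    next
      case 2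
      then show ?thesis using g by (intro exI[of _ "linepath (0, 0) (1 / 2, 0)"]) (simp add: ts(1) c)
    next
      case 3
      then show ?thesis using g by (intro exI[of _ "linepath (0, 0) (1 / 2, 0) +++ linepath (1 / 2, 0) (1, 0)"]) (simp add: ts(1) c)
    next
      case 4
      then show ?thesis using g by (intro exI[of _ "linepath (0, 0) (0, 1)"]) (simp add: ts(1) c)
    next
      case 6
      then show ?thesis using g by (intro exI[of _ "linepath (0, 0) (0, 0)"]) (simp add: ts(1) c)
    qed (use g in \<open>intro exI[of _ "linepath (0, 0) (0, 1) +++ linepath (0, 1) (1, 1)"], simp add: ts(1) c\<close>)+
  qed
qed

section \<open>Paths inside one tile\<close>

definition clamp01 :: "real \<times> real \<Rightarrow> real \<times> real" where
  "clamp01 z = (max 0 (min 1 (fst z)), max 0 (min 1 (snd z)))"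

lemma clamp01_in: "clamp01 z \<in> {0..1} \<times> {0..1}"
  by (auto simp: clamp01_def)

lemma tile_map_clamp01: "tile_map c (clamp01 z) = tile_map c z"
  by (cases c; cases z) (auto simp: clamp01_def tile_defs max_def min_def)

lemma continuous_clamp01: "continuous_on S clamp01"
  unfolding clamp01_def by (intro continuous_intros)

lemma tiled_unitE:
  assumes "y \<in> tiled"
  obtains c z where "z \<in> {0..1} \<times> {0..1}" "y = tile_map c z"
proof -
  from assms obtain c z where "y = tile_map c z" by (rule tiledE)
  then have "y = tile_map c (clamp01 z)" by (simp add: tile_map_clamp01)
  then show thesis by (rule that[OF clamp01_in])
qed

text \<open>Instead of going straight to \<open>z\<close>, one may follow the boundary to the base
  corner and continue along the tether: in the tile this is a path with the same ends. The formula
  for the base vertex is read off where the two parts meet.\<close>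

lemma lift_corner_tether:
  assumes z: "z \<in> {0..1} \<times> {0..1}"
  shows "tile_map c \<circ> linepath (0, 0) z \<asymp> lift_word (corner_word c z) (tile_index c) +++ tether (tile_map c z)"
    "tiled_path (tether (tile_map c z))" "pathstart (tether (tile_map c z)) = Vert (base (tile_map c z))"
    "pathfinish (tether (tile_map c z)) = tile_map c z"
    "base (tile_map c z) = tile_index c + word_degree (corner_word c z)"
proof -
  have t: "tile_map c \<circ> linepath (corner c z) z \<asymp> tether (tile_map c z)"
    by (rule homotopic_paths_eq) (use tether_eq[OF z] tiled_path_tile_map in auto)
  show "tiled_path (tether (tile_map c z))"
    using homotopic_paths_imp_path[OF t] homotopic_paths_imp_subset[OF t] by simp
  show "pathfinish (tether (tile_map c z)) = tile_map c z"
    using homotopic_paths_imp_pathfinish[OF t] by (simp add: pathfinish_compose)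
  show s: "pathstart (tether (tile_map c z)) = Vert (base (tile_map c z))"
    by (simp add: pathstart_def tether_0)
  obtain g where g: "path g" "pathstart g = (0, 0)" "pathfinish g = corner c z"
    "lift_word (corner_word c z) (tile_index c) \<asymp> tile_map c \<circ> g"
    using lift_corner_word[OF z, of c] by (elim exE conjE)
  show "base (tile_map c z) = tile_index c + word_degree (corner_word c z)"
    using homotopic_paths_imp_pathfinish[OF g(4)] homotopic_paths_imp_pathstart[OF t] s g(3)
    by (simp add: pathfinish_compose pathstart_compose)
  have "tile_map c \<circ> linepath (0, 0) z \<asymp> tile_map c \<circ> (g +++ linepath (corner c z) z)"
    by (rule homotopic_tile_map) (use g in auto)
  also have "\<dots> \<asymp> lift_word (corner_word c z) (tile_index c) +++ tether (tile_map c z)"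
    unfolding path_compose_join
    by (intro homotopic_paths_join homotopic_paths_sym[OF g(4)] t) (simp add: pathfinish_compose pathstart_compose g)
  finally show "tile_map c \<circ> linepath (0, 0) z \<asymp> lift_word (corner_word c z) (tile_index c) +++ tether (tile_map c z)" .
qed

lemma tether_path:
  assumes "y \<in> tiled"
  shows "tiled_path (tether y)" "pathstart (tether y) = Vert (base y)" "pathfinish (tether y) = y"
proof -
  obtain c z where z: "z \<in> {0..1} \<times> {0..1}" and y: "y = tile_map c z"
    using assms by (rule tiled_unitE)
  show "tiled_path (tether y)" "pathstart (tether y) = Vert (base y)" "pathfinish (tether y) = y"
    using lift_corner_tether(2-4)[OF z, of c] by (simp_all add: y)
qed

text \<open>
  Straight paths from the base vertices, the tethers, turn an arbitrary path into one between
  vertices; being a lift of a word is then stable under concatenation and can be checked locally.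
\<close>

definition traced :: "(real \<Rightarrow> cell_point) \<Rightarrow> bool" where
  "traced p \<longleftrightarrow> tiled_path p \<and> (\<exists>w. base (pathfinish p) = base (pathstart p) + word_degree w \<and>
     tether (pathstart p) +++ p \<asymp> lift_word w (base (pathstart p)) +++ tether (pathfinish p))"

lemma path_ends_tiled: "tiled_path p \<Longrightarrow> pathstart p \<in> tiled" "tiled_path p \<Longrightarrow> pathfinish p \<in> tiled"
  using pathstart_in_path_image[of p] pathfinish_in_path_image[of p] by auto

lemma traced_join:
  assumes p: "traced p" and q: "traced q" and pq: "pathfinish p = pathstart q"
  shows "traced (p +++ q)"
proof -
  let ?x = "pathstart p" and ?y = "pathstart q" and ?z = "pathfinish q"
  obtain u where u: "base ?y = base ?x + word_degree u" "tether ?x +++ p \<asymp> lift_word u (base ?x) +++ tether ?y"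
    using p pq by (auto simp: traced_def)
  obtain v where v: "base ?z = base ?y + word_degree v" "tether ?y +++ q \<asymp> lift_word v (base ?y) +++ tether ?z"
    using q by (auto simp: traced_def)
  have tp: "tiled_path p" "tiled_path q" using p q by (auto simp: traced_def)
  note x = tether_path[OF path_ends_tiled(1)[OF tp(1)]] and y = tether_path[OF path_ends_tiled(1)[OF tp(2)]]
    and z = tether_path[OF path_ends_tiled(2)[OF tp(2)]]
  have "tether ?x +++ (p +++ q) \<asymp> (tether ?x +++ p) +++ q"
    by (rule homotopic_paths_assoc) (use tp x pq in auto)
  also have "\<dots> \<asymp> (lift_word u (base ?x) +++ tether ?y) +++ q"
    by (rule homotopic_join_left[OF u(2)]) (use tp pq in auto)
  also have "\<dots> \<asymp> lift_word u (base ?x) +++ (tether ?y +++ q)"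
    by (rule homotopic_assoc) (use tp y u in auto)
  also have "\<dots> \<asymp> lift_word u (base ?x) +++ (lift_word v (base ?y) +++ tether ?z)"
    by (rule homotopic_join_right[OF v(2)]) (use y u in auto)
  also have "\<dots> \<asymp> (lift_word u (base ?x) +++ lift_word v (base ?y)) +++ tether ?z"
    by (rule homotopic_paths_assoc) (use z u v in auto)
  also have "\<dots> \<asymp> lift_word (u @ v) (base ?x) +++ tether ?z"
    by (rule homotopic_join_left) (use z u(1) v(1) homotopic_paths_sym[OF lift_word_append[of u v "base ?x"]] in auto)
  finally show ?thesis
    using u(1) v(1) tp pq by (auto simp: traced_def add.assoc intro!: exI[of _ "u @ v"])
qed

lemma traced_homotopic:
  assumes "traced p" "p \<asymp> q"
  shows "traced q"
proof -
  have e: "pathstart q = pathstart p" "pathfinish q = pathfinish p"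
    using homotopic_paths_imp_pathstart[OF assms(2)] homotopic_paths_imp_pathfinish[OF assms(2)] by simp_all
  have tp: "tiled_path p" "tiled_path q"
    using homotopic_paths_imp_path[OF assms(2)] homotopic_paths_imp_subset[OF assms(2)] by simp_all
  have r: "tether (pathstart p) +++ q \<asymp> tether (pathstart p) +++ p"
    by (rule homotopic_join_right[OF homotopic_paths_sym[OF assms(2)]])
      (use tether_path[OF path_ends_tiled(1)[OF tp(1)]] e in auto)
  from assms(1) obtain w where "base (pathfinish p) = base (pathstart p) + word_degree w"
     "tether (pathstart p) +++ p \<asymp> lift_word w (base (pathstart p)) +++ tether (pathfinish p)"
    by (auto simp: traced_def)
  with tp(2) homotopic_paths_trans[OF r] show ?thesis
    unfolding traced_def e by (intro conjI exI[of _ w]) auto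
qed

text \<open>Prefix the lift of an inverse word at the vertex where the lift of \<open>u\<close>
  ends; together the two lifts contract.\<close>

lemma lift_word_cancel:
  assumes "lift_word u k +++ p \<asymp> q" "tiled_path p" "pathstart p = Vert (k + word_degree u)" "w @ u \<simeq> []"
  shows "p \<asymp> lift_word w (k + word_degree u) +++ q"
proof -
  have d: "word_degree w = - word_degree u"
    using lift_word_cong[OF assms(4)] by (simp add: eq_neg_iff_add_eq_0)
  let ?k = "k + word_degree u"
  have "p \<asymp> (\<lambda>_. Vert ?k) +++ p"
    using homotopic_paths_units(2)[of p tiled] assms(2,3) by (simp add: homotopic_paths_sym)
  also have "\<dots> \<asymp> lift_word (w @ u) ?k +++ p"
    by (rule homotopic_join_left)
      (use lift_word_cong[OF assms(4)] assms(2,3) in \<open>auto intro: homotopic_paths_sym\<close>)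
  also have "\<dots> \<asymp> (lift_word w ?k +++ lift_word u k) +++ p"
    by (rule homotopic_join_left) (use lift_word_append[of w u ?k] assms(2,3) d in auto)
  also have "\<dots> \<asymp> lift_word w ?k +++ (lift_word u k +++ p)"
    by (rule homotopic_assoc) (use assms(2,3) d in auto)
  also have "\<dots> \<asymp> lift_word w ?k +++ q"
    by (rule homotopic_join_right[OF assms(1)]) (use d in auto)
  finally show ?thesis .
qed

text \<open>A criterion relative to an auxiliary vertex \<open>k\<close> from which both ends are
  reached; the word obtained is the inverse of \<open>u\<close> followed by \<open>v\<close>. In the
  application \<open>k\<close> is the corner \<open>(0, 0)\<close> of a tile, and \<open>a\<close>
  and \<open>b\<close> are straight lines from it.\<close>

lemma tracedI:
  assumes p: "tiled_path p" "pathstart p = x" "pathfinish p = y"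
    and x: "a \<asymp> lift_word u k +++ tether x" "base x = k + word_degree u"
    and y: "b \<asymp> lift_word v k +++ tether y" "base y = k + word_degree v"
    and ab: "a +++ p \<asymp> b" "pathfinish a = x"
  shows "traced p"
proof -
  obtain w where w: "w @ u \<simeq> []"
    using word_eq_inverse by blast
  have "word_degree (w @ u) = word_degree []"
    using lift_word_cong[OF w] by (rule conjunct1)
  then have d: "word_degree w = - word_degree u"
    by (simp add: eq_neg_iff_add_eq_0)
  have xt: "x \<in> tiled" "y \<in> tiled" using path_ends_tiled[OF p(1)] p by auto
  note X = tether_path[OF xt(1)] and Y = tether_path[OF xt(2)]
  have k: "k + word_degree u + word_degree w = k" by (simp only: d) simp
  have "lift_word u k +++ (tether x +++ p) \<asymp> (lift_word u k +++ tether x) +++ p"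
    by (rule homotopic_paths_assoc) (simp_all only: X p x(2) lift_word_pathD)
  also have "\<dots> \<asymp> a +++ p"
    by (rule homotopic_join_left[OF homotopic_paths_sym[OF x(1)]]) (simp_all add: p X)
  also note ab(1)
  also note y(1)
  finally have "tether x +++ p \<asymp> lift_word w (k + word_degree u) +++ (lift_word v k +++ tether y)"
    by (rule lift_word_cancel) (simp_all only: tiled_path_join X p x(2) w pathstart_join)
  also have "\<dots> \<asymp> (lift_word w (k + word_degree u) +++ lift_word v k) +++ tether y"
    by (rule homotopic_paths_assoc) (simp_all only: Y k y(2) lift_word_pathD)
  also have "\<dots> \<asymp> lift_word (w @ v) (k + word_degree u) +++ tether y"
  proof (rule homotopic_join_left)
    show "lift_word w (k + word_degree u) +++ lift_word v k \<asymp> lift_word (w @ v) (k + word_degree u)"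
      using homotopic_paths_sym[OF lift_word_append[of w v "k + word_degree u"]] by (simp only: k)
  qed (simp_all only: Y y(2) lift_word_pathD pathfinish_join)
  finally show ?thesis
    unfolding traced_def p x(2) y(2)
    by (intro conjI exI[of _ "w @ v"]) (simp_all only: p word_degree_simps d, simp)
qed

lemma traced_tile_map_unit:
  assumes f: "path f" "path_image f \<subseteq> {0..1} \<times> {0..1}"
  shows "traced (tile_map c \<circ> f)"
proof -
  have pq: "pathstart f \<in> {0..1} \<times> {0..1}" "pathfinish f \<in> {0..1} \<times> {0..1}"
    using f(2) pathstart_in_path_image[of f] pathfinish_in_path_image[of f] by auto
  have "(tile_map c \<circ> linepath (0, 0) (pathstart f)) +++ (tile_map c \<circ> f) \<asymp> tile_map c \<circ> linepath (0, 0) (pathfinish f)"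
    unfolding path_compose_join[symmetric] by (rule homotopic_tile_map) (use f in simp_all)
  from tracedI[OF tiled_path_tile_map[OF f(1)] pathstart_compose pathfinish_compose
      lift_corner_tether(1,5)[OF pq(1)] lift_corner_tether(1,5)[OF pq(2)] this]
  show ?thesis by (simp add: pathfinish_compose)
qed

lemma traced_tile_map:
  assumes f: "path f"
  shows "traced (tile_map c \<circ> f)"
proof -
  have "tile_map c \<circ> f = tile_map c \<circ> (clamp01 \<circ> f)"
    by (simp add: fun_eq_iff tile_map_clamp01)
  moreover have "path (clamp01 \<circ> f)"
    using f continuous_clamp01 by (rule path_continuous_image)
  moreover have "path_image (clamp01 \<circ> f) \<subseteq> {0..1} \<times> {0..1}"
    unfolding path_image_def comp_def using clamp01_in by blast
  ultimately show ?thesis using traced_tile_map_unit[of "clamp01 \<circ> f" c] by simp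
qed

section \<open>Paths inside one chart\<close>

lemma open_chart_domain: "open (chart_domain O')"
  unfolding open_cell_point_def
proof
  fix c
  show "open (tile_map c -` chart_domain O')"
  proof (subst open_subopen, intro ballI)
    fix z assume "z \<in> tile_map c -` chart_domain O'"
    then have "near O' (tile_map c z)" by (simp add: chart_domain_def)
    then obtain N p w where "z \<in> N" "chart_region O' c N p w"
      by (rule near_regionE)
    then show "\<exists>T. open T \<and> z \<in> T \<and> T \<subseteq> tile_map c -` chart_domain O'"
      by (intro exI[of _ N]) (auto simp: chart_region_def chart_domain_def)
  qed
qed

definition centre :: "chart \<Rightarrow> cell_point" where
  "centre O' = (case O' of Star k \<Rightarrow> Vert k | Arc_a k \<Rightarrow> On_a k (1 / 2) | Arc_d k \<Rightarrow> On_d k (1 / 2))"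

lemma contract_ends:
  assumes "y \<in> chart_domain O'"
  shows "contract O' y 0 = y" "contract O' y 1 = centre O'"
proof -
  obtain c z where y: "y = tile_map c z" using assms by (auto simp: chart_domain_def elim: tiledE)
  have n: "near O' y" using assms by (simp add: chart_domain_def)
  then obtain N p w where "z \<in> N" "chart_region O' c N p w"
    unfolding y by (rule near_regionE)
  then show "contract O' y 0 = y" by (simp add: chart_region_def y)
  show "contract O' y 1 = centre O'"
    using n by (cases "(O', y)" rule: near.cases)
      (auto simp: centre_def tile_defs)
qed

text \<open>The time is clamped to the unit interval to get a map on an open set of the product with
  the whole line, where \<open>open_tiled_times\<close> applies. In a region the map is the tile
  applied to an affine interpolation.\<close>

lemma continuous_contract:
  "continuous_on (chart_domain O' \<times> {0..1}) (\<lambda>(y, r). contract O' y r)"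
proof -
  let ?R = "\<lambda>(y, r). contract O' y (max 0 (min 1 r))"
  have "continuous_on (chart_domain O' \<times> UNIV) ?R"
  proof (subst continuous_on_open_vimage)
    show "open (chart_domain O' \<times> (UNIV :: real set))"
      by (intro open_Times open_chart_domain open_UNIV)
    show "\<forall>B. open B \<longrightarrow> open (?R -` B \<inter> chart_domain O' \<times> UNIV)"
    proof (intro allI impI)
      fix B :: "cell_point set" assume B: "open B"
      show "open (?R -` B \<inter> chart_domain O' \<times> UNIV)"
      proof (rule open_tiled_times)
        show "?R -` B \<inter> chart_domain O' \<times> UNIV \<subseteq> tiled \<times> UNIV"
          by (auto simp: chart_domain_def)
        fix c
        let ?V = "{(z, r). (tile_map c z, r) \<in> ?R -` B \<inter> chart_domain O' \<times> UNIV}"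
        show "open ?V"
        proof (subst open_subopen, intro ballI)
          fix x assume "x \<in> ?V"
          moreover obtain z r where x: "x = (z, r)" by (cases x)
          ultimately have zr: "contract O' (tile_map c z) (max 0 (min 1 r)) \<in> B" "near O' (tile_map c z)"
            by (simp_all add: chart_domain_def)
          from zr(2) obtain N p w where N: "z \<in> N" "chart_region O' c N p w"
            by (rule near_regionE)
          let ?g = "\<lambda>x. tile_map c ((1 - max 0 (min 1 (snd x))) *\<^sub>R fst x + max 0 (min 1 (snd x)) *\<^sub>R p)"
          have g: "contract O' (tile_map c (fst x)) (max 0 (min 1 (snd x))) = ?g x" if "fst x \<in> N" for x
            using N(2) that by (simp add: chart_region_def)
          have "continuous_on (N \<times> UNIV) ?g"
            by (intro continuous_intros)
          moreover have "open (N \<times> (UNIV :: real set))"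
            using N by (intro open_Times) (auto simp: chart_region_def)
          ultimately have "open (?g -` B \<inter> N \<times> UNIV)"
            using B by (simp add: continuous_on_open_vimage)
          moreover have "x \<in> ?g -` B \<inter> N \<times> UNIV"
            using zr g[of x] N x by simp
          moreover have "?g -` B \<inter> N \<times> UNIV \<subseteq> ?V"
          proof
            fix x' assume x': "x' \<in> ?g -` B \<inter> N \<times> UNIV"
            then have "fst x' \<in> N" by auto
            moreover from this have "near O' (tile_map c (fst x'))"
              using N(2) unfolding chart_region_def by blast
            ultimately show "x' \<in> ?V"
              using g[of x'] x' by (cases x') (simp add: chart_domain_def)
          qed
          ultimately show "\<exists>T. open T \<and> x \<in> T \<and> T \<subseteq> ?V" by (intro exI conjI)
        qed
      qed
    qed
  qed
  then have "continuous_on (chart_domain O' \<times> {0..1}) ?R"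
    by (rule continuous_on_subset) auto
  then show ?thesis
    by (rule continuous_on_eq) auto
qed

text \<open>Stars take in the open edges \<open>b\<close> entirely. The interior of a tile lies in
  the tube around one of its sides: the bottom for \<open>C\<close>, the top for
  \<open>D\<close>.\<close>

lemma chart_cover: "\<exists>O'. y \<in> tiled \<longrightarrow> y \<in> chart_domain O'"
proof (cases y)
  case (Vert k)
  then show ?thesis by (intro exI[of _ "Star k"]) (simp add: chart_domain_def)
next
  case (On_a k t)
  then show ?thesis by (intro exI[of _ "Arc_a k"]) (simp add: chart_domain_def)
next
  case (On_b k t)
  then show ?thesis by (intro exI[of _ "Star k"]) (simp add: chart_domain_def)
next
  case (On_d k t)
  then show ?thesis by (intro exI[of _ "Arc_d k"]) (simp add: chart_domain_def)
next
  case (In_C k t s)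
  then show ?thesis by (intro exI[of _ "Arc_a k"]) (simp add: chart_domain_def)
next
  case (In_D k t s)
  then show ?thesis by (intro exI[of _ "Arc_d (k + 1)"]) (simp add: chart_domain_def)
qed

lemma contract_trace:
  assumes "y \<in> chart_domain O'"
  shows "traced (contract O' y)" "traced (reversepath (contract O' y))"
proof -
  obtain c z where y: "y = tile_map c z" using assms by (auto simp: chart_domain_def elim: tiledE)
  have n: "near O' y" using assms by (simp add: chart_domain_def)
  then obtain N p w where "z \<in> N" "chart_region O' c N p w"
    unfolding y by (rule near_regionE)
  then have e: "contract O' y r = tile_map c (linepath z p r)" if "r \<in> {0..1}" for r
    using that by (simp add: chart_region_def y linepath_def)
  have "tile_map c \<circ> linepath z p \<asymp> contract O' y"
    by (rule homotopic_paths_eq) (use e tiled_path_tile_map in auto)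
  then show "traced (contract O' y)"
    by (rule traced_homotopic[OF traced_tile_map[OF path_linepath]])
  have l: "linepath z p (1 - r) = linepath p z r" for r
    by (simp add: linepath_def add.commute)
  have "tile_map c \<circ> linepath p z \<asymp> reversepath (contract O' y)"
    by (rule homotopic_paths_eq)
      (use e tiled_path_tile_map[OF path_linepath[of p z], of c] in \<open>simp_all add: reversepath_def l\<close>)
  then show "traced (reversepath (contract O' y))"
    by (rule traced_homotopic[OF traced_tile_map[OF path_linepath]])
qed

text \<open>Contraction sweeps \<open>p\<close> over a square. The other three sides are the
  trajectories of the two ends, which are lines in tiles, and a path resting at the centre. Hence
  their join is traced, and \<open>p\<close> is homotopic to it.\<close>

lemma traced_in_chart:
  assumes p: "path p" "path_image p \<subseteq> chart_domain O'"
  shows "traced p"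
proof -
  let ?I = "{0..1::real}"
  define H where "H = (\<lambda>x. contract O' (p (fst x)) (snd x))"
  have pd: "p t \<in> chart_domain O'" if "t \<in> ?I" for t
    using p(2) that by (auto simp: path_image_def)
  have "continuous_on (?I \<times> ?I) (\<lambda>x. (\<lambda>(y, r). contract O' y r) (p (fst x), snd x))"
  proof (rule continuous_on_compose2[OF continuous_contract])
    have "continuous_on (?I \<times> ?I) (\<lambda>x. p (fst x))"
      by (rule continuous_on_compose2[OF p(1)[unfolded path_def]])
        (auto intro: continuous_on_fst continuous_on_id)
    then show "continuous_on (?I \<times> ?I) (\<lambda>x. (p (fst x), snd x))"
      by (rule continuous_on_Pair[OF _ continuous_on_snd[OF continuous_on_id]])
    show "(\<lambda>x. (p (fst x), snd x)) ` (?I \<times> ?I) \<subseteq> chart_domain O' \<times> ?I"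
      using pd by auto
  qed
  then have H: "continuous_on (?I \<times> ?I) H" by (simp add: H_def)
  have tiled: "H \<in> ?I \<times> ?I \<rightarrow> tiled"
  proof
    fix x assume "x \<in> ?I \<times> ?I"
    then have "fst x \<in> ?I" "snd x \<in> ?I" by auto
    then have "contract O' (p (fst x)) (snd x) \<in> path_image (contract O' (p (fst x)))"
      by (auto simp: path_image_def)
    then show "H x \<in> tiled"
      using contract_trace(1)[OF pd[OF \<open>fst x \<in> ?I\<close>]] unfolding H_def traced_def by blast
  qed
  define top where "top = H \<circ> linepath (0, 1) (1, 1)"
  have bottom: "H \<circ> linepath (0, 0) (1, 0) \<asymp> p"
  proof (rule homotopic_paths_sym, rule homotopic_paths_eq[OF p(1)])
    show "path_image p \<subseteq> tiled" using p(2) by (auto simp: chart_domain_def)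
  qed (use pd contract_ends in \<open>auto simp: H_def linepath_def\<close>)
  have l: "H \<circ> linepath (0, 0) (0, 1) = contract O' (p 0)"
    "H \<circ> linepath (1, 1) (1, 0) = reversepath (contract O' (p 1))"
    by (auto simp: H_def fun_eq_iff linepath_def reversepath_def)
  have "H (0, 1) \<in> tiled" by (rule funcset_mem[OF tiled]) simp
  then have "centre O' \<in> tiled" using contract_ends(2)[OF pd[of 0]] by (simp add: H_def)
  then obtain c z where cz: "centre O' = tile_map c z" by (rule tiledE)
  have top: "top x = tile_map c z" if "x \<in> ?I" for x
    using contract_ends(2)[OF pd[OF that]] by (simp add: top_def H_def linepath_def cz)
  \<comment> \<open>The resting path counts as a degenerate line in a tile through the
    centre.\<close>
  have "tile_map c \<circ> linepath z z \<asymp> top"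
    by (rule homotopic_paths_eq)
      (use tiled_path_tile_map[OF path_linepath[of z z], of c] in \<open>simp_all add: top\<close>)
  then have t: "traced top" by (rule traced_homotopic[OF traced_tile_map[OF path_linepath]])
  have "H \<circ> (linepath (0, 0) (0, 1) +++ (linepath (0, 1) (1, 1) +++ linepath (1, 1) (1, 0))) \<asymp> H \<circ> linepath (0, 0) (1, 0)"
  proof (rule homotopic_paths_through_convex[OF _ H tiled])
    show "convex (?I \<times> ?I)" by (intro convex_Times) auto
    show "path_image (linepath (0, 0) (0, 1) +++ (linepath (0, 1) (1, 1) +++ linepath (1, 1) (1, 0))) \<subseteq> ?I \<times> ?I"
      "path_image (linepath (0, 0) (1, 0)) \<subseteq> ?I \<times> ?I"
      by (auto simp: path_image_join path_image_linepath closed_segment_def)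
  qed auto
  then have "contract O' (p 0) +++ (top +++ reversepath (contract O' (p 1))) \<asymp> H \<circ> linepath (0, 0) (1, 0)"
    by (simp only: path_compose_join l top_def)
  from homotopic_paths_trans[OF this bottom]
  have h: "contract O' (p 0) +++ (top +++ reversepath (contract O' (p 1))) \<asymp> p" .
  show ?thesis
  proof (rule traced_homotopic[OF _ h], intro traced_join contract_trace t)
    show "p 0 \<in> chart_domain O'" "p 1 \<in> chart_domain O'" using pd by auto
  qed (auto simp: top_def H_def pathstart_def pathfinish_def linepath_def reversepath_def joinpaths_def)
qed

lemma tiled_path_traced:
  assumes "tiled_path p"
  shows "traced p"
proof (rule path_property_subdivide[of p tiled])
  fix y assume "y \<in> tiled"
  then obtain O' where "y \<in> chart_domain O'" using chart_cover by blast
  then show "\<exists>U. open U \<and> y \<in> U \<and> (\<forall>q. path q \<longrightarrow> path_image q \<subseteq> U \<inter> tiled \<longrightarrow> traced q)"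
    using open_chart_domain traced_in_chart by (intro exI[of _ "chart_domain O'"]) auto
qed (use assms traced_join traced_homotopic in auto)

section \<open>Holonomy in the Artin group\<close>

abbreviation artin_class :: "artin_gen word \<Rightarrow> artin_gen word set" where
  "artin_class w \<equiv> word_class artin_rels w"

lemma artin_23inf_eq: "artin_23inf = presented_group artin_rels"
  by (simp add: artin_23inf_def artin_rels_def)

abbreviation artin_mult :: "artin_gen word set \<Rightarrow> artin_gen word set \<Rightarrow> artin_gen word set" (infixl "\<cdot>" 70) where
  "g \<cdot> h \<equiv> g \<otimes>\<^bsub>artin_23inf\<^esub> h"

abbreviation artin_inv :: "artin_gen word set \<Rightarrow> artin_gen word set" ("inv\<^sub>A _" [81] 80) where
  "inv\<^sub>A g \<equiv> inv\<^bsub>artin_23inf\<^esub> g"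

interpretation artin: group artin_23inf
  unfolding artin_23inf_eq by (rule group_presented_group)

lemma carrier_artin: "carrier artin_23inf = range artin_class"
  by (simp add: artin_23inf_eq presented_group_def)

lemma artin_class_closed [simp]: "artin_class w \<in> carrier artin_23inf"
  by (simp add: carrier_artin)

lemma artin_class_mult [simp]: "artin_class u \<cdot> artin_class v = artin_class (u @ v)"
  by (simp add: artin_23inf_eq mult_presented_group)

lemma artin_class_one: "\<one>\<^bsub>artin_23inf\<^esub> = artin_class []"
  by (simp add: artin_23inf_eq presented_group_def)

definition chart_of :: "cell_point \<Rightarrow> chart" where
  "chart_of y = (SOME O'. y \<in> chart_domain O')"

lemma chart_of: "y \<in> tiled \<Longrightarrow> y \<in> chart_domain (chart_of y)"
  unfolding chart_of_def using chart_cover[of y] by (metis someI_ex)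

text \<open>From the frame of \<open>y\<close> to the centre of a chart and from there to the frame
  of \<open>y'\<close>. The chart is chosen at \<open>y\<close> alone, so the two arguments play
  different roles.\<close>

definition kappa :: "cell_point \<Rightarrow> cell_point \<Rightarrow> artin_gen word set" where
  "kappa y y' = artin_class (centre_word (chart_of y) y)
     \<cdot> inv\<^sub>A artin_class (centre_word (chart_of y) y')"

lemma chart_region_at:
  assumes "tile_map c z \<in> chart_domain O'"
  obtains N w where "open N" "z \<in> N" "\<forall>z'\<in>N. tile_map c z' \<in> chart_domain O' \<and>
    artin_class (corner_word c z') \<cdot> artin_class (centre_word O' (tile_map c z')) = artin_class w"
proof -
  have "near O' (tile_map c z)" using assms by (simp add: chart_domain_def)
  then obtain N p w where "z \<in> N" "chart_region O' c N p w"
    by (rule near_regionE)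
  then show thesis
    by (intro that[of N w]) (simp_all add: chart_region_def chart_domain_def word_class_eq_iff)
qed

text \<open>In a tile, both words can be prefixed by the same \<open>corner_word\<close>, after
  which each becomes constant near the point. The prefix cancels in the transition, which is
  therefore locally constant.\<close>

lemma open_transition:
  "open {y \<in> chart_domain P \<inter> chart_domain Q.
     inv\<^sub>A artin_class (centre_word P y) \<cdot> artin_class (centre_word Q y) = g}"
    (is "open ?S")
  unfolding open_cell_point_def
proof
  fix c
  show "open (tile_map c -` ?S)"
  proof (subst open_subopen, intro ballI)
    fix z assume z: "z \<in> tile_map c -` ?S"
    then have PQ: "tile_map c z \<in> chart_domain P" "tile_map c z \<in> chart_domain Q" by auto
    obtain M u where M: "open M" "z \<in> M" "\<forall>z'\<in>M. tile_map c z' \<in> chart_domain P \<and>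
      artin_class (corner_word c z') \<cdot> artin_class (centre_word P (tile_map c z')) = artin_class u"
      by (rule chart_region_at[OF PQ(1)])
    obtain N v where N: "open N" "z \<in> N" "\<forall>z'\<in>N. tile_map c z' \<in> chart_domain Q \<and>
      artin_class (corner_word c z') \<cdot> artin_class (centre_word Q (tile_map c z')) = artin_class v"
      by (rule chart_region_at[OF PQ(2)])
    have t: "inv\<^sub>A artin_class (centre_word P (tile_map c z')) \<cdot> artin_class (centre_word Q (tile_map c z'))
        = inv\<^sub>A artin_class u \<cdot> artin_class v" if "z' \<in> M \<inter> N" for z'
    proof -
      let ?f = "artin_class (corner_word c z')" and ?p = "artin_class (centre_word P (tile_map c z'))"
        and ?q = "artin_class (centre_word Q (tile_map c z'))"
      have "artin_class u = ?f \<cdot> ?p" "artin_class v = ?f \<cdot> ?q" using M(3) N(3) that by simp_all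
      moreover have "inv\<^sub>A (f \<cdot> p) \<cdot> (f \<cdot> q) = inv\<^sub>A p \<cdot> q"
        if "f \<in> carrier artin_23inf" "p \<in> carrier artin_23inf" "q \<in> carrier artin_23inf" for f p q
      proof -
        have "inv\<^sub>A f \<cdot> (f \<cdot> q) = q"
          using that by (simp add: artin.m_assoc[symmetric])
        then show ?thesis using that by (simp add: artin.inv_mult_group artin.m_assoc)
      qed
      ultimately show ?thesis using artin_class_closed by metis
    qed
    have "M \<inter> N \<subseteq> tile_map c -` ?S"
    proof
      fix z' assume z': "z' \<in> M \<inter> N"
      have "inv\<^sub>A artin_class u \<cdot> artin_class v = g"
        using t[of z] z M(2) N(2) by simp
      then show "z' \<in> tile_map c -` ?S"
        using t[OF z'] M(3) N(3) z' by simp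
    qed
    then show "\<exists>T. open T \<and> z \<in> T \<and> T \<subseteq> tile_map c -` ?S"
      using M(1,2) N(1,2) by (intro exI[of _ "M \<inter> N"]) auto
  qed
qed

lemma (in group) transition_cocycle:
  assumes "x \<in> carrier G" "y \<in> carrier G" "z \<in> carrier G" "y' \<in> carrier G" "z' \<in> carrier G"
    and "inv z \<otimes> z' = inv y \<otimes> y'"
  shows "x \<otimes> inv z = x \<otimes> inv y \<otimes> (y' \<otimes> inv z')"
proof -
  have "inv y \<otimes> (y' \<otimes> inv z') = inv y \<otimes> y' \<otimes> inv z'" using assms(1-5) by (simp add: m_assoc)
  also have "\<dots> = inv z \<otimes> (z' \<otimes> inv z')" unfolding assms(6)[symmetric] using assms(1-5) by (simp add: m_assoc)
  also have "\<dots> = inv z" using assms(1-5) by simp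
  finally show ?thesis using assms(1-5) by (simp add: m_assoc)
qed

text \<open>After cancelling the word of \<open>x\<close>, the cocycle identity says that the
  transition between the charts of \<open>x\<close> and \<open>y\<close> has the same value at
  \<open>z\<close> as at \<open>y\<close>.\<close>

interpretation holonomy: local_system artin_23inf tiled kappa
proof
  fix x y assume "x \<in> tiled" "y \<in> tiled"
  show "kappa x y \<in> carrier artin_23inf" by (simp add: kappa_def del: artin_class_mult)
next
  fix x assume x: "x \<in> tiled"
  show "kappa x x = \<one>\<^bsub>artin_23inf\<^esub>" by (simp add: kappa_def del: artin_class_mult)
  let ?P = "chart_of x"
  show "\<exists>W. open W \<and> x \<in> W \<and> (\<forall>y\<in>W \<inter> tiled. \<exists>V. open V \<and> y \<in> V \<and>
      (\<forall>z\<in>V \<inter> tiled. kappa x z = kappa x y \<cdot> kappa y z))"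
  proof (rule exI[of _ "chart_domain ?P"], intro conjI ballI open_chart_domain chart_of x)
    fix y assume y: "y \<in> chart_domain ?P \<inter> tiled"
    let ?Q = "chart_of y"
    let ?V = "{z \<in> chart_domain ?P \<inter> chart_domain ?Q.
       inv\<^sub>A artin_class (centre_word ?P z) \<cdot> artin_class (centre_word ?Q z) =
       inv\<^sub>A artin_class (centre_word ?P y) \<cdot> artin_class (centre_word ?Q y)}"
    show "\<exists>V. open V \<and> y \<in> V \<and> (\<forall>z\<in>V \<inter> tiled. kappa x z = kappa x y \<cdot> kappa y z)"
    proof (rule exI[of _ ?V], intro conjI ballI open_transition)
      show "y \<in> ?V" using y chart_of[of y] by simp
      fix z assume "z \<in> ?V \<inter> tiled"
      then show "kappa x z = kappa x y \<cdot> kappa y z"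
        unfolding kappa_def by (intro artin.transition_cocycle artin_class_closed) simp
    qed
  qed
qed

lemma (in group) region_cocycle:
  assumes "p \<in> carrier G" "q \<in> carrier G" "f \<in> carrier G" "g \<in> carrier G" "f \<otimes> p = g \<otimes> q"
  shows "g = f \<otimes> (p \<otimes> inv q)"
  using assms by (metis inv_closed inv_solve_right m_assoc m_closed)

text \<open>Along a path in one tile the class of \<open>corner_word\<close> is itself a flat
  section: multiplied by \<open>centre_word\<close> of the chart at hand it is constant in a
  region.\<close>

lemma hol_tile_map:
  assumes f: "path f"
  shows "holonomy.hol (tile_map c \<circ> f) =
    inv\<^sub>A artin_class (corner_word c (pathstart f)) \<cdot> artin_class (corner_word c (pathfinish f))"
proof -
  have "holonomy.flat {0..1} (tile_map c \<circ> f) (\<lambda>t. artin_class (corner_word c (f t)))"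
  proof (rule holonomy.flatI)
    fix t :: real assume t: "t \<in> {0..1}"
    show "(tile_map c \<circ> f) t \<in> tiled" "artin_class (corner_word c (f t)) \<in> carrier artin_23inf" by simp_all
    let ?y = "tile_map c (f t)"
    obtain N w where N: "open N" "f t \<in> N" "\<forall>z'\<in>N. tile_map c z' \<in> chart_domain (chart_of ?y) \<and>
      artin_class (corner_word c z') \<cdot> artin_class (centre_word (chart_of ?y) (tile_map c z')) = artin_class w"
      by (rule chart_region_at[OF chart_of[OF tile_map_in_tiled]])
    obtain U where U: "open U" "t \<in> U" "\<forall>t'\<in>{0..1} \<inter> U. f t' \<in> N"
      by (rule continuous_on_nbhd[OF f[unfolded path_def] t N(1,2)])
    have "artin_class (corner_word c (f t')) = artin_class (corner_word c (f t)) \<cdot> kappa ?y (tile_map c (f t'))"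
      if "t' \<in> {0..1} \<inter> U" for t'
      unfolding kappa_def
    proof (rule artin.region_cocycle)
      have "f t' \<in> N" using U(3) that by simp
      then show "artin_class (corner_word c (f t)) \<cdot> artin_class (centre_word (chart_of ?y) ?y) =
          artin_class (corner_word c (f t')) \<cdot> artin_class (centre_word (chart_of ?y) (tile_map c (f t')))"
        using N(2,3) by (simp del: artin_class_mult)
    qed simp_all
    then show "\<exists>U. open U \<and> t \<in> U \<and> (\<forall>t'\<in>{0..1} \<inter> U. artin_class (corner_word c (f t')) =
        artin_class (corner_word c (f t)) \<cdot> kappa ((tile_map c \<circ> f) t) ((tile_map c \<circ> f) t'))"
      using U(1,2) by (intro exI[of _ U]) (simp del: artin_class_mult)
  qed
  from holonomy.hol_eqI[OF this] show ?thesis by (simp add: pathstart_def pathfinish_def)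
qed

section \<open>Holonomy of lifts of words\<close>

lemma hol_edges:
  "holonomy.hol (edge_a k) = artin_class word_a" "holonomy.hol (edge_b k) = artin_class word_b"
  "holonomy.hol (edge_d k) = artin_class word_d"
proof -
  have i: "inv\<^sub>A artin_class [] = artin_class []"
    using artin.inv_one by (simp add: artin_class_one)
  show "holonomy.hol (edge_a k) = artin_class word_a" "holonomy.hol (edge_b k) = artin_class word_b"
    unfolding edge_eq_tile_map(1,3) by (simp_all add: hol_tile_map i)
  \<comment> \<open>The edge is viewed as the top of the tile one vertex earlier, where it equals a
    side of the tile as a function. The corner words at the ends of that side are b and bd.\<close>
  have "holonomy.hol (edge_d (k - 1 + 1)) = artin_class word_d"
    unfolding edge_eq_tile_map(7)
    by (simp add: hol_tile_map del: artin_class_mult)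
      (simp add: artin.m_assoc[symmetric] flip: artin_class_mult)
  then show "holonomy.hol (edge_d k) = artin_class word_d" by simp
qed

lemma hol_reversepath:
  assumes "tiled_path p"
  shows "holonomy.hol (reversepath p) = inv\<^sub>A holonomy.hol p"
proof -
  have "holonomy.hol (reversepath p +++ p) = \<one>\<^bsub>artin_23inf\<^esub>"
    using holonomy.hol_homotopic[OF homotopic_paths_units(4)[of p tiled]] assms
      holonomy.hol_const[OF path_ends_tiled(2)[OF assms]] by simp
  then have "holonomy.hol (reversepath p) \<cdot> holonomy.hol p = \<one>\<^bsub>artin_23inf\<^esub>"
    using holonomy.hol_join[of "reversepath p" p] assms by simp
  then show ?thesis
    using holonomy.hol_closed assms by (intro artin.inv_equality[symmetric]) simp_all
qed

lemma hol_lift_gen: "holonomy.hol (lift_gen g k) = artin_class [(g, True)]"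
proof (cases g)
  case gen_c
  have "holonomy.hol (lift_gen g k) = artin_class word_d \<cdot> inv\<^sub>A artin_class word_b"
    unfolding gen_c lift_gen.simps
    by (subst holonomy.hol_join) (simp_all add: hol_reversepath hol_edges add.commute)
  moreover have "artin_class word_d = artin_class [(g, True)] \<cdot> artin_class word_b"
    by (simp add: gen_c word_d_def word_b_def)
  ultimately show ?thesis
    by (simp add: artin.m_assoc del: artin_class_mult)
qed (simp_all add: hol_edges word_a_def word_b_def)

lemma artin_class_inverse: "inv\<^sub>A artin_class [(g, True)] = artin_class [(g, False)]"
  by (rule artin.inv_equality)
    (use word_eq.cancel[of artin_rels g False] in \<open>simp_all add: artin_class_one word_class_eq_iff\<close>)

lemma hol_lift_word: "holonomy.hol (lift_word w k) = artin_class w"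
proof (induction w arbitrary: k)
  case Nil
  show ?case by (simp add: holonomy.hol_const artin_class_one)
next
  case (Cons l w)
  obtain g b where l: "l = (g, b)" by (cases l)
  have "holonomy.hol (lift_letter l k) = artin_class [l]"
    by (cases b) (simp_all add: l hol_lift_gen hol_reversepath artin_class_inverse)
  then have "holonomy.hol (lift_word (l # w) k) = artin_class [l] \<cdot> artin_class w"
    using holonomy.hol_join[of "lift_letter l k" "lift_word w (k + letter_degree l)"]
    by (simp add: Cons.IH del: artin_class_mult)
  then show ?case by simp
qed

text \<open>The tether moves the loop to a vertex, where it can be compared with lifts of
  words.\<close>

definition based_hol :: "cell_point \<Rightarrow> (real \<Rightarrow> cell_point) \<Rightarrow> artin_gen word set" where
  "based_hol y p = holonomy.hol (tether y +++ (p +++ reversepath (tether y)))"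

text \<open>A loop is traced from \<open>base y\<close> back to \<open>base y\<close>, so the traced
  word has degree 0 modulo 6. Its lift is then itself a loop, and its class is the holonomy.\<close>

lemma loop_lift_word:
  assumes p: "tiled_path p" "pathstart p = y" "pathfinish p = y"
  obtains w where "word_degree w = 0" "tether y +++ p \<asymp> lift_word w (base y) +++ tether y"
    "based_hol y p = artin_class w"
proof -
  have y: "y \<in> tiled" using path_ends_tiled(1)[OF p(1)] p by simp
  note Y = tether_path[OF y]
  have tr: "traced p" by (rule tiled_path_traced[OF p(1)])
  obtain w where w0: "base y = base y + word_degree w" and w: "tether y +++ p \<asymp> lift_word w (base y) +++ tether y"
    using tr unfolding traced_def p(2,3) by (elim exE conjE)
  have d: "word_degree w = 0" using w0 by (simp only: add_cancel_right_right)
  have h: "based_hol y p = holonomy.hol (lift_word w (base y))"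
    unfolding based_hol_def
  proof (rule holonomy.hol_homotopic)
    let ?r = "reversepath (tether y)"
    have r: "tiled_path ?r" "pathstart ?r = y" "pathfinish ?r = Vert (base y)" using Y by simp_all
    have f: "pathfinish (lift_word w (base y)) = Vert (base y)" using d by simp
    have "tether y +++ (p +++ ?r) \<asymp> (tether y +++ p) +++ ?r"
      by (rule homotopic_paths_assoc) (simp_all only: p Y r)
    also have "\<dots> \<asymp> (lift_word w (base y) +++ tether y) +++ ?r"
      by (rule homotopic_join_left[OF w]) (simp_all only: p Y r pathfinish_join)
    also have "\<dots> \<asymp> lift_word w (base y) +++ (tether y +++ ?r)"
      by (rule homotopic_assoc) (simp_all only: p Y r d add_0_right lift_word_pathD)
    also have "\<dots> \<asymp> lift_word w (base y) +++ (\<lambda>_. Vert (base y))"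
      by (rule homotopic_join_right) (use homotopic_paths_units(3)[of "tether y" tiled] Y f in simp_all)
    also have "\<dots> \<asymp> lift_word w (base y)"
      using homotopic_paths_units(1)[of "lift_word w (base y)" tiled] f by simp
    finally show "tether y +++ (p +++ ?r) \<asymp> lift_word w (base y)" .
  qed
  show thesis by (rule that[OF d w]) (simp only: h hol_lift_word)
qed


lemma based_hol_homotopic:
  assumes "p \<asymp> q" "pathstart p = y" "pathfinish p = y"
  shows "based_hol y p = based_hol y q"
proof -
  have tp: "tiled_path p" "tiled_path q"
    using homotopic_paths_imp_path[OF assms(1)] homotopic_paths_imp_subset[OF assms(1)] by simp_all
  have y: "y \<in> tiled" using path_ends_tiled(1)[OF tp(1)] assms by simp
  have e: "pathstart q = y" "pathfinish q = y"
    using homotopic_paths_imp_pathstart[OF assms(1)] homotopic_paths_imp_pathfinish[OF assms(1)] assms by simp_all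
  show ?thesis
    unfolding based_hol_def
    by (intro holonomy.hol_homotopic homotopic_join_right homotopic_join_left assms(1))
      (use tether_path[OF y] assms e in simp_all)
qed

lemma (in group) conjugate_mult:
  assumes "x \<in> carrier G" "p \<in> carrier G" "q \<in> carrier G"
  shows "x \<otimes> (p \<otimes> q \<otimes> inv x) = x \<otimes> (p \<otimes> inv x) \<otimes> (x \<otimes> (q \<otimes> inv x))"
proof -
  have "inv x \<otimes> (x \<otimes> (q \<otimes> inv x)) = q \<otimes> inv x" using assms by (simp add: m_assoc[symmetric])
  then show ?thesis using assms by (simp add: m_assoc)
qed

lemma based_hol_eq:
  assumes p: "tiled_path p" "pathstart p = y" "pathfinish p = y"
  shows "based_hol y p = holonomy.hol (tether y) \<cdot>
    (holonomy.hol p \<cdot> inv\<^sub>A holonomy.hol (tether y))"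
proof -
  have y: "y \<in> tiled" using path_ends_tiled(1)[OF p(1)] p by simp
  note Y = tether_path[OF y]
  show ?thesis
    unfolding based_hol_def using p Y
    by (simp add: holonomy.hol_join hol_reversepath)
qed

lemma based_hol_join:
  assumes p: "tiled_path p" "pathstart p = y" "pathfinish p = y"
    and q: "tiled_path q" "pathstart q = y" "pathfinish q = y"
  shows "based_hol y (p +++ q) = based_hol y p \<cdot> based_hol y q"
proof -
  have y: "y \<in> tiled" using path_ends_tiled(1)[OF p(1)] p by simp
  have pq: "tiled_path (p +++ q)" "pathstart (p +++ q) = y" "pathfinish (p +++ q) = y"
    using p q by simp_all
  have "holonomy.hol (p +++ q) = holonomy.hol p \<cdot> holonomy.hol q"
    using p q by (intro holonomy.hol_join) simp_all
  then show ?thesis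
    unfolding based_hol_eq[OF p] based_hol_eq[OF q] based_hol_eq[OF pq]
    using artin.conjugate_mult[OF holonomy.hol_closed holonomy.hol_closed holonomy.hol_closed, of "tether y" p q]
      tether_path[OF y] p q by simp
qed

lemma homotopic_cancel_left:
  assumes t: "tiled_path t" and p: "tiled_path p" and q: "tiled_path q"
    and e: "pathfinish t = y" "pathstart p = y" "pathstart q = y"
    and h: "t +++ p \<asymp> t +++ q"
  shows "p \<asymp> q"
proof -
  let ?r = "reversepath t"
  have r: "tiled_path ?r" "pathstart ?r = y" "pathfinish ?r = pathstart t" using t e by simp_all
  have rt: "(\<lambda>_. y) \<asymp> ?r +++ t"
    using homotopic_paths_sym[OF homotopic_paths_units(4)[of t tiled]] t unfolding e(1) by blast
  have cancel: "p \<asymp> ?r +++ (t +++ p)" if p: "tiled_path p" "pathstart p = y" for p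
  proof -
    have "p \<asymp> (\<lambda>_. y) +++ p"
      using homotopic_paths_sym[OF homotopic_paths_units(2)[of p tiled]] p by simp
    also have "\<dots> \<asymp> (?r +++ t) +++ p"
      by (rule homotopic_join_left[OF rt]) (simp_all only: p const_path_ends simp_thms)
    also have "\<dots> \<asymp> ?r +++ (t +++ p)"
      by (rule homotopic_assoc) (simp_all only: p t r e simp_thms)
    finally show ?thesis .
  qed
  note cancel[OF p e(2)]
  also have "?r +++ (t +++ p) \<asymp> ?r +++ (t +++ q)"
    by (rule homotopic_join_right[OF h]) (simp_all only: r t e pathstart_join simp_thms)
  also note homotopic_paths_sym[OF cancel[OF q e(3)]]
  finally show ?thesis .
qed

text \<open>The traced words of the two loops represent the same element, so their lifts are
  homotopic; the common tether cancels.\<close>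

lemma based_hol_inj:
  assumes p: "tiled_path p" "pathstart p = y" "pathfinish p = y"
    and q: "tiled_path q" "pathstart q = y" "pathfinish q = y"
    and eq: "based_hol y p = based_hol y q"
  shows "p \<asymp> q"
proof -
  have y: "y \<in> tiled" using path_ends_tiled(1)[OF p(1)] p by simp
  note Y = tether_path[OF y]
  obtain u where u: "word_degree u = 0" "tether y +++ p \<asymp> lift_word u (base y) +++ tether y"
    "based_hol y p = artin_class u"
    by (rule loop_lift_word[OF p])
  obtain v where v: "word_degree v = 0" "tether y +++ q \<asymp> lift_word v (base y) +++ tether y"
    "based_hol y q = artin_class v"
    by (rule loop_lift_word[OF q])
  have "artin_class u = artin_class v" using u(3) v(3) eq by (simp only:)
  then have "u \<simeq> v" by (simp only: word_class_eq_iff)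
  then have "\<forall>k. lift_word u k \<asymp> lift_word v k"
    by (rule lift_word_cong[THEN conjunct2])
  then have n: "lift_word u (base y) \<asymp> lift_word v (base y)" ..
  have "lift_word u (base y) +++ tether y \<asymp> lift_word v (base y) +++ tether y"
    by (rule homotopic_join_left[OF n]) (use Y u(1) in simp_all)
  from homotopic_paths_trans[OF homotopic_paths_trans[OF u(2) this] homotopic_paths_sym[OF v(2)]]
  show ?thesis by (rule homotopic_cancel_left[OF Y(1) p(1) q(1) Y(3) p(2) q(2)])
qed

lemma (in group) conjugate_cancel:
  assumes "x \<in> carrier G" "w \<in> carrier G"
  shows "x \<otimes> (inv x \<otimes> (w \<otimes> x) \<otimes> inv x) = w"
proof -
  have "inv x \<otimes> (w \<otimes> x) \<otimes> inv x = inv x \<otimes> (w \<otimes> (x \<otimes> inv x))" using assms by (simp add: m_assoc)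
  also have "\<dots> = inv x \<otimes> w" using assms by simp
  finally show ?thesis using assms by (simp add: m_assoc[symmetric])
qed

lemma based_hol_surj:
  assumes y: "y \<in> tiled" and w: "word_degree w = 0"
  obtains p where "tiled_path p" "pathstart p = y" "pathfinish p = y" "based_hol y p = artin_class w"
proof -
  note Y = tether_path[OF y]
  \<comment> \<open>The lift at the base vertex closes up because its degree is 0, and conjugation
    by the tether undoes the one in \<open>based_hol\<close>.\<close>
  define p where "p = reversepath (tether y) +++ (lift_word w (base y) +++ tether y)"
  have p: "tiled_path p" "pathstart p = y" "pathfinish p = y"
    using Y w by (simp_all add: p_def)
  have c: "holonomy.hol (tether y) \<in> carrier artin_23inf"
    using Y by (simp add: holonomy.hol_closed)
  have "holonomy.hol p = inv\<^sub>A holonomy.hol (tether y) \<cdot>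
      (artin_class w \<cdot> holonomy.hol (tether y))"
    unfolding p_def using Y w by (simp add: holonomy.hol_join hol_reversepath hol_lift_word)
  then have "based_hol y p = artin_class w"
    unfolding based_hol_eq[OF p] using artin.conjugate_cancel[OF c artin_class_closed[of w]] by simp
  with p show thesis by (rule that)
qed

section \<open>The kernel of the degree and its index\<close>

definition degree_kernel :: "artin_gen word set set" where
  "degree_kernel = {artin_class w | w. word_degree w = 0}"

lemma word_degree_cong:
  assumes "artin_class u = artin_class v"
  shows "word_degree u = word_degree v"
  using assms lift_word_cong[THEN conjunct1] by (simp only: word_class_eq_iff)

lemma degree_kernel_iff: "artin_class w \<in> degree_kernel \<longleftrightarrow> word_degree w = 0"
  unfolding degree_kernel_def
proof
  assume "artin_class w \<in> {artin_class w |w. word_degree w = 0}"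
  then obtain v where "artin_class w = artin_class v" "word_degree v = 0" by auto
  then show "word_degree w = 0" using word_degree_cong[of w v] by simp
qed auto

lemma of_nat_surj_6: "\<exists>n. of_nat n = (k :: 6)"
proof -
  obtain z where z: "k = of_int z" "0 \<le> z" by (cases k) auto
  then have "of_nat (nat z) = k" by (simp add: of_nat_nat)
  then show ?thesis by blast
qed

lemma card_rcosets_degree_kernel: "card (rcosets\<^bsub>artin_23inf\<^esub> degree_kernel) = 6"
proof -
  \<comment> \<open>The fibres of the degree; they are shown to be the cosets.\<close>
  define S where "S k = {artin_class w | w. word_degree w = k}" for k
  have coset: "degree_kernel #>\<^bsub>artin_23inf\<^esub> artin_class v = S (word_degree v)" for v
  proof
    show "degree_kernel #>\<^bsub>artin_23inf\<^esub> artin_class v \<subseteq> S (word_degree v)"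
      by (force simp: degree_kernel_def S_def r_coset_def)
    show "S (word_degree v) \<subseteq> degree_kernel #>\<^bsub>artin_23inf\<^esub> artin_class v"
    proof
      fix g assume "g \<in> S (word_degree v)"
      then obtain w where g: "g = artin_class w" "word_degree w = word_degree v" by (auto simp: S_def)
      obtain v' where v': "artin_class (v' @ v) = artin_class []"
        using word_eq_inverse[of artin_rels v] by (metis word_class_eq_iff)
      then have d: "word_degree v' = - word_degree v"
        using word_degree_cong[OF v'] by (simp add: eq_neg_iff_add_eq_0)
      have "artin_class (w @ v' @ v) = artin_class w"
        using v' by (metis append_Nil2 artin_class_mult)
      moreover have "artin_class (w @ v') \<in> degree_kernel" using d g by (simp add: degree_kernel_iff)
      ultimately show "g \<in> degree_kernel #>\<^bsub>artin_23inf\<^esub> artin_class v"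
        unfolding r_coset_def g by (force intro: bexI[of _ "artin_class (w @ v')"])
    qed
  qed
  have deg: "\<exists>v. word_degree v = k" for k
  proof -
    \<comment> \<open>Powers of \<open>b\<close> realise every degree.\<close>
    have "word_degree (replicate n (gen_b, True)) = of_nat n" for n
      by (induction n) simp_all
    then show ?thesis by (metis of_nat_surj_6)
  qed
  have "rcosets\<^bsub>artin_23inf\<^esub> degree_kernel = range S"
    unfolding RCOSETS_def carrier_artin using coset deg by (auto simp: image_iff) metis
  moreover have "inj S"
  proof
    fix k l assume "S k = S l"
    obtain v where v: "word_degree v = k" using deg by blast
    then have "artin_class v \<in> S k" unfolding S_def by blast
    then have "artin_class v \<in> S l" by (simp only: \<open>S k = S l\<close>)
    then obtain w where "artin_class v = artin_class w" "word_degree w = l" unfolding S_def by blast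
    then show "k = l" using v word_degree_cong[of v w] by simp
  qed
  ultimately show ?thesis by (simp add: card_image)
qed

lemma subgroup_degree_kernel: "subgroup degree_kernel artin_23inf"
proof (rule artin.subgroupI)
  show "degree_kernel \<subseteq> carrier artin_23inf"
    unfolding degree_kernel_def by (blast intro: artin_class_closed)
  show "degree_kernel \<noteq> {}"
    unfolding degree_kernel_def by (blast intro: exI[of _ "[]"] word_degree_simps(1))
next
  fix g assume "g \<in> degree_kernel"
  then obtain w where w: "g = artin_class w" "word_degree w = 0" unfolding degree_kernel_def by blast
  obtain v where v: "v @ w \<simeq> []" using word_eq_inverse by blast
  have "word_degree (v @ w) = word_degree []" by (rule lift_word_cong[OF v, THEN conjunct1])
  then have d: "word_degree v = 0" using w(2) by simp
  have "artin_class (v @ w) = artin_class []" using v by (simp only: word_class_eq_iff)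
  then have "artin_class v \<cdot> artin_class w = \<one>\<^bsub>artin_23inf\<^esub>"
    by (simp only: artin_class_mult artin_class_one)
  then have "inv\<^sub>A g = artin_class v"
    unfolding w(1) by (rule artin.inv_equality) simp_all
  then show "inv\<^sub>A g \<in> degree_kernel" using d by (simp add: degree_kernel_iff)
next
  fix g h assume "g \<in> degree_kernel" "h \<in> degree_kernel"
  then obtain u v where "g = artin_class u" "word_degree u = 0" "h = artin_class v" "word_degree v = 0"
    unfolding degree_kernel_def by blast
  then show "g \<cdot> h \<in> degree_kernel" by (simp add: degree_kernel_iff)
qed

section \<open>The total space is the model complex\<close>

text \<open>
  \<open>v\<^sub>i\<close> and \<open>w\<^sub>i\<close> become the vertices \<open>2i\<close> and \<open>2i + 1\<close>. The segment over \<open>p\<^sub>i\<close> is the edge \<open>b\<close> at \<open>2i\<close>,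
  the segment over \<open>q\<^sub>i\<close> is the edge \<open>b\<close> at \<open>2i + 3\<close> traversed backwards. Hence the squares over
  \<open>\<lambda>\<^sub>i\<close>, \<open>\<alpha>\<^sub>i\<close> are tiles at \<open>2i\<close>, and those over \<open>\<mu>\<^sub>i\<close>, \<open>\<beta>\<^sub>i\<close> are tiles at \<open>2i + 3\<close> turned upside down.
\<close>

definition double :: "3 \<Rightarrow> 6" where
  "double i = (if i = 0 then 0 else if i = 1 then 2 else 4)"

definition half :: "6 \<Rightarrow> 3" where
  "half k = (if k = 0 \<or> k = 1 then 0 else if k = 2 \<or> k = 3 then 1 else 2)"

definition is_odd :: "6 \<Rightarrow> bool" where
  "is_odd k \<longleftrightarrow> k = 1 \<or> k = 3 \<or> k = 5"

fun offset :: "theta_vertex \<Rightarrow> 6" where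
  "offset Theta_v = 0" | "offset Theta_w = 1"

definition side :: "6 \<Rightarrow> theta_vertex" where
  "side k = (if is_odd k then Theta_w else Theta_v)"

lemma three_cases: "(i :: 3) = 0 \<or> i = 1 \<or> i = 2"
  using exhaust_3[of i] by auto

lemma six_cases: "(k :: 6) = 0 \<or> k = 1 \<or> k = 2 \<or> k = 3 \<or> k = 4 \<or> k = 5"
proof -
  obtain z where z: "k = of_int z" "0 \<le> z" "z < 6" by (cases k) auto
  then have "z = 0 \<or> z = 1 \<or> z = 2 \<or> z = 3 \<or> z = 4 \<or> z = 5" by linarith
  then show ?thesis using z(1) by auto
qed

text \<open>Doubling is a homomorphism from the integers modulo 3 to those modulo 6, where 4 stands
  for -2.\<close>

lemma double_add:
  "double (i + 1) = double i + 2" "double (i + 2) = double i + 4" "double (i - 1) = double i + 4"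
  using three_cases[of i] by (auto simp: double_def)

lemma half_double [simp]:
  "half (double i + offset v) = i" "side (double i + offset v) = v" "half (double i) = i" "\<not> is_odd (double i)"
  "half (double i + 3) = i + 1" "is_odd (double i + 3)" "side (double i) = Theta_v"
  using three_cases[of i] by (cases v; auto simp: half_def double_def is_odd_def side_def)+

text \<open>Odd vertices are written with 3 and not with 1, because the tiles based at
  \<open>double i + 3\<close> are the ones over the arcs \<open>Beta\<close> and \<open>Mu\<close>
  of the same edge space \<open>i\<close>.\<close>

lemma even_or_odd: "\<exists>i. k = double i \<or> k = double i + 3"
proof -
  have "k = double 0 \<or> k = double 1 \<or> k = double 2 \<or> k = double 0 + 3 \<or> k = double 1 + 3 \<or> k = double 2 + 3"
    using six_cases[of k] by (auto simp: double_def)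
  then show ?thesis by blast
qed

section \<open>Points of the total space and their representatives\<close>

abbreviation vertex_point :: "3 + vertex_graph_arc \<times> real \<Rightarrow> (3 + vertex_graph_arc \<times> real) set" where
  "vertex_point \<equiv> graph_point vertex_graph"

abbreviation edge_point :: "edge_graph_vertex + edge_graph_arc \<times> real \<Rightarrow> (edge_graph_vertex + edge_graph_arc \<times> real) set" where
  "edge_point \<equiv> graph_point edge_graph"

abbreviation iota_map :: "3 \<Rightarrow> (edge_graph_vertex + edge_graph_arc \<times> real) set \<Rightarrow> (3 + vertex_graph_arc \<times> real) set" where
  "iota_map i \<equiv> graph_map vertex_graph (iota_vertex i) (iota_arc i)"

abbreviation tau_map :: "3 \<Rightarrow> (edge_graph_vertex + edge_graph_arc \<times> real) set \<Rightarrow> (3 + vertex_graph_arc \<times> real) set" where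
  "tau_map i \<equiv> graph_map vertex_graph (tau_vertex i) (tau_arc i)"

abbreviation vertex_pieces :: "(3 + vertex_graph_arc \<times> real) set" where
  "vertex_pieces \<equiv> topspace (graph_pieces vertex_graph)"

abbreviation edge_pieces :: "(edge_graph_vertex + edge_graph_arc \<times> real) set" where
  "edge_pieces \<equiv> topspace (graph_pieces edge_graph)"

definition theta_pieces where
  "theta_pieces = total_pieces theta_graph (\<lambda>_. realization vertex_graph) (\<lambda>_. realization edge_graph)"

definition theta_point where
  "theta_point = quotient_point theta_pieces (total_glue theta_graph iota_map tau_map)"

lemma X_Theta_eq: "X_Theta = quotient_space theta_pieces (total_glue theta_graph iota_map tau_map)"
  by (simp add: X_Theta_def total_space_def theta_pieces_def)

fun vertex_piece :: "theta_vertex \<Rightarrow> 3 + vertex_graph_arc \<times> real \<Rightarrow> cell_point" where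
  "vertex_piece v (Inl j) = Vert (double j + offset v)"
| "vertex_piece v (Inr (Edge_x j, t)) = edge_d (double j + offset v) t"
| "vertex_piece v (Inr (Loop_a j, t)) = edge_a (double j + offset v) t"

fun edge_piece :: "3 \<Rightarrow> edge_graph_vertex + edge_graph_arc \<times> real \<Rightarrow> real \<Rightarrow> cell_point" where
  "edge_piece i (Inl Vert_p) s = edge_b (double i) s"
| "edge_piece i (Inl Vert_q) s = edge_b (double i + 3) (1 - s)"
| "edge_piece i (Inr (Alpha, t)) s = tile_D (double i) t s"
| "edge_piece i (Inr (Beta, t)) s = tile_D (double i + 3) t (1 - s)"
| "edge_piece i (Inr (Lambda, t)) s = tile_C (double i) t s"
| "edge_piece i (Inr (Mu, t)) s = tile_C (double i + 3) t (1 - s)"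

lemma vertex_graph_simps [simp]:
  "verts vertex_graph = UNIV" "arcs vertex_graph = UNIV" "tail vertex_graph = vertex_graph_tail" "head vertex_graph = vertex_graph_head"
  by (simp_all add: vertex_graph_def)

lemma edge_graph_simps [simp]:
  "verts edge_graph = UNIV" "arcs edge_graph = UNIV" "tail edge_graph = edge_graph_tail" "head edge_graph = edge_graph_head"
  by (simp_all add: edge_graph_def)

lemma theta_graph_simps [simp]:
  "verts theta_graph = UNIV" "arcs theta_graph = UNIV" "tail theta_graph i = Theta_v" "head theta_graph i = Theta_w"
  by (auto simp: theta_graph_def intro: theta_vertex.exhaust)

lemma vertex_piece_glue: "graph_glue vertex_graph p p' \<Longrightarrow> vertex_piece v p = vertex_piece v p'"
proof (induction rule: graph_glue.cases)
  case (1 e)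
  then show ?case by (cases e) (simp_all add: tile_defs)
next
  case (2 e)
  then show ?case by (cases e) (simp_all add: tile_defs double_add add_ac)
qed

lemma edge_piece_glue: "graph_glue edge_graph p p' \<Longrightarrow> edge_piece i p s = edge_piece i p' s"
proof (induction rule: graph_glue.cases)
  case (1 e)
  then show ?case by (cases e) (simp_all add: tile_D_sides, auto simp: tile_defs)
next
  case (2 e)
  then show ?case by (cases e) (simp_all add: tile_D_sides, auto simp: tile_defs)
qed

lemma the_elem_vertex_piece:
  "p \<in> vertex_pieces \<Longrightarrow> the_elem (vertex_piece v ` vertex_point p) = vertex_piece v p"
  unfolding graph_point_def by (rule the_elem_quotient_point) (auto intro: vertex_piece_glue)

lemma the_elem_edge_piece:
  "p \<in> edge_pieces \<Longrightarrow> the_elem ((\<lambda>p. edge_piece i p s) ` edge_point p) = edge_piece i p s"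
  unfolding graph_point_def by (rule the_elem_quotient_point) (auto intro: edge_piece_glue)

lemma iota_map_point: "p \<in> edge_pieces \<Longrightarrow>
    iota_map i (edge_point p) = piece_map vertex_graph (iota_vertex i) (iota_arc i) p"
  by (rule graph_map_point[OF wf_vertex_graph]) (use iota_arc_walk in auto)

lemma tau_map_point: "p \<in> edge_pieces \<Longrightarrow>
    tau_map i (edge_point p) = piece_map vertex_graph (tau_vertex i) (tau_arc i) p"
  by (rule graph_map_point[OF wf_vertex_graph]) (use tau_arc_walk in auto)

lemma topspace_vertex_pieces [simp]:
  "Inl j \<in> vertex_pieces"
  "Inr (e, t) \<in> vertex_pieces \<longleftrightarrow> 0 \<le> t \<and> t \<le> 1"
  by auto

lemma topspace_edge_pieces [simp]:
  "Inl u \<in> edge_pieces"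
  "Inr (f, t) \<in> edge_pieces \<longleftrightarrow> 0 \<le> t \<and> t \<le> 1"
  by auto

text \<open>A common representative shows that the gluing at the initial end is what the tiles do at
  \<open>s = 0\<close>. The path of length two over \<open>Alpha\<close> changes arcs at
  \<open>1 / 2\<close>, just where the bottom of \<open>tile_D\<close> has its middle vertex. At the
  terminal end \<open>Beta\<close> plays this part, its tile being upside down.\<close>

lemma iota_piece:
  assumes p: "p \<in> edge_pieces"
  shows "\<exists>p'\<in>vertex_pieces.
    iota_map i (edge_point p) = vertex_point p' \<and> edge_piece i p 0 = vertex_piece Theta_v p'"
proof (cases p)
  case (Inl u)
  show ?thesis
    unfolding iota_map_point[OF p] unfolding Inl
    by (intro bexI[of _ "Inl (iota_vertex i u)"])
      (cases u; simp add: tile_defs double_add del: topspace_graph_pieces)+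
next
  case (Inr y)
  obtain e t where y: "y = (e, t)" by (cases y)
  have t: "0 \<le> t" "t \<le> 1" using p Inr y by auto
  let ?p = "case e of Alpha \<Rightarrow> if t < 1 / 2 then Inr (Edge_x i, 2 * t) else Inr (Edge_x (i + 1), 2 * t - 1)
     | Beta \<Rightarrow> Inr (Edge_x (i - 1), t) | Lambda \<Rightarrow> Inr (Loop_a i, t) | Mu \<Rightarrow> Inr (Loop_a (i - 1), t)"
  have "?p \<in> vertex_pieces"
    using t by (cases e) (simp_all del: topspace_graph_pieces)
  moreover have "piece_map vertex_graph (iota_vertex i) (iota_arc i) (Inr (e, t)) = vertex_point ?p"
    using t by (cases e) (simp_all add: walk_point_single walk_point_pair)
  moreover have "edge_piece i (Inr (e, t)) 0 = vertex_piece Theta_v ?p"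
    using t by (cases e) (simp_all add: tile_D_sides double_add, simp_all add: tile_C_def add_ac)
  ultimately show ?thesis
    unfolding iota_map_point[OF p] unfolding Inr y by (intro bexI[of _ ?p] conjI)
qed

lemma tau_piece:
  assumes p: "p \<in> edge_pieces"
  shows "\<exists>p'\<in>vertex_pieces.
    tau_map i (edge_point p) = vertex_point p' \<and> edge_piece i p 1 = vertex_piece Theta_w p'"
proof (cases p)
  case (Inl u)
  show ?thesis
    unfolding tau_map_point[OF p] unfolding Inl
    by (intro bexI[of _ "Inl (tau_vertex i u)"])
      (cases u; simp add: tile_defs double_add add.assoc del: topspace_graph_pieces)+
next
  case (Inr y)
  obtain e t where y: "y = (e, t)" by (cases y)
  have t: "0 \<le> t" "t \<le> 1" using p Inr y by auto
  let ?p = "case e of Alpha \<Rightarrow> Inr (Edge_x i, t)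
     | Beta \<Rightarrow> if t < 1 / 2 then Inr (Edge_x (i + 1), 2 * t) else Inr (Edge_x (i + 2), 2 * t - 1)
     | Lambda \<Rightarrow> Inr (Loop_a i, t) | Mu \<Rightarrow> Inr (Loop_a (i + 1), t)"
  have "?p \<in> vertex_pieces"
    using t by (cases e) (simp_all del: topspace_graph_pieces)
  moreover have "piece_map vertex_graph (tau_vertex i) (tau_arc i) (Inr (e, t)) = vertex_point ?p"
    using t by (cases e) (simp_all add: walk_point_single walk_point_pair)
  moreover have "edge_piece i (Inr (e, t)) 1 = vertex_piece Theta_w ?p"
    using t by (cases e) (simp_all add: tile_D_sides double_add, simp_all add: tile_C_def add_ac)
  ultimately show ?thesis
    unfolding tau_map_point[OF p] unfolding Inr y by (intro bexI[of _ ?p] conjI)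
qed

text \<open>The total space is a quotient of quotients. Here the map descends through the
  realizations of the graphs; the gluing of the total space follows in \<open>model\<close>.\<close>

fun piece_model :: "theta_vertex \<times> (3 + vertex_graph_arc \<times> real) set
     + 3 \<times> (edge_graph_vertex + edge_graph_arc \<times> real) set \<times> real \<Rightarrow> cell_point" where
  "piece_model (Inl (v, y)) = the_elem (vertex_piece v ` y)"
| "piece_model (Inr (i, y, s)) = the_elem ((\<lambda>p. edge_piece i p s) ` y)"

lemma theta_pieces_cases:
  assumes "z \<in> topspace theta_pieces"
  obtains v p where "p \<in> vertex_pieces" "z = Inl (v, vertex_point p)"
  | i p s where "p \<in> edge_pieces" "0 \<le> s" "s \<le> 1" "z = Inr (i, edge_point p, s)"
  using assms
  by (auto simp: theta_pieces_def total_pieces_def topspace_realization simp del: topspace_graph_pieces)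

lemma vertex_in_theta_pieces:
  "p \<in> vertex_pieces \<Longrightarrow> Inl (v, vertex_point p) \<in> topspace theta_pieces"
  by (auto simp: theta_pieces_def total_pieces_def topspace_realization simp del: topspace_graph_pieces)

lemma edge_in_theta_pieces:
  "p \<in> edge_pieces \<Longrightarrow> 0 \<le> s \<Longrightarrow> s \<le> 1 \<Longrightarrow> Inr (i, edge_point p, s) \<in> topspace theta_pieces"
  by (auto simp: theta_pieces_def total_pieces_def topspace_realization simp del: topspace_graph_pieces)

lemma piece_model_vertex:
  "p \<in> vertex_pieces \<Longrightarrow> piece_model (Inl (v, vertex_point p)) = vertex_piece v p"
  by (simp only: piece_model.simps the_elem_vertex_piece)

lemma piece_model_edge:
  "p \<in> edge_pieces \<Longrightarrow> piece_model (Inr (i, edge_point p, s)) = edge_piece i p s"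
  by (simp only: piece_model.simps the_elem_edge_piece)

lemma piece_model_glue:
  assumes z: "z \<in> topspace theta_pieces" and g: "total_glue theta_graph iota_map tau_map z z'"
  shows "piece_model z = piece_model z'"
  using g
proof cases
  case (1 i y)
  from z[unfolded 1(1)] obtain p where p: "p \<in> edge_pieces" "y = edge_point p"
    by (cases rule: theta_pieces_cases) auto
  obtain p' where p': "p' \<in> vertex_pieces"
    "iota_map i (edge_point p) = vertex_point p'" "edge_piece i p 0 = vertex_piece Theta_v p'"
    using iota_piece[OF p(1), of i] by (elim bexE conjE)
  show ?thesis
    unfolding 1 p(2) p'(2) theta_graph_simps piece_model_edge[OF p(1)] piece_model_vertex[OF p'(1)] by (rule p'(3))
next
  case (2 i y)
  from z[unfolded 2(1)] obtain p where p: "p \<in> edge_pieces" "y = edge_point p"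
    by (cases rule: theta_pieces_cases) auto
  obtain p' where p': "p' \<in> vertex_pieces"
    "tau_map i (edge_point p) = vertex_point p'" "edge_piece i p 1 = vertex_piece Theta_w p'"
    using tau_piece[OF p(1), of i] by (elim bexE conjE)
  show ?thesis
    unfolding 2 p(2) p'(2) theta_graph_simps piece_model_edge[OF p(1)] piece_model_vertex[OF p'(1)] by (rule p'(3))
qed

definition model :: "_ \<Rightarrow> cell_point" where
  "model x = the_elem (piece_model ` x)"

lemma model_point: "z \<in> topspace theta_pieces \<Longrightarrow> model (theta_point z) = piece_model z"
  unfolding model_def theta_point_def
  by (rule the_elem_quotient_point) (blast intro: piece_model_glue)+

lemma topspace_X_Theta: "topspace X_Theta = theta_point ` topspace theta_pieces"
  by (simp add: X_Theta_eq theta_point_def)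

lemma quotient_map_theta_point: "quotient_map theta_pieces X_Theta theta_point"
  unfolding X_Theta_eq theta_point_def by (rule quotient_map_quotient_point)

section \<open>Continuity of the map to the model\<close>

lemma continuous_tile_C: "continuous_on S f \<Longrightarrow> continuous_on S g \<Longrightarrow> continuous_on S (\<lambda>x. tile_C k (f x) (g x))"
  using continuous_on_tile_map[OF continuous_on_Pair, of S f g "Tile_C k"] by simp

lemma continuous_tile_D: "continuous_on S f \<Longrightarrow> continuous_on S g \<Longrightarrow> continuous_on S (\<lambda>x. tile_D k (f x) (g x))"
  using continuous_on_tile_map[OF continuous_on_Pair, of S f g "Tile_D k"] by simp

lemma continuous_edge_a: "continuous_on S f \<Longrightarrow> continuous_on S (\<lambda>x. edge_a k (f x))"
  using continuous_tile_C[of S f "\<lambda>_. 0" k] by (simp add: tile_C_def)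

lemma continuous_edge_b: "continuous_on S f \<Longrightarrow> continuous_on S (\<lambda>x. edge_b k (f x))"
  using continuous_tile_D[of S "\<lambda>_. 0" f k] by (simp add: tile_D_sides)

lemma continuous_edge_d: "continuous_on S f \<Longrightarrow> continuous_on S (\<lambda>x. edge_d k (f x))"
  using continuous_tile_D[of S f "\<lambda>_. 1" "k - 1"] by (simp add: tile_D_sides)

lemmas continuous_tiles = continuous_tile_C continuous_tile_D continuous_edge_a continuous_edge_b continuous_edge_d

lemma continuous_vertex_piece: "continuous_map (realization vertex_graph) euclidean (\<lambda>y. the_elem (vertex_piece v ` y))"
proof (rule continuous_compose_quotient_map[OF quotient_map_graph_point])
  have "continuous_map (graph_pieces vertex_graph) euclidean (vertex_piece v)"
    unfolding graph_pieces_def continuous_map_from_plus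
  proof (intro conjI continuous_map_from_sum)
    fix e :: vertex_graph_arc
    show "continuous_map (top_of_set {0..1}) euclidean (\<lambda>t. vertex_piece v (Inr (e, t)))"
      by (cases e) (auto intro!: continuous_tiles)
  qed simp
  then show "continuous_map (graph_pieces vertex_graph) euclidean ((\<lambda>y. the_elem (vertex_piece v ` y)) \<circ> vertex_point)"
    by (rule continuous_map_eq) (simp only: comp_def the_elem_vertex_piece)
qed

text \<open>The unit interval is compact and Hausdorff, so the projection from the pieces remains a
  quotient map after multiplication with it, and continuity can be tested on each arc times the
  interval.\<close>

lemma continuous_edge_piece:
  "continuous_map (prod_topology (realization edge_graph) (top_of_set {0..1})) euclidean
    (\<lambda>x. the_elem ((\<lambda>p. edge_piece i p (snd x)) ` fst x))"
proof (rule continuous_compose_quotient_map)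
  let ?I = "top_of_set {0..1::real}"
  have "compact_space ?I" by (simp add: compact_space_subtopology)
  then show "quotient_map (prod_topology (graph_pieces edge_graph) ?I) (prod_topology (realization edge_graph) ?I) (\<lambda>(p, s). (edge_point p, s))"
    by (intro quotient_map_prod_left compact_imp_locally_compact_space quotient_map_graph_point)
      (simp_all add: Hausdorff_space_subtopology)
  have "continuous_map (prod_topology (graph_pieces edge_graph) ?I) euclidean (\<lambda>x. edge_piece i (fst x) (snd x))"
  proof (rule continuous_map_from_graph_pieces_times)
    fix u :: edge_graph_vertex
    show "continuous_map ?I euclidean (\<lambda>s. edge_piece i (fst (Inl u, s)) (snd (Inl u, s)))"
      by (cases u) (auto intro!: continuous_tiles continuous_intros)
  next
    fix e :: edge_graph_arc
    have I: "prod_topology ?I ?I = top_of_set ({0..1} \<times> {0..1})"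
      by (simp add: prod_topology_subtopology subtopology_subtopology Times_Int_Times)
    show "continuous_map (prod_topology ?I ?I) euclidean
        (\<lambda>x. edge_piece i (fst (Inr (e, fst x), snd x)) (snd (Inr (e, fst x), snd x)))"
      unfolding I by (cases e) (auto intro!: continuous_tiles continuous_intros)
  qed
  then show "continuous_map (prod_topology (graph_pieces edge_graph) ?I) euclidean
      ((\<lambda>x. the_elem ((\<lambda>p. edge_piece i p (snd x)) ` fst x)) \<circ> (\<lambda>(p, s). (edge_point p, s)))"
    by (rule continuous_map_eq) (auto simp: the_elem_edge_piece simp del: topspace_graph_pieces)
qed

lemma continuous_model: "continuous_map X_Theta euclidean model"
proof (rule continuous_compose_quotient_map[OF quotient_map_theta_point])
  have "continuous_map theta_pieces euclidean piece_model"
    unfolding theta_pieces_def total_pieces_def continuous_map_from_plus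
  proof (intro conjI continuous_map_from_sum)
    fix v
    show "continuous_map (realization vertex_graph) euclidean (\<lambda>y. piece_model (Inl (v, y)))"
      using continuous_vertex_piece by simp
    fix i
    show "continuous_map (prod_topology (realization edge_graph) (top_of_set {0..1})) euclidean (\<lambda>x. piece_model (Inr (i, x)))"
      by (rule continuous_map_eq[OF continuous_edge_piece[of i]]) auto
  qed
  then show "continuous_map theta_pieces euclidean (model \<circ> theta_point)"
    by (rule continuous_map_eq) (simp add: model_point)
qed

text \<open>The inverse, one open cell at a time. The parity of the base vertex tells which arc lies
  below. An odd vertex is \<open>double i + 3\<close>, and its half is \<open>i + 1\<close>; hence
  the shift by one.\<close>

fun unmodel :: "cell_point \<Rightarrow> (theta_vertex \<times> (3 + vertex_graph_arc \<times> real) set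
     + 3 \<times> (edge_graph_vertex + edge_graph_arc \<times> real) set \<times> real) set" where
  "unmodel (Vert k) = theta_point (Inl (side k, vertex_point (Inl (half k))))"
| "unmodel (On_a k t) = theta_point (Inl (side k, vertex_point (Inr (Loop_a (half k), t))))"
| "unmodel (On_d k t) = theta_point (Inl (side k, vertex_point (Inr (Edge_x (half k), t))))"
| "unmodel (On_b k s) = theta_point (Inr (if is_odd k then (half k - 1, edge_point (Inl Vert_q), 1 - s)
     else (half k, edge_point (Inl Vert_p), s)))"
| "unmodel (In_C k t s) = theta_point (Inr (if is_odd k then (half k - 1, edge_point (Inr (Mu, t)), 1 - s)
     else (half k, edge_point (Inr (Lambda, t)), s)))"
| "unmodel (In_D k t s) = theta_point (Inr (if is_odd k then (half k - 1, edge_point (Inr (Beta, t)), 1 - s)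
     else (half k, edge_point (Inr (Alpha, t)), s)))"

lemma wf_edge_graph: "wf_digraph edge_graph"
  by (simp add: wf_digraph_def)

lemma unit_cases:
  fixes t :: real
  assumes "0 \<le> t" "t \<le> 1"
  obtains "t = 0" | "t = 1" | "0 < t" "t < 1"
  using assms by linarith

lemma unmodel_vertex_piece:
  assumes p: "p \<in> vertex_pieces"
  shows "unmodel (vertex_piece v p) = theta_point (Inl (v, vertex_point p))"
proof -
  have 0: "unmodel (vertex_piece v (Inl j)) = theta_point (Inl (v, vertex_point (Inl j)))" for j
    by simp
  show ?thesis
  proof (cases p)
    case (Inl j)
    then show ?thesis using 0 by (simp only:)
  next
    case (Inr y)
    obtain e t where y: "y = (e, t)" by (cases y)
    have t: "0 \<le> t" "t \<le> 1" using p Inr y by auto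
    from t show ?thesis
    proof (cases rule: unit_cases)
      case 1
      have "vertex_piece v (Inr (e, 0)) = vertex_piece v (Inl (vertex_graph_tail e))"
        using vertex_piece_glue[OF graph_glue.intros(1)[of vertex_graph e]] by simp
      moreover have "vertex_point (Inr (e, 0)) = vertex_point (Inl (vertex_graph_tail e))"
        using graph_point_glue(1)[OF wf_vertex_graph, of e] by simp
      ultimately show ?thesis unfolding Inr y 1 by (simp only: 0)
    next
      case 2
      have "vertex_piece v (Inr (e, 1)) = vertex_piece v (Inl (vertex_graph_head e))"
        using vertex_piece_glue[OF graph_glue.intros(2)[of vertex_graph e]] by simp
      moreover have "vertex_point (Inr (e, 1)) = vertex_point (Inl (vertex_graph_head e))"
        using graph_point_glue(2)[OF wf_vertex_graph, of e] by simp
      ultimately show ?thesis unfolding Inr y 2 by (simp only: 0)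
    next
      case 3
      then show ?thesis unfolding Inr y by (cases e) (simp_all add: edge_a_def edge_d_def)
    qed
  qed
qed

lemma theta_point_glue:
  assumes p: "p \<in> edge_pieces"
  shows "theta_point (Inr (i, edge_point p, 0)) = theta_point (Inl (Theta_v, iota_map i (edge_point p)))"
    "theta_point (Inr (i, edge_point p, 1)) = theta_point (Inl (Theta_w, tau_map i (edge_point p)))"
proof -
  obtain p' where "p' \<in> vertex_pieces" "iota_map i (edge_point p) = vertex_point p'"
    using iota_piece[OF p, of i] by (elim bexE conjE)
  then have "Inl (Theta_v, iota_map i (edge_point p)) \<in> topspace theta_pieces"
    by (simp only: vertex_in_theta_pieces)
  then show "theta_point (Inr (i, edge_point p, 0)) = theta_point (Inl (Theta_v, iota_map i (edge_point p)))"
    unfolding theta_point_def using edge_in_theta_pieces[OF p, of 0 i]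
      total_glue.intros(1)[of theta_graph iota_map tau_map i "edge_point p"]
    by (intro quotient_point_eqI) simp_all
  obtain p' where "p' \<in> vertex_pieces" "tau_map i (edge_point p) = vertex_point p'"
    using tau_piece[OF p, of i] by (elim bexE conjE)
  then have "Inl (Theta_w, tau_map i (edge_point p)) \<in> topspace theta_pieces"
    by (simp only: vertex_in_theta_pieces)
  then show "theta_point (Inr (i, edge_point p, 1)) = theta_point (Inl (Theta_w, tau_map i (edge_point p)))"
    unfolding theta_point_def using edge_in_theta_pieces[OF p, of 1 i]
      total_glue.intros(2)[of theta_graph iota_map tau_map i "edge_point p"]
    by (intro quotient_point_eqI) simp_all
qed

text \<open>\<open>unmodel\<close> reads normal forms. At an extreme height the point is pushed by
  the gluing into a vertex space, at an extreme position on an arc to a vertex of the edge graph;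
  what remains lies in an open cell, where the formula applies literally.\<close>

lemma unmodel_edge_piece:
  assumes p: "p \<in> edge_pieces" and s: "0 \<le> s" "s \<le> 1"
  shows "unmodel (edge_piece i p s) = theta_point (Inr (i, edge_point p, s))"
  using s
proof (cases rule: unit_cases)
  case 1
  obtain p' where p': "p' \<in> vertex_pieces"
    "iota_map i (edge_point p) = vertex_point p'" "edge_piece i p 0 = vertex_piece Theta_v p'"
    using iota_piece[OF p, of i] by (elim bexE conjE)
  show ?thesis
    unfolding 1 p'(3) theta_point_glue(1)[OF p] p'(2) by (rule unmodel_vertex_piece[OF p'(1)])
next
  case 2
  obtain p' where p': "p' \<in> vertex_pieces"
    "tau_map i (edge_point p) = vertex_point p'" "edge_piece i p 1 = vertex_piece Theta_w p'"
    using tau_piece[OF p, of i] by (elim bexE conjE)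
  show ?thesis
    unfolding 2 p'(3) theta_point_glue(2)[OF p] p'(2) by (rule unmodel_vertex_piece[OF p'(1)])
next
  case 3
  have 0: "unmodel (edge_piece i (Inl u) s) = theta_point (Inr (i, edge_point (Inl u), s))" for u
    using 3 by (cases u) (simp_all add: edge_b_def)
  show ?thesis
  proof (cases p)
    case (Inl j)
    then show ?thesis using 0 by (simp only:)
  next
    case (Inr y)
    obtain e t where y: "y = (e, t)" by (cases y)
    have t: "0 \<le> t" "t \<le> 1" using p Inr y by auto
    from t show ?thesis
    proof (cases rule: unit_cases)
      case 1
      have "edge_piece i (Inr (e, 0)) s = edge_piece i (Inl (edge_graph_tail e)) s"
        using edge_piece_glue[OF graph_glue.intros(1)[of edge_graph e]] by simp
      moreover have "edge_point (Inr (e, 0)) = edge_point (Inl (edge_graph_tail e))"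
        using graph_point_glue(1)[OF wf_edge_graph, of e] by simp
      ultimately show ?thesis unfolding Inr y 1 by (simp only: 0)
    next
      case 2
      have "edge_piece i (Inr (e, 1)) s = edge_piece i (Inl (edge_graph_head e)) s"
        using edge_piece_glue[OF graph_glue.intros(2)[of edge_graph e]] by simp
      moreover have "edge_point (Inr (e, 1)) = edge_point (Inl (edge_graph_head e))"
        using graph_point_glue(2)[OF wf_edge_graph, of e] by simp
      ultimately show ?thesis unfolding Inr y 2 by (simp only: 0)
    next
      case t: 3
      then show ?thesis using 3 unfolding Inr y by (cases e) (simp_all add: tile_C_def tile_D_def)
    qed
  qed
qed

lemma tile_map_eq_edge_piece:
  "\<exists>i e f. (f = id \<or> f = (\<lambda>s. 1 - s)) \<and> (\<forall>z. tile_map c z = edge_piece i (Inr (e, fst z)) (f (snd z)))"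
proof (cases c)
  case (Tile_C k)
  from even_or_odd[of k] consider i where "k = double i" | i where "k = double i + 3" by blast
  then show ?thesis
  proof cases
    case 1
    then show ?thesis using Tile_C by (intro exI[of _ i] exI[of _ Lambda] exI[of _ id]) auto
  next
    case 2
    then show ?thesis using Tile_C by (intro exI[of _ i] exI[of _ Mu] exI[of _ "\<lambda>s. 1 - s"]) auto
  qed
next
  case (Tile_D k)
  from even_or_odd[of k] consider i where "k = double i" | i where "k = double i + 3" by blast
  then show ?thesis
  proof cases
    case 1
    then show ?thesis using Tile_D by (intro exI[of _ i] exI[of _ Alpha] exI[of _ id]) auto
  next
    case 2
    then show ?thesis using Tile_D by (intro exI[of _ i] exI[of _ Beta] exI[of _ "\<lambda>s. 1 - s"]) auto
  qed
qed

text \<open>A tile as the square over an arc of an edge graph, possibly upside down, together with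
  the resulting formula for \<open>unmodel\<close> on it. Clamping keeps the arguments within the
  pieces of the total space.\<close>

definition square_over :: "tile \<Rightarrow> 3 \<Rightarrow> edge_graph_arc \<Rightarrow> (real \<Rightarrow> real) \<Rightarrow> bool" where
  "square_over c i e f \<longleftrightarrow> (f = id \<or> f = (\<lambda>s. 1 - s)) \<and>
     (\<forall>z. tile_map c z = edge_piece i (Inr (e, fst (clamp01 z))) (f (snd (clamp01 z))) \<and>
       unmodel (tile_map c z) = theta_point (Inr (i, edge_point (Inr (e, fst (clamp01 z))), f (snd (clamp01 z)))))"

lemma tile_map_unmodel:
  "\<exists>i e f. square_over c i e f"
proof -
  obtain i e f where f: "f = id \<or> f = (\<lambda>s. 1 - s)" and t: "\<forall>z. tile_map c z = edge_piece i (Inr (e, fst z)) (f (snd z))"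
    using tile_map_eq_edge_piece[of c] by (elim exE conjE)
  have e: "tile_map c z = edge_piece i (Inr (e, fst (clamp01 z))) (f (snd (clamp01 z)))" for z
    using t tile_map_clamp01[of c z] by metis
  have "0 \<le> fst (clamp01 z)" "fst (clamp01 z) \<le> 1" "0 \<le> f (snd (clamp01 z))" "f (snd (clamp01 z)) \<le> 1" for z
    using f by (auto simp: clamp01_def)
  then have "unmodel (tile_map c z) = theta_point (Inr (i, edge_point (Inr (e, fst (clamp01 z))), f (snd (clamp01 z))))" for z
    unfolding e by (intro unmodel_edge_piece) (simp_all del: topspace_graph_pieces)
  with f e show ?thesis
    unfolding square_over_def by (intro exI[of _ i] exI[of _ e] exI[of _ f] conjI allI)
qed

lemma clamp01_bounds: "0 \<le> fst (clamp01 z)" "fst (clamp01 z) \<le> 1" "0 \<le> snd (clamp01 z)" "snd (clamp01 z) \<le> 1"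
  by (auto simp: clamp01_def)

lemma model_unmodel:
  assumes "y \<in> tiled"
  shows "model (unmodel y) = y" "unmodel y \<in> topspace X_Theta"
proof -
  obtain c z where y: "y = tile_map c z" using assms by (rule tiledE)
  obtain i e f where "square_over c i e f" using tile_map_unmodel[of c] by (elim exE)
  note f = this[unfolded square_over_def, THEN conjunct1] and t = this[unfolded square_over_def, THEN conjunct2]
  let ?p = "Inr (e, fst (clamp01 z))" and ?s = "f (snd (clamp01 z))"
  have p: "?p \<in> edge_pieces" using clamp01_bounds by (simp del: topspace_graph_pieces)
  have s: "0 \<le> ?s" "?s \<le> 1" using f clamp01_bounds[of z] by auto
  note z = edge_in_theta_pieces[OF p s, of i]
  have u: "unmodel y = theta_point (Inr (i, edge_point ?p, ?s))" "y = edge_piece i ?p ?s" using t y by blast+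
  show "model (unmodel y) = y"
    unfolding u(1) model_point[OF z] piece_model_edge[OF p] by (rule u(2)[symmetric])
  show "unmodel y \<in> topspace X_Theta"
    unfolding u(1) topspace_X_Theta using z by (rule imageI)
qed

lemma edge_piece_tiled: "edge_piece i p s \<in> tiled"
proof -
  have "tile_C k t s \<in> tiled" "tile_D k t s \<in> tiled" for k t s
    using tile_map_in_tiled[of "Tile_C k" "(t, s)"] tile_map_in_tiled[of "Tile_D k" "(t, s)"] by simp_all
  moreover have "edge_b k s \<in> tiled" for k s
    using tile_map_in_tiled[of "Tile_D k" "(0, s)"] by (simp add: tile_D_sides)
  ultimately show ?thesis by (cases "(i, p, s)" rule: edge_piece.cases) simp_all
qed

lemma vertex_piece_tiled: "vertex_piece v p \<in> tiled"
proof -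
  have "edge_a k t \<in> tiled" "edge_d k t \<in> tiled" for k t
    using tile_map_in_tiled[of "Tile_C k" "(t, 0)"] tile_map_in_tiled[of "Tile_D (k - 1)" "(t, 1)"]
    by (simp_all add: tile_C_def tile_D_sides)
  then show ?thesis by (cases "(v, p)" rule: vertex_piece.cases) simp_all
qed

lemma unmodel_model:
  assumes "x \<in> topspace X_Theta"
  shows "unmodel (model x) = x" "model x \<in> tiled"
proof -
  obtain z where z: "z \<in> topspace theta_pieces" "x = theta_point z"
    using assms unfolding topspace_X_Theta by (elim imageE)
  from z(1) have "unmodel (piece_model z) = theta_point z \<and> piece_model z \<in> tiled"
  proof (cases rule: theta_pieces_cases)
    case (1 v p)
    show ?thesis
      unfolding 1(2) piece_model_vertex[OF 1(1)] using unmodel_vertex_piece[OF 1(1)] vertex_piece_tiled by simp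
  next
    case (2 i p s)
    show ?thesis
      unfolding 2(4) piece_model_edge[OF 2(1)] using unmodel_edge_piece[OF 2(1-3)] edge_piece_tiled by simp
  qed
  then show "unmodel (model x) = x" "model x \<in> tiled"
    unfolding z(2) model_point[OF z(1)] by simp_all
qed

text \<open>Open sets are tested on tiles. Along a tile, \<open>unmodel\<close> is a composite of
  continuous maps: clamp, pass to an arc of an edge graph and a height, include into the disjoint
  union, project to the total space.\<close>

lemma continuous_unmodel: "continuous_map (top_of_set tiled) X_Theta unmodel"
  unfolding continuous_map_def
proof (intro conjI allI impI)
  show "unmodel \<in> topspace (top_of_set tiled) \<rightarrow> topspace X_Theta"
    using model_unmodel(2) by auto
  fix U assume U: "openin X_Theta U"
  have "open (tile_map c -` {y \<in> tiled. unmodel y \<in> U})" for c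
  proof -
    obtain i e f where "square_over c i e f" using tile_map_unmodel[of c] by (elim exE)
    note f = this[unfolded square_over_def, THEN conjunct1] and t = this[unfolded square_over_def, THEN conjunct2]
    let ?I = "top_of_set {0..1::real}"
    have "continuous_map euclidean ?I (\<lambda>z. fst (clamp01 z))"
      using clamp01_bounds by (auto simp: continuous_map_in_subtopology intro!: continuous_on_fst continuous_clamp01)
    from continuous_map_compose[OF this continuous_map_graph_piece[of e edge_graph]]
    have 1: "continuous_map euclidean (realization edge_graph) (\<lambda>z. edge_point (Inr (e, fst (clamp01 z))))"
      by (simp add: o_def)
    have "continuous_on UNIV (\<lambda>z. f (snd (clamp01 z)))"
      using f continuous_on_snd[OF continuous_clamp01, of UNIV] by (auto intro: continuous_intros)
    moreover have "f (snd (clamp01 z)) \<in> {0..1}" for z using f clamp01_bounds[of z] by auto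
    ultimately have 2: "continuous_map euclidean ?I (\<lambda>z. f (snd (clamp01 z)))"
      by (auto simp: continuous_map_in_subtopology)
    let ?E = "\<lambda>_ :: 3. prod_topology (realization edge_graph) ?I"
    have 3: "continuous_map euclidean (?E i) (\<lambda>z. (edge_point (Inr (e, fst (clamp01 z))), f (snd (clamp01 z))))"
      using 1 2 by (simp add: continuous_map_pairedI)
    have 4: "continuous_map (?E i) (sum_topology ?E UNIV) (\<lambda>x. (i, x))"
      by (rule continuous_map_component_injection) simp
    have "continuous_map theta_pieces theta_pieces (\<lambda>x. x)" by simp
    then have 5: "continuous_map (sum_topology ?E UNIV) theta_pieces Inr"
      by (subst (asm) theta_pieces_def) (simp add: total_pieces_def continuous_map_from_plus)
    have "continuous_map euclidean X_Theta (\<lambda>z. theta_point (Inr (i, edge_point (Inr (e, fst (clamp01 z))), f (snd (clamp01 z)))))"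
      using continuous_map_compose[OF continuous_map_compose[OF continuous_map_compose[OF 3 4] 5]
        quotient_imp_continuous_map[OF quotient_map_theta_point]]
      by (simp add: o_def)
    moreover have "(\<lambda>z. unmodel (tile_map c z)) =
        (\<lambda>z. theta_point (Inr (i, edge_point (Inr (e, fst (clamp01 z))), f (snd (clamp01 z)))))"
      using t by (intro ext) blast
    ultimately have "continuous_map euclidean X_Theta (\<lambda>z. unmodel (tile_map c z))"
      by (simp only:)
    then have "openin euclidean {z \<in> topspace euclidean. unmodel (tile_map c z) \<in> U}"
      using U by (rule openin_continuous_map_preimage)
    then show ?thesis by (simp add: vimage_def)
  qed
  then have "open {y \<in> tiled. unmodel y \<in> U}" by (simp add: open_cell_point_def)
  then show "openin (top_of_set tiled) {y \<in> topspace (top_of_set tiled). unmodel y \<in> U}"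
    by (simp add: openin_open_eq open_tiled Collect_mono_iff)
qed

section \<open>The fundamental group of the total space\<close>

lemma continuous_model_tiled: "continuous_map X_Theta (top_of_set tiled) model"
  unfolding continuous_map_in_subtopology
  by (intro conjI continuous_model funcsetI unmodel_model(2))

section \<open>Transfer of loops and homotopies to the model\<close>

lemma loop_model:
  assumes "p \<in> loops_at X_Theta x"
  shows "tiled_path (model \<circ> p)" "pathstart (model \<circ> p) = model x" "pathfinish (model \<circ> p) = model x"
proof -
  have p: "pathin X_Theta p" "p 0 = x" "p 1 = x" using assms by (simp_all add: loops_at_def)
  have "continuous_map (top_of_set {0..1}) (top_of_set tiled) (model \<circ> p)"
    using p(1) continuous_model_tiled unfolding pathin_def by (rule continuous_map_compose)
  then show "tiled_path (model \<circ> p)"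
    unfolding path_def path_image_def continuous_map_in_subtopology
    by (simp add: image_subset_iff_funcset del: comp_apply)
  show "pathstart (model \<circ> p) = model x" "pathfinish (model \<circ> p) = model x"
    using p by (simp_all add: pathstart_def pathfinish_def)
qed

lemma loop_in_topspace:
  assumes "p \<in> loops_at X_Theta x" "t \<in> {0..1}"
  shows "p t \<in> topspace X_Theta"
proof -
  have "continuous_map (top_of_set {0..1}) X_Theta p" using assms(1) by (simp add: loops_at_def pathin_def)
  from funcset_mem[OF continuous_map_funspace[OF this]] show ?thesis using assms(2) by simp
qed

text \<open>Outside the unit interval \<open>q\<close> may leave \<open>tiled\<close>, where the two
  maps are not inverse to each other. Agreement on the interval is enough for a homotopy.\<close>

lemma loop_unmodel:
  assumes x: "x \<in> topspace X_Theta"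
    and q: "tiled_path q" "pathstart q = model x" "pathfinish q = model x"
  shows "unmodel \<circ> q \<in> loops_at X_Theta x" "model \<circ> (unmodel \<circ> q) \<asymp> q"
proof -
  have qc: "continuous_map (top_of_set {0..1}) (top_of_set tiled) q"
    using q(1) unfolding path_def path_image_def continuous_map_in_subtopology
    by (simp add: image_subset_iff_funcset)
  have qt: "q t \<in> tiled" if "t \<in> {0..1}" for t
    using q(1) that by (auto simp: path_image_def)
  have "continuous_map (top_of_set {0..1}) X_Theta (unmodel \<circ> q)"
    using qc continuous_unmodel by (rule continuous_map_compose)
  then show "unmodel \<circ> q \<in> loops_at X_Theta x"
    using q(2,3) unmodel_model(1)[OF x] by (simp add: loops_at_def pathin_def pathstart_def pathfinish_def)
  show "model \<circ> (unmodel \<circ> q) \<asymp> q"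
    by (rule homotopic_paths_sym, rule homotopic_paths_eq) (use q(1) model_unmodel(1)[OF qt] in auto)
qed

lemma loop_homotopic_model:
  assumes "loop_homotopic X_Theta x p q" "p \<in> loops_at X_Theta x"
  shows "model \<circ> p \<asymp> model \<circ> q"
proof -
  have "homotopic_with (\<lambda>r. pathstart r = pathstart (model \<circ> p) \<and> pathfinish r = pathfinish (model \<circ> p))
      (top_of_set {0..1}) (top_of_set tiled) (model \<circ> p) (model \<circ> q)"
  proof (rule homotopic_with_compose_continuous_map_left[OF _ continuous_model_tiled])
    show "homotopic_with (\<lambda>r. r 0 = x \<and> r 1 = x) (top_of_set {0..1}) X_Theta p q"
      using assms(1) by (simp add: loop_homotopic_def)
  qed (use loop_model[OF assms(2)] in \<open>auto simp: pathstart_def pathfinish_def\<close>)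
  then show ?thesis by (simp add: homotopic_paths_def)
qed

lemma loop_homotopic_unmodel:
  assumes x: "x \<in> topspace X_Theta"
    and p: "p \<in> loops_at X_Theta x" and q: "q \<in> loops_at X_Theta x"
    and h: "model \<circ> p \<asymp> model \<circ> q"
  shows "loop_homotopic X_Theta x p q"
proof -
  have "homotopic_with (\<lambda>r. pathstart r = pathstart (model \<circ> p) \<and> pathfinish r = pathfinish (model \<circ> p))
      (top_of_set {0..1}) (top_of_set tiled) (model \<circ> p) (model \<circ> q)"
    using h by (simp add: homotopic_paths_def)
  then have "homotopic_with (\<lambda>r. r 0 = x \<and> r 1 = x) (top_of_set {0..1}) X_Theta
      (unmodel \<circ> (model \<circ> p)) (unmodel \<circ> (model \<circ> q))"
    by (rule homotopic_with_compose_continuous_map_left[OF _ continuous_unmodel])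
      (use loop_model[OF p] unmodel_model(1)[OF x] in \<open>auto simp: pathstart_def pathfinish_def\<close>)
  then have "homotopic_with (\<lambda>r. r 0 = x \<and> r 1 = x) (top_of_set {0..1}) X_Theta p q"
  proof (rule homotopic_with_eq)
    fix t assume "t \<in> topspace (top_of_set {0..1::real})"
    then show "p t = (unmodel \<circ> (model \<circ> p)) t" "q t = (unmodel \<circ> (model \<circ> q)) t"
      using loop_in_topspace[OF p] loop_in_topspace[OF q] unmodel_model(1) by auto
  qed auto
  then show ?thesis by (simp add: loop_homotopic_def)
qed

lemma model_path_concat: "model \<circ> path_concat p q = (model \<circ> p) +++ (model \<circ> q)"
  by (auto simp: path_concat_def joinpaths_def)

text \<open>Continuity is inherited from the join of paths in the model: \<open>model\<close> turns
  concatenation into a join, and \<open>unmodel\<close> brings it back.\<close>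

lemma path_concat_loop:
  assumes x: "x \<in> topspace X_Theta"
    and p: "p \<in> loops_at X_Theta x" and q: "q \<in> loops_at X_Theta x"
  shows "path_concat p q \<in> loops_at X_Theta x"
proof -
  have pq: "tiled_path ((model \<circ> p) +++ (model \<circ> q))" "pathstart ((model \<circ> p) +++ (model \<circ> q)) = model x"
    "pathfinish ((model \<circ> p) +++ (model \<circ> q)) = model x"
    using loop_model[OF p] loop_model[OF q] by simp_all
  have "unmodel \<circ> ((model \<circ> p) +++ (model \<circ> q)) \<in> loops_at X_Theta x"
    by (rule loop_unmodel(1)[OF x pq])
  moreover have "(unmodel \<circ> ((model \<circ> p) +++ (model \<circ> q))) t = path_concat p q t" if "t \<in> {0..1}" for t
    using that loop_in_topspace[OF p] loop_in_topspace[OF q]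
    by (auto simp: joinpaths_def path_concat_def unmodel_model(1))
  ultimately show ?thesis
    unfolding loops_at_def pathin_def
    by (auto intro: continuous_map_eq)
qed

lemma loop_class_eq_iff:
  assumes x: "x \<in> topspace X_Theta"
    and p: "p \<in> loops_at X_Theta x" and q: "q \<in> loops_at X_Theta x"
  shows "loop_class X_Theta x p = loop_class X_Theta x q \<longleftrightarrow> model \<circ> p \<asymp> model \<circ> q"
proof
  have "loop_homotopic X_Theta x q q"
    using loop_model(1)[OF q] by (intro loop_homotopic_unmodel[OF x q q]) simp
  then have "q \<in> loop_class X_Theta x q" by (simp add: loop_class_def)
  moreover assume "loop_class X_Theta x p = loop_class X_Theta x q"
  ultimately have "q \<in> loop_class X_Theta x p" by simp
  then show "model \<circ> p \<asymp> model \<circ> q"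
    using loop_homotopic_model[OF _ p] by (simp add: loop_class_def)
next
  assume "model \<circ> p \<asymp> model \<circ> q"
  then have h: "loop_homotopic X_Theta x p q" by (rule loop_homotopic_unmodel[OF x p q])
  then have h': "loop_homotopic X_Theta x q p"
    unfolding loop_homotopic_def by (rule homotopic_with_symD)
  show "loop_class X_Theta x p = loop_class X_Theta x q"
    unfolding loop_class_def using h h' unfolding loop_homotopic_def
    by (blast intro: homotopic_with_trans)
qed

lemma loop_classD:
  assumes "r \<in> loop_class X_Theta x p" "p \<in> loops_at X_Theta x"
  shows "r \<in> loops_at X_Theta x" "model \<circ> p \<asymp> model \<circ> r"
proof -
  have h: "loop_homotopic X_Theta x p r" using assms(1) by (simp add: loop_class_def)
  then have h': "homotopic_with (\<lambda>r. r 0 = x \<and> r 1 = x) (top_of_set {0..1}) X_Theta p r"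
    by (simp only: loop_homotopic_def)
  show "r \<in> loops_at X_Theta x"
    unfolding loops_at_def pathin_def
    using homotopic_with_imp_continuous_maps[OF h'] homotopic_with_imp_property[OF h'] by simp
  show "model \<circ> p \<asymp> model \<circ> r" by (rule loop_homotopic_model[OF h assms(2)])
qed

lemma loop_class_self:
  assumes "x \<in> topspace X_Theta" "p \<in> loops_at X_Theta x"
  shows "p \<in> loop_class X_Theta x p"
  unfolding loop_class_def using loop_model(1)[OF assms(2)]
  by (intro CollectI loop_homotopic_unmodel[OF assms assms(2)]) simp

text \<open>The product runs over all representatives. They yield a single class, because joins in
  the model respect homotopy.\<close>

lemma mult_loop_class:
  assumes x: "x \<in> topspace X_Theta"
    and p: "p \<in> loops_at X_Theta x" and q: "q \<in> loops_at X_Theta x"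
  shows "loop_class X_Theta x p \<otimes>\<^bsub>fundamental_group X_Theta x\<^esub> loop_class X_Theta x q
    = loop_class X_Theta x (path_concat p q)"
proof -
  have "loop_homotopic X_Theta x (path_concat p' q') r \<longleftrightarrow> loop_homotopic X_Theta x (path_concat p q) r"
    if "p' \<in> loop_class X_Theta x p" "q' \<in> loop_class X_Theta x q" for p' q' r
  proof -
    note P = loop_classD[OF that(1) p] and Q = loop_classD[OF that(2) q]
    have "model \<circ> path_concat p' q' \<asymp> model \<circ> path_concat p q"
      unfolding model_path_concat
      using homotopic_paths_sym[OF P(2)] homotopic_paths_sym[OF Q(2)] loop_model[OF P(1)] loop_model[OF Q(1)]
      by (intro homotopic_paths_join) simp_all
    then have "loop_class X_Theta x (path_concat p' q') = loop_class X_Theta x (path_concat p q)"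
      using loop_class_eq_iff[OF x path_concat_loop[OF x P(1) Q(1)] path_concat_loop[OF x p q]] by blast
    then show ?thesis unfolding loop_class_def by blast
  qed
  moreover have "p \<in> loop_class X_Theta x p" "q \<in> loop_class X_Theta x q"
    using loop_class_self[OF x p] loop_class_self[OF x q] .
  ultimately have "(\<exists>p'\<in>loop_class X_Theta x p. \<exists>q'\<in>loop_class X_Theta x q. loop_homotopic X_Theta x (path_concat p' q') r)
      \<longleftrightarrow> loop_homotopic X_Theta x (path_concat p q) r" for r
    by blast
  then have "{r. \<exists>p'\<in>loop_class X_Theta x p. \<exists>q'\<in>loop_class X_Theta x q. loop_homotopic X_Theta x (path_concat p' q') r}
      = loop_class X_Theta x (path_concat p q)"
    unfolding loop_class_def[of _ _ "path_concat p q"] by (rule Collect_cong)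
  then show ?thesis by (simp add: fundamental_group_def)
qed

section \<open>The holonomy as an embedding of the fundamental group\<close>

definition holonomy_map :: "_ \<Rightarrow> (real \<Rightarrow> _) set \<Rightarrow> artin_gen word set" where
  "holonomy_map x P = the_elem ((\<lambda>p. based_hol (model x) (model \<circ> p)) ` P)"

lemma holonomy_map_class:
  assumes x: "x \<in> topspace X_Theta" and p: "p \<in> loops_at X_Theta x"
  shows "holonomy_map x (loop_class X_Theta x p) = based_hol (model x) (model \<circ> p)"
  unfolding holonomy_map_def
proof (rule the_elem_image_unique)
  show "loop_class X_Theta x p \<noteq> {}" using loop_class_self[OF x p] by blast
  fix r assume "r \<in> loop_class X_Theta x p"
  from based_hol_homotopic[OF loop_classD(2)[OF this p] loop_model(2,3)[OF p]]
  show "based_hol (model x) (model \<circ> r) = based_hol (model x) (model \<circ> p)" by (rule HOL.sym)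
qed

lemma carrier_fundamental_group: "carrier (fundamental_group X_Theta x) = loop_class X_Theta x ` loops_at X_Theta x"
  by (simp add: fundamental_group_def)

text \<open>Words traced by loops have degree 0, and conversely every such word lifts to a loop. The
  image is thus the same subgroup for all base points.\<close>

lemma holonomy_map_image:
  assumes x: "x \<in> topspace X_Theta"
  shows "holonomy_map x ` carrier (fundamental_group X_Theta x) = degree_kernel"
proof (intro equalityI subsetI)
  fix g assume "g \<in> holonomy_map x ` carrier (fundamental_group X_Theta x)"
  then obtain p where p: "p \<in> loops_at X_Theta x" "g = holonomy_map x (loop_class X_Theta x p)"
    unfolding carrier_fundamental_group by blast
  obtain w where "word_degree w = 0" "based_hol (model x) (model \<circ> p) = artin_class w"
    by (rule loop_lift_word[OF loop_model[OF p(1)]])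
  then show "g \<in> degree_kernel"
    unfolding p(2) holonomy_map_class[OF x p(1)] by (simp add: degree_kernel_iff)
next
  fix g assume "g \<in> degree_kernel"
  then obtain w where w: "g = artin_class w" "word_degree w = 0" unfolding degree_kernel_def by blast
  obtain q where q: "tiled_path q" "pathstart q = model x" "pathfinish q = model x"
    "based_hol (model x) q = artin_class w"
    by (rule based_hol_surj[OF unmodel_model(2)[OF x] w(2)])
  note u = loop_unmodel[OF x q(1-3)]
  have "holonomy_map x (loop_class X_Theta x (unmodel \<circ> q)) = g"
    unfolding holonomy_map_class[OF x u(1)] w(1) q(4)[symmetric]
    by (rule based_hol_homotopic[OF u(2) loop_model(2,3)[OF u(1)]])
  then show "g \<in> holonomy_map x ` carrier (fundamental_group X_Theta x)"
    unfolding carrier_fundamental_group using u(1) by blast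
qed

lemma holonomy_map_mon:
  assumes x: "x \<in> topspace X_Theta"
  shows "holonomy_map x \<in> mon (fundamental_group X_Theta x) artin_23inf"
  unfolding mon_def
proof (intro CollectI conjI homI inj_onI)
  fix P assume "P \<in> carrier (fundamental_group X_Theta x)"
  then show "holonomy_map x P \<in> carrier artin_23inf"
    using holonomy_map_image[OF x] subgroup.subset[OF subgroup_degree_kernel] by blast
next
  fix P Q assume "P \<in> carrier (fundamental_group X_Theta x)" "Q \<in> carrier (fundamental_group X_Theta x)"
  then obtain p q where p: "p \<in> loops_at X_Theta x" "P = loop_class X_Theta x p"
    and q: "q \<in> loops_at X_Theta x" "Q = loop_class X_Theta x q"
    unfolding carrier_fundamental_group by blast
  show "holonomy_map x (P \<otimes>\<^bsub>fundamental_group X_Theta x\<^esub> Q) = holonomy_map x P \<cdot> holonomy_map x Q"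
    unfolding p(2) q(2) mult_loop_class[OF x p(1) q(1)] holonomy_map_class[OF x p(1)] holonomy_map_class[OF x q(1)]
      holonomy_map_class[OF x path_concat_loop[OF x p(1) q(1)]] model_path_concat
    by (rule based_hol_join[OF loop_model[OF p(1)] loop_model[OF q(1)]])
next
  fix P Q assume "P \<in> carrier (fundamental_group X_Theta x)" "Q \<in> carrier (fundamental_group X_Theta x)"
    and eq: "holonomy_map x P = holonomy_map x Q"
  then obtain p q where p: "p \<in> loops_at X_Theta x" "P = loop_class X_Theta x p"
    and q: "q \<in> loops_at X_Theta x" "Q = loop_class X_Theta x q"
    unfolding carrier_fundamental_group by blast
  from eq have "based_hol (model x) (model \<circ> p) = based_hol (model x) (model \<circ> q)"
    unfolding p(2) q(2) holonomy_map_class[OF x p(1)] holonomy_map_class[OF x q(1)] .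
  then have "model \<circ> p \<asymp> model \<circ> q"
    by (rule based_hol_inj[OF loop_model[OF p(1)] loop_model[OF q(1)]])
  then show "P = Q"
    unfolding p(2) q(2) using loop_class_eq_iff[OF x p(1) q(1)] by blast
qed

theorem proposition8:
  assumes "x\<^sub>0 \<in> topspace X_Theta"
  shows "\<exists>h \<in> mon (fundamental_group X_Theta x\<^sub>0) artin_23inf.
           subgroup (h ` carrier (fundamental_group X_Theta x\<^sub>0)) artin_23inf \<and>
           card (rcosets\<^bsub>artin_23inf\<^esub> (h ` carrier (fundamental_group X_Theta x\<^sub>0))) = 6"
  using holonomy_map_mon[OF assms] subgroup_degree_kernel card_rcosets_degree_kernel
  by (intro bexI[of _ "holonomy_map x\<^sub>0"]) (simp_all add: holonomy_map_image[OF assms])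

end
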